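(* Let $B$ be a planar polygon containing the origin and let $p>0$. Let $M$ be: - the plane with density $r^p$, if the origin is contained in the interior of $B$; - the half plane with density $r^p$ (the origin lying on its boundary line), if the origin is contained in the boundary of $B$ but is not a vertex; - the $\theta_0$-sector with density $r^p$, if the origin is a vertex of $B$ of angle $\theta_0$. Then for sufficiently small areas, isoperimetric regions in $B$ with density $r^p$ are the same as those in $M$, in the natural sense: there is $A^*>0$ such that for every $0<A<A^*$ the isoperimetric regions of weighted area $A$ in $B$ are exactly the isoperimetric regions of weighted area $A$ in $M$, under the natural identification of a neighborhood of the origin in $B$ with a neighborhood of the origin in $M$.
   Context: $r$ is distance to the origin. Density $r^p$ means that weighted area is $\int r^p\,dA_0$ and weighted perimeter is $\int r^p\,ds_0$ with Euclidean area and arclength. The $\theta_0$-sector is $\{(r,\theta):r\ge0,\ 0\le\theta\le\theta_0\}$ with metric $dr^2+r^2d\theta^2$. In $B$ and in $M$, the part of a region's boundary lying in the boundary of the ambient space ($B$, half plane or sector) is not counted in perimeter. A region is isoperimetric if it has least weighted perimeter among regions of the ambient space with the same weighted area. *)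

theory Defs
  imports "HOL-Analysis.Analysis"
begin

section \<open>Arclength on subsets of the plane\<close>

text \<open>
  The library has no Hausdorff measures, so arclength in the plane is introduced as
  one-dimensional Hausdorff measure.  The guard \<^const>\<open>bounded\<close> is needed because
  \<^const>\<open>diameter\<close> is meaningless on unbounded sets.
\<close>

definition hausdorff1_pre :: "real \<Rightarrow> complex set \<Rightarrow> ennreal" where
  "hausdorff1_pre \<delta> S =
     (INF U \<in> {U :: nat \<Rightarrow> complex set. S \<subseteq> (\<Union>i. U i) \<and> (\<forall>i. bounded (U i) \<and> diameter (U i) \<le> \<delta>)}.
        \<Sum>i. ennreal (diameter (U i)))"

definition hausdorff1 :: "complex set \<Rightarrow> ennreal" where
  "hausdorff1 S = (SUP \<delta>\<in>{0<..}. hausdorff1_pre \<delta> S)"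

definition arclength :: "complex measure" where
  "arclength = measure_of UNIV (sets borel) hausdorff1"

text \<open>\<^const>\<open>measure_of\<close> is the null measure unless its argument is countably additive;
  the following lemmas show that it is.\<close>

lemma hausdorff1_pre_mono: "S \<subseteq> T \<Longrightarrow> hausdorff1_pre \<delta> S \<le> hausdorff1_pre \<delta> T"
  unfolding hausdorff1_pre_def by (rule INF_superset_mono) auto

lemma hausdorff1_pre_antimono:
  assumes "\<delta> \<le> \<epsilon>" shows "hausdorff1_pre \<epsilon> S \<le> hausdorff1_pre \<delta> S"
  unfolding hausdorff1_pre_def
  by (rule INF_superset_mono) (use assms in \<open>auto intro: order_trans\<close>)

lemma hausdorff1_pre_le:
  assumes "S \<subseteq> (\<Union>i. U i)" "\<And>i. bounded (U i)" "\<And>i. diameter (U i) \<le> \<delta>"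
  shows "hausdorff1_pre \<delta> S \<le> (\<Sum>i. ennreal (diameter (U i)))"
  unfolding hausdorff1_pre_def by (rule INF_lower) (use assms in auto)

lemma hausdorff1_mono: "S \<subseteq> T \<Longrightarrow> hausdorff1 S \<le> hausdorff1 T"
  unfolding hausdorff1_def by (intro SUP_mono) (auto intro: hausdorff1_pre_mono)

lemma hausdorff1_pre_le_hausdorff1: "0 < \<delta> \<Longrightarrow> hausdorff1_pre \<delta> S \<le> hausdorff1 S"
  unfolding hausdorff1_def by (rule SUP_upper) auto

lemma hausdorff1_empty: "hausdorff1 {} = 0"
proof -
  have "hausdorff1_pre \<delta> {} = 0" if "0 < \<delta>" for \<delta>
    using hausdorff1_pre_le[of "{}" "\<lambda>_. {}" \<delta>] that by simp
  then have "(SUP \<delta>\<in>{0<..}. hausdorff1_pre \<delta> {}) \<le> 0"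
    by (intro SUP_least) auto
  then show ?thesis unfolding hausdorff1_def by simp
qed

lemma hausdorff1_pre_UN:
  "hausdorff1_pre \<delta> (\<Union>n::nat. A n) \<le> (\<Sum>n. hausdorff1_pre \<delta> (A n))"
proof (cases "\<exists>n. hausdorff1_pre \<delta> (A n) = \<infinity>")
  case True
  then obtain n where n: "hausdorff1_pre \<delta> (A n) = \<infinity>" by blast
  have "hausdorff1_pre \<delta> (A n) \<le> (\<Sum>n. hausdorff1_pre \<delta> (A n))"
    using sum_le_suminf[of "\<lambda>n. hausdorff1_pre \<delta> (A n)" "{n}"] by simp
  with n show ?thesis by (simp add: top_unique)
next
  case False
  show ?thesis
  proof (rule ennreal_le_epsilon)
    fix e :: real assume e: "0 < e"
    have "\<exists>U. A n \<subseteq> (\<Union>i::nat. U i) \<and> (\<forall>i. bounded (U i) \<and> diameter (U i) \<le> \<delta>) \<and>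
            (\<Sum>i. ennreal (diameter (U i))) \<le> hausdorff1_pre \<delta> (A n) + e * (1/2)^Suc n" for n
    proof -
      have "hausdorff1_pre \<delta> (A n) < hausdorff1_pre \<delta> (A n) + e * (1/2)^Suc n"
        using False e ennreal_add_left_cancel_less[of "hausdorff1_pre \<delta> (A n)" 0 "e * (1/2)^Suc n"]
        by (simp add: infinity_ennreal_def)
      then show ?thesis
        unfolding hausdorff1_pre_def INF_less_iff by (auto intro: less_imp_le)
    qed
    then obtain U where U: "\<And>n. A n \<subseteq> (\<Union>i::nat. U n i)"
        "\<And>n i. bounded (U n i)" "\<And>n i. diameter (U n i) \<le> \<delta>"
        "\<And>n. (\<Sum>i. ennreal (diameter (U n i))) \<le> hausdorff1_pre \<delta> (A n) + e * (1/2)^Suc n"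
      by metis
    define V where "V = (\<lambda>k. case prod_decode k of (n, i) \<Rightarrow> U n i)"
    have "(\<Union>n. A n) \<subseteq> (\<Union>k. V k)"
    proof
      fix x assume "x \<in> (\<Union>n. A n)"
      then obtain n i where "x \<in> U n i" using U(1) by blast
      then have "x \<in> V (prod_encode (n, i))" by (simp add: V_def)
      then show "x \<in> (\<Union>k. V k)" by blast
    qed
    then have "hausdorff1_pre \<delta> (\<Union>n. A n) \<le> (\<Sum>k. ennreal (diameter (V k)))"
      by (rule hausdorff1_pre_le) (auto simp: V_def U split: prod.split)
    also have "\<dots> = (\<Sum>k. (\<lambda>(n, i). ennreal (diameter (U n i))) (prod_decode k))"
      by (simp add: V_def split_def)
    also have "\<dots> = (\<Sum>n. \<Sum>i. ennreal (diameter (U n i)))"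
      by (rule suminf_ennreal_2dimen) simp
    also have "\<dots> \<le> (\<Sum>n. hausdorff1_pre \<delta> (A n) + e * (1/2)^Suc n)"
      by (intro suminf_le U summableI)
    also have "\<dots> = (\<Sum>n. hausdorff1_pre \<delta> (A n)) + (\<Sum>n. ennreal (e * (1/2)^Suc n))"
      by (rule suminf_add[symmetric]) (rule summableI)+
    also have "(\<Sum>n. ennreal (e * (1/2)^Suc n)) = ennreal e"
    proof (rule suminf_ennreal_eq)
      show "(\<lambda>n. e * (1/2)^Suc n) sums e"
        using sums_mult[OF power_half_series, of e] by simp
    qed (use e in simp)
    finally show "hausdorff1_pre \<delta> (\<Union>n. A n) \<le> (\<Sum>n. hausdorff1_pre \<delta> (A n)) + e" .
  qed
qed

lemma hausdorff1_UN: "hausdorff1 (\<Union>n::nat. A n) \<le> (\<Sum>n. hausdorff1 (A n))"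
proof -
  have "hausdorff1_pre \<delta> (\<Union>n. A n) \<le> (\<Sum>n. hausdorff1 (A n))" if "0 < \<delta>" for \<delta>
    by (rule order_trans[OF hausdorff1_pre_UN])
       (intro suminf_le summableI hausdorff1_pre_le_hausdorff1 that)
  then show ?thesis
    by (subst hausdorff1_def) (auto intro: SUP_least)
qed

lemma hausdorff1_Un: "hausdorff1 (S \<union> T) \<le> hausdorff1 S + hausdorff1 T"
proof -
  have *: "range (\<lambda>n::nat. if n = 0 then S else if n = 1 then T else {}) = {S, T, {}}"
  proof -
    have "{S, T, {}} \<subseteq> range (\<lambda>n::nat. if n = 0 then S else if n = 1 then T else {})"
      using rangeI[of "\<lambda>n::nat. if n = 0 then S else if n = 1 then T else {}" 0]
        rangeI[of "\<lambda>n::nat. if n = 0 then S else if n = 1 then T else {}" 1]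
        rangeI[of "\<lambda>n::nat. if n = 0 then S else if n = 1 then T else {}" 2]
      by simp
    then show ?thesis by auto
  qed
  have "hausdorff1 (\<Union>n::nat. if n = 0 then S else if n = 1 then T else {})
      \<le> (\<Sum>n. hausdorff1 (if n = 0 then S else if n = 1 then T else {}))"
    by (rule hausdorff1_UN)
  also have "\<dots> = (\<Sum>n\<in>{0,1::nat}. hausdorff1 (if n = 0 then S else if n = 1 then T else {}))"
    by (rule suminf_finite) (auto simp: hausdorff1_empty)
  finally show ?thesis by (simp add: * Un_commute)
qed

lemma hausdorff1_separated:
  assumes d: "0 < d" "\<And>x y. x \<in> S \<Longrightarrow> y \<in> T \<Longrightarrow> d \<le> dist x y"
  shows "hausdorff1 S + hausdorff1 T \<le> hausdorff1 (S \<union> T)"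
proof -
  have key: "hausdorff1_pre \<delta> S + hausdorff1_pre \<delta> T \<le> hausdorff1_pre \<delta> (S \<union> T)"
    if \<delta>: "0 < \<delta>" "\<delta> < d" for \<delta>
    unfolding hausdorff1_pre_def[of \<delta> "S \<union> T"]
  proof (rule INF_greatest, clarify)
    fix U :: "nat \<Rightarrow> complex set"
    assume cov: "S \<union> T \<subseteq> (\<Union>i. U i)" and U: "\<forall>i. bounded (U i) \<and> diameter (U i) \<le> \<delta>"
    define V where "V i = (if U i \<inter> S = {} then {} else U i)" for i
    define W where "W i = (if U i \<inter> S = {} then U i else {})" for i
    have disj: "U i \<inter> T = {}" if "U i \<inter> S \<noteq> {}" for i
    proof (rule ccontr)
      assume "U i \<inter> T \<noteq> {}"
      with that obtain x y where xy: "x \<in> U i" "x \<in> S" "y \<in> U i" "y \<in> T" by blast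
      then have "dist x y \<le> \<delta>"
        using U diameter_bounded_bound order_trans by metis
      with d(2) xy \<delta> show False by fastforce
    qed
    have S: "S \<subseteq> (\<Union>i. V i)" using cov by (force simp: V_def)
    have T: "T \<subseteq> (\<Union>i. W i)"
    proof
      fix x assume "x \<in> T"
      then obtain i where "x \<in> U i" using cov by blast
      with \<open>x \<in> T\<close> disj[of i] have "x \<in> W i" by (auto simp: W_def)
      then show "x \<in> (\<Union>i. W i)" by blast
    qed
    have "hausdorff1_pre \<delta> S + hausdorff1_pre \<delta> T
        \<le> (\<Sum>i. ennreal (diameter (V i))) + (\<Sum>i. ennreal (diameter (W i)))"
      by (intro add_mono hausdorff1_pre_le S T) (use U \<delta> in \<open>auto simp: V_def W_def\<close>)
    also have "\<dots> = (\<Sum>i. ennreal (diameter (V i)) + ennreal (diameter (W i)))"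
      by (rule suminf_add) (rule summableI)+
    also have "\<dots> = (\<Sum>i. ennreal (diameter (U i)))"
      by (rule suminf_cong) (simp add: V_def W_def)
    finally show "hausdorff1_pre \<delta> S + hausdorff1_pre \<delta> T \<le> (\<Sum>i. ennreal (diameter (U i)))" .
  qed
  have pre: "hausdorff1_pre \<delta> S + hausdorff1_pre \<epsilon> T \<le> hausdorff1 (S \<union> T)"
    if "0 < \<delta>" "0 < \<epsilon>" for \<delta> \<epsilon>
  proof -
    define \<eta> where "\<eta> = Min {\<delta>, \<epsilon>, d/2}"
    have \<eta>: "0 < \<eta>" "\<eta> \<le> \<delta>" "\<eta> \<le> \<epsilon>" "\<eta> < d" using that d(1) by (auto simp: \<eta>_def)
    have "hausdorff1_pre \<delta> S + hausdorff1_pre \<epsilon> T \<le> hausdorff1_pre \<eta> S + hausdorff1_pre \<eta> T"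
      by (intro add_mono hausdorff1_pre_antimono \<eta>)
    also have "\<dots> \<le> hausdorff1_pre \<eta> (S \<union> T)" by (rule key) (use \<eta> in auto)
    also have "\<dots> \<le> hausdorff1 (S \<union> T)" by (rule hausdorff1_pre_le_hausdorff1) (use \<eta> in auto)
    finally show ?thesis .
  qed
  have ne: "{0::real<..} \<noteq> {}" by (auto intro: exI[of _ 1])
  have 1: "hausdorff1_pre \<delta> S + hausdorff1 T \<le> hausdorff1 (S \<union> T)" if "0 < \<delta>" for \<delta>
    unfolding hausdorff1_def[of T] ennreal_SUP_add_right[OF ne]
    by (rule SUP_least) (use pre that in auto)
  show ?thesis
    unfolding hausdorff1_def[of S] ennreal_SUP_add_left[OF ne, symmetric]
    by (rule SUP_least) (use 1 in auto)
qed

lemma hausdorff1_separated_eq: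
  assumes "0 < d" "\<And>x y. x \<in> S \<Longrightarrow> y \<in> T \<Longrightarrow> d \<le> dist x y"
  shows "hausdorff1 (S \<union> T) = hausdorff1 S + hausdorff1 T"
  using hausdorff1_separated[OF assms] hausdorff1_Un by (rule antisym[rotated])

lemma hausdorff1_closed_split:
  assumes "closed C"
  shows "hausdorff1 (A \<inter> C) + hausdorff1 (A - C) \<le> hausdorff1 A"
proof (cases "C = {} \<or> hausdorff1 A = \<infinity>")
  case True
  then show ?thesis by (auto simp: hausdorff1_empty)
next
  case False
  then have C: "C \<noteq> {}" and fin: "hausdorff1 A \<noteq> \<infinity>" by auto
  define f where "f x = infdist x C" for x
  have f_lip: "f x - f y \<le> dist x y" for x y
    using infdist_triangle[of x C y] by (simp add: f_def)
  have f_C: "f x = 0" if "x \<in> C" for x using that by (simp add: f_def)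
  have f_pos: "0 < f x" if "x \<notin> C" for x
    using that in_closed_iff_infdist_zero[OF assms C, of x] infdist_nonneg[of x C]
    by (simp add: f_def)
  define a where "a n = {x\<in>A. 1 / real (n + 1) \<le> f x}" for n :: nat
  define R where "R k = {x\<in>A. 1 / real (k + 2) \<le> f x \<and> f x < 1 / real (k + 1)}" for k :: nat
  define S where "S = (\<Sum>k. hausdorff1 (R k))"
  have half: "(\<Sum>k<n. hausdorff1 (R (2 * k + j))) = hausdorff1 (\<Union>k<n. R (2 * k + j))" for n j
  proof (induction n)
    case 0
    show ?case by (simp add: hausdorff1_empty)
  next
    case (Suc n)
    let ?d = "1 / real (2 * n + j) - 1 / real (2 * n + j + 1)"
    show ?case
    proof (cases "n = 0")
      case True
      then show ?thesis by (simp add: lessThan_Suc)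
    next
      case n: False
      have "(\<Union>k<Suc n. R (2 * k + j)) = (\<Union>k<n. R (2 * k + j)) \<union> R (2 * n + j)"
        by (auto simp: lessThan_Suc)
      moreover have "hausdorff1 ((\<Union>k<n. R (2 * k + j)) \<union> R (2 * n + j))
          = hausdorff1 (\<Union>k<n. R (2 * k + j)) + hausdorff1 (R (2 * n + j))"
      proof (rule hausdorff1_separated_eq)
        have "1 / real (2 * n + j + 1) < 1 / real (2 * n + j)"
          by (rule divide_strict_left_mono) (use n in auto)
        then show "0 < ?d" by linarith
        fix x y assume "x \<in> (\<Union>k<n. R (2 * k + j))" and y: "y \<in> R (2 * n + j)"
        then obtain k where k: "k < n" "x \<in> R (2 * k + j)" by auto
        have "1 / real (2 * n + j) \<le> 1 / real (2 * k + j + 2)"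
          using k(1) by (intro divide_left_mono) auto
        also have "\<dots> \<le> f x" using k(2) by (simp add: R_def)
        finally have "?d \<le> f x - f y" using y by (simp add: R_def)
        then show "?d \<le> dist x y" using f_lip[of x y] by linarith
      qed
      ultimately show ?thesis using Suc.IH by simp
    qed
  qed
  have half_le: "(\<Sum>k<n. hausdorff1 (R (2 * k + j))) \<le> hausdorff1 A" for n j
    unfolding half by (rule hausdorff1_mono) (auto simp: R_def)
  have "S \<le> hausdorff1 A + hausdorff1 A"
    unfolding S_def
  proof (rule suminf_le_const[OF summableI])
    fix n
    have "(\<Sum>k<n. hausdorff1 (R k)) \<le> (\<Sum>k<2*n. hausdorff1 (R k))"
      by (rule sum_mono2) auto
    also have "\<dots> = (\<Sum>k<n. hausdorff1 (R (2 * k + 0))) + (\<Sum>k<n. hausdorff1 (R (2 * k + 1)))"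
      by (induction n) (simp_all add: ac_simps)
    also have "\<dots> \<le> hausdorff1 A + hausdorff1 A"
      by (intro add_mono half_le)
    finally show "(\<Sum>k<n. hausdorff1 (R k)) \<le> hausdorff1 A + hausdorff1 A" .
  qed
  then have S_fin: "S \<noteq> \<infinity>" using fin by (auto simp: top_unique infinity_ennreal_def)
  have step: "hausdorff1 (A \<inter> C) + hausdorff1 (A - C) + (\<Sum>k<n. hausdorff1 (R k)) \<le> hausdorff1 A + S"
    for n
  proof -
    have cov: "A - C \<subseteq> a n \<union> (\<Union>k. R (k + n))"
    proof
      fix x assume x: "x \<in> A - C"
      show "x \<in> a n \<union> (\<Union>k. R (k + n))"
      proof (cases "x \<in> a n")
        case False
        then have lt: "f x < 1 / real (n + 1)" using x by (auto simp: a_def)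
        define m where "m = (LEAST m. 1 / real (m + 1) \<le> f x)"
        obtain m0 where "1 / real (Suc m0) < f x"
          using nat_approx_posE[of "f x"] f_pos x by auto
        then have "1 / real (m0 + 1) \<le> f x" by simp
        then have m: "1 / real (m + 1) \<le> f x"
          unfolding m_def by (rule LeastI[of "\<lambda>m. 1 / real (m + 1) \<le> f x"])
        have nm: "n < m"
        proof (rule ccontr)
          assume "\<not> n < m"
          then have "1 / real (n + 1) \<le> 1 / real (m + 1)"
            by (intro divide_left_mono) auto
          then show False using lt m by linarith
        qed
        then have "f x < 1 / real (m - 1 + 1)"
          using not_less_Least[of "m - 1" "\<lambda>m. 1 / real (m + 1) \<le> f x"]
          unfolding m_def[symmetric] by auto
        then have "x \<in> R (m - 1)"
          using x m nm by (auto simp: R_def of_nat_diff)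
        moreover have "m - 1 = (m - 1 - n) + n" using nm by simp
        ultimately show ?thesis by (metis UN_I UNIV_I UnI2)
      qed simp
    qed
    have "hausdorff1 (A \<inter> C) + hausdorff1 (a n) = hausdorff1 (A \<inter> C \<union> a n)"
    proof (rule hausdorff1_separated_eq[symmetric])
      show "0 < 1 / real (n + 1)" by simp
      fix x y assume "x \<in> A \<inter> C" "y \<in> a n"
      then show "1 / real (n + 1) \<le> dist x y"
        using f_lip[of y x] f_C[of x] by (auto simp: a_def dist_commute)
    qed
    also have "\<dots> \<le> hausdorff1 A" by (rule hausdorff1_mono) (auto simp: a_def)
    finally have le: "hausdorff1 (A \<inter> C) + hausdorff1 (a n) \<le> hausdorff1 A" .
    have "hausdorff1 (A - C) \<le> hausdorff1 (a n \<union> (\<Union>k. R (k + n)))"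
      by (rule hausdorff1_mono[OF cov])
    also have "\<dots> \<le> hausdorff1 (a n) + (\<Sum>k. hausdorff1 (R (k + n)))"
      by (rule order_trans[OF hausdorff1_Un]) (intro add_mono order_refl hausdorff1_UN)
    finally have "hausdorff1 (A \<inter> C) + hausdorff1 (A - C) + (\<Sum>k<n. hausdorff1 (R k))
        \<le> hausdorff1 (A \<inter> C) + (hausdorff1 (a n) + (\<Sum>k. hausdorff1 (R (k + n))))
            + (\<Sum>k<n. hausdorff1 (R k))"
      by (intro add_mono order_refl)
    also have "\<dots> = (hausdorff1 (A \<inter> C) + hausdorff1 (a n)) +
          ((\<Sum>k. hausdorff1 (R (k + n))) + (\<Sum>k<n. hausdorff1 (R k)))"
      by (simp add: ac_simps)
    also have "(\<Sum>k. hausdorff1 (R (k + n))) + (\<Sum>k<n. hausdorff1 (R k)) = S"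
      unfolding S_def by (rule suminf_offset[symmetric]) (rule summableI)
    also have "hausdorff1 (A \<inter> C) + hausdorff1 (a n) + S \<le> hausdorff1 A + S"
      by (intro add_mono le order_refl)
    finally show ?thesis .
  qed
  have "hausdorff1 (A \<inter> C) + hausdorff1 (A - C) + S
      = (SUP n. hausdorff1 (A \<inter> C) + hausdorff1 (A - C) + (\<Sum>k<n. hausdorff1 (R k)))"
    unfolding S_def suminf_eq_SUP by (rule ennreal_SUP_add_right) simp
  also have "\<dots> \<le> hausdorff1 A + S"
    by (rule SUP_least) (rule step)
  finally show ?thesis
    using S_fin by (simp add: infinity_ennreal_def ac_simps)
qed

lemma hausdorff1_measure_space: "measure_space UNIV (sets borel) hausdorff1"
proof -
  have om: "outer_measure_space UNIV hausdorff1"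
    unfolding outer_measure_space_def positive_def increasing_def countably_subadditive_def
    using hausdorff1_empty hausdorff1_mono hausdorff1_UN by auto
  interpret sigma_algebra "UNIV :: complex set" UNIV
    by (rule sigma_algebra_iff2[THEN iffD2]) auto
  have ms: "measure_space UNIV (lambda_system UNIV UNIV hausdorff1) hausdorff1"
    using caratheodory_lemma[OF om] .
  then interpret L: sigma_algebra UNIV "lambda_system UNIV UNIV hausdorff1"
    by (simp add: measure_space_def)
  have "C \<in> lambda_system UNIV UNIV hausdorff1" if "closed C" for C
  proof -
    have "hausdorff1 (A \<inter> C) + hausdorff1 (A - C) = hausdorff1 A" for A
      using hausdorff1_closed_split[OF that, of A] hausdorff1_Un[of "A \<inter> C" "A - C"]
      by (simp add: Int_Diff_Un antisym)
    then show ?thesis by (simp add: lambda_system_eq)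
  qed
  then have "sigma_sets UNIV (Collect closed) \<subseteq> lambda_system UNIV UNIV hausdorff1"
    by (intro L.sigma_sets_subset) auto
  then have "sets borel \<subseteq> lambda_system UNIV UNIV hausdorff1"
    by (simp add: borel_eq_closed)
  moreover have "sigma_algebra (UNIV :: complex set) (sets borel)"
    using sets.sigma_algebra_axioms[of "borel :: complex measure"] by simp
  ultimately show ?thesis
    by (intro measure_down[OF ms])
qed

lemma sets_arclength: "sets arclength = sets borel"
  unfolding arclength_def using sets.sigma_sets_eq[of "borel :: complex measure"]
  by (simp add: sets_measure_of)

lemma emeasure_arclength: "S \<in> sets borel \<Longrightarrow> emeasure arclength S = hausdorff1 S"
  using emeasure_measure_of[OF arclength_def, of S] hausdorff1_measure_space
  by (simp add: measure_space_def sets_arclength)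


section \<open>Isoperimetric regions for the density \<open>r\<^sup>p\<close>\<close>

text \<open>Ambient spaces are closed subsets of the plane.  A region is a closed set without
  lower-dimensional parts; this singles out one representative of each class of sets that differ by
  a null set, so that isoperimetric regions can be compared as sets.  Regions need be neither
  connected nor bounded, and no regularity of the boundary is assumed: a region whose boundary has
  infinite weighted length has weighted perimeter \<open>\<infinity>\<close>.\<close>

definition region :: "complex set \<Rightarrow> complex set \<Rightarrow> bool" where
  "region M E \<longleftrightarrow> E \<subseteq> M \<and> closure (interior E) = E"

definition weighted_area :: "real \<Rightarrow> complex set \<Rightarrow> ennreal" where
  "weighted_area p E = (\<integral>\<^sup>+z\<in>E. ennreal (norm z powr p) \<partial>lborel)"

definition weighted_perimeter :: "real \<Rightarrow> complex set \<Rightarrow> complex set \<Rightarrow> ennreal" where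
  "weighted_perimeter p M E =
     (\<integral>\<^sup>+z\<in>frontier E - frontier M. ennreal (norm z powr p) \<partial>arclength)"

definition isoperimetric :: "real \<Rightarrow> complex set \<Rightarrow> real \<Rightarrow> complex set \<Rightarrow> bool" where
  "isoperimetric p M A E \<longleftrightarrow>
     region M E \<and> weighted_area p E = ennreal A \<and>
     (\<forall>F. region M F \<and> weighted_area p F = ennreal A \<longrightarrow>
        weighted_perimeter p M E \<le> weighted_perimeter p M F)"


section \<open>Polygons, half plane and sectors\<close>

definition next_vertex :: "complex list \<Rightarrow> nat \<Rightarrow> complex" where
  "next_vertex vs i = vs ! ((i + 1) mod length vs)"

definition prev_vertex :: "complex list \<Rightarrow> nat \<Rightarrow> complex" where
  "prev_vertex vs i = vs ! ((i + length vs - 1) mod length vs)"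

definition polygon_boundary :: "complex list \<Rightarrow> complex set" where
  "polygon_boundary vs = (\<Union>i<length vs. closed_segment (vs ! i) (next_vertex vs i))"

text \<open>The closed polygonal curve through the vertices, in this order (clockwise or
  counterclockwise), does not meet itself: its edges, each without its final endpoint, are
  nondegenerate and pairwise disjoint.\<close>

definition simple_polygon :: "complex list \<Rightarrow> bool" where
  "simple_polygon vs \<longleftrightarrow>
     3 \<le> length vs \<and>
     (\<forall>i<length vs. vs ! i \<noteq> next_vertex vs i) \<and>
     (\<forall>i<length vs. \<forall>j<length vs. i \<noteq> j \<longrightarrow>
        (closed_segment (vs ! i) (next_vertex vs i) - {next_vertex vs i}) \<inter>
        (closed_segment (vs ! j) (next_vertex vs j) - {next_vertex vs j}) = {})"

definition polygon_region :: "complex list \<Rightarrow> complex set" where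
  "polygon_region vs = polygon_boundary vs \<union> inside (polygon_boundary vs)"

text \<open>With \<open>u\<close> and \<open>w\<close> the directions of the two edges at a vertex \<open>v\<close>, the number
  \<open>t = Arg2pi (w / u)\<close> is the angle from \<open>u\<close> counterclockwise to \<open>w\<close>.  It is the interior angle
  if the bisecting ray of direction \<open>u cis (t/2)\<close> starts inside the polygon; otherwise the interior
  angle is the complementary angle.  A vertex of angle \<open>\<pi>\<close> is allowed.\<close>

definition interior_angle :: "complex list \<Rightarrow> nat \<Rightarrow> real" where
  "interior_angle vs i =
     (let v = vs ! i; u = next_vertex vs i - v; w = prev_vertex vs i - v; t = Arg2pi (w / u)
      in if \<forall>\<^sub>F \<epsilon> in at_right 0. v + of_real \<epsilon> * u * cis (t / 2) \<in> polygon_region vs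
         then t else 2 * pi - t)"

definition half_plane :: "complex set" where
  "half_plane = {z. 0 \<le> Im z}"

text \<open>For \<open>\<theta>\<^sub>0 < 2 \<pi>\<close>, which is the case for interior angles of polygons, the sector with metric
  \<open>dr\<^sup>2 + r\<^sup>2 d\<theta>\<^sup>2\<close> embeds in the plane as follows.\<close>

definition sector :: "real \<Rightarrow> complex set" where
  "sector \<theta>\<^sub>0 = {of_real r * cis \<theta> | r \<theta>. 0 \<le> r \<and> 0 \<le> \<theta> \<and> \<theta> \<le> \<theta>\<^sub>0}"

end

theory Submission
  imports Defs
begin

text \<open>
  Near the origin, \<open>B\<close> is a rotated copy \<open>C\<close> of the cone \<open>M\<close>.  The theorem follows from one statement
  about an ambient space that agrees with a cone in \<open>ball 0 \<rho>\<close>, which applies to \<open>B\<close> and to \<open>C\<close> alike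
  (\<open>localization\<close>): a region of small weighted area whose perimeter is at most that of every region of the
  same area inside the ball lies itself in the ball.  Hence, for small areas, being isoperimetric in \<open>B\<close> and
  being isoperimetric in \<open>C\<close> both mean having least perimeter among the regions inside the ball
  (\<open>isoperimetric_iff_within\<close>), where \<open>B\<close> and \<open>C\<close> coincide.

  Localization compares a region \<open>F\<close> of area \<open>A\<close> with its truncations.  Let \<open>a t\<close> be the area of \<open>F\<close> outside the
  square of half side \<open>t\<close> and \<open>H t\<close> the length of the slice of \<open>F\<close> by the rim of this square.  Cutting \<open>F\<close> at
  \<open>t\<close> costs a constant times \<open>H t\<close>, and a dilation that restores the area multiplies the remaining perimeter
  by at most \<open>1 + 2 * a t / A\<close>; as the perimeter is of order \<open>A powr ((p + 1) / (p + 2))\<close>, this costs at most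
  a constant times \<open>A powr (- 1 / (p + 2)) * a t\<close>.  On the other hand, the part cut off has perimeter at least a
  constant times \<open>sqrt (a t)\<close>, because away from the origin an isoperimetric inequality of Euclidean type
  holds.  Since \<open>(p + 1) / (p + 2) > 1/2\<close>, the restoring cost is negligible against \<open>sqrt (a t)\<close> for small
  \<open>A\<close>, and minimality yields \<open>sqrt (a t) \<le> const * H t\<close>.  By Fubini's theorem \<open>a\<close> decreases at least at
  the rate \<open>const * H\<close>, so \<open>a' \<le> - const * sqrt a\<close>, and \<open>a\<close> vanishes after a time of order \<open>sqrt A\<close>, while
  the square is still inside the ball (\<open>finite_time_extinction\<close>).

  The isoperimetric inequality away from the origin rests on its relative form in a parallelogram, which
  follows from projecting the frontier of a set along the two sides (\<open>square_projections\<close>).  It extends to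
  every ambient space that is covered, up to a null set, by finitely many families of disjoint translates of
  parallelograms (\<open>tiled_exterior_isoperimetric\<close>).  Cones are covered in this way by the images of a square
  grid, and a compact set that looks like a cone near each of its points is covered by compactness
  (\<open>locally_conical_tiled\<close>).  A polygon is such a set: by the Jordan curve theorem, exactly one of the two
  sectors between the edges at a boundary point belongs to it (\<open>jordan_two_rays\<close>), and for a vertex this is
  the sector whose angle is the interior angle (\<open>polygon_local_vertex\<close>).
\<close>

section \<open>One-dimensional Hausdorff measure\<close>

text \<open>A Lipschitz map turns a cover into a cover whose diameters grow at most by the factor \<open>L\<close>.\<close>

lemma hausdorff1_lipschitz_image:
  assumes L: "0 < L" and f: "\<And>x y. x \<in> S \<Longrightarrow> y \<in> S \<Longrightarrow> dist (f x) (f y) \<le> L * dist x y"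
  shows "hausdorff1 (f ` S) \<le> ennreal L * hausdorff1 S"
proof -
  have diam: "bounded (f ` (U \<inter> S)) \<and> diameter (f ` (U \<inter> S)) \<le> L * diameter U"
    if U: "bounded U" for U
  proof -
    have le: "dist x y \<le> L * diameter U" if xy: "x \<in> f ` (U \<inter> S)" "y \<in> f ` (U \<inter> S)" for x y
    proof -
      obtain a b where ab: "a \<in> U" "a \<in> S" "b \<in> U" "b \<in> S" "x = f a" "y = f b" using xy by blast
      have "dist x y \<le> L * dist a b" using f ab by simp
      also have "\<dots> \<le> L * diameter U"
        using diameter_bounded_bound[OF U ab(1,3)] L by simp
      finally show ?thesis .
    qed
    have b: "bounded (f ` (U \<inter> S))" unfolding bounded_two_points using le by blast
    have "diameter (f ` (U \<inter> S)) \<le> L * diameter U"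
      using L le diameter_ge_0[OF U] by (intro diameter_le) (auto simp: dist_norm)
    with b show ?thesis by simp
  qed
  have pre: "hausdorff1_pre \<delta> (f ` S) \<le> ennreal L * hausdorff1 S" if \<delta>: "0 < \<delta>" for \<delta>
  proof -
    have "ennreal (1 / L) * hausdorff1_pre \<delta> (f ` S) \<le> hausdorff1_pre (\<delta> / L) S"
      unfolding hausdorff1_pre_def[of "\<delta> / L"]
    proof (rule INF_greatest, clarify)
      fix U :: "nat \<Rightarrow> complex set"
      assume cov: "S \<subseteq> (\<Union>i. U i)" and U: "\<forall>i. bounded (U i) \<and> diameter (U i) \<le> \<delta> / L"
      have "hausdorff1_pre \<delta> (f ` S) \<le> (\<Sum>i. ennreal (diameter (f ` (U i \<inter> S))))"
      proof (rule hausdorff1_pre_le)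
        show "f ` S \<subseteq> (\<Union>i. f ` (U i \<inter> S))" using cov by blast
        show "bounded (f ` (U i \<inter> S))" for i using diam U by blast
        have "L * diameter (U i) \<le> \<delta>" for i using U L by (simp add: field_simps)
        then show "diameter (f ` (U i \<inter> S)) \<le> \<delta>" for i using diam U order_trans by blast
      qed
      also have "\<dots> \<le> (\<Sum>i. ennreal L * ennreal (diameter (U i)))"
      proof (intro suminf_le summableI)
        fix i
        have "ennreal (diameter (f ` (U i \<inter> S))) \<le> ennreal (L * diameter (U i))"
          using diam U by (intro ennreal_leI) blast
        then show "ennreal (diameter (f ` (U i \<inter> S))) \<le> ennreal L * ennreal (diameter (U i))"
          using L U diameter_ge_0[of "U i"] by (simp add: ennreal_mult)
      qed
      also have "\<dots> = ennreal L * (\<Sum>i. ennreal (diameter (U i)))"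
        by (rule ennreal_suminf_cmult)
      finally have "ennreal (1 / L) * hausdorff1_pre \<delta> (f ` S)
          \<le> ennreal (1 / L) * (ennreal L * (\<Sum>i. ennreal (diameter (U i))))"
        by (rule mult_left_mono) simp
      also have "\<dots> = (\<Sum>i. ennreal (diameter (U i)))"
        using L by (simp add: mult.assoc[symmetric] ennreal_mult[symmetric])
      finally show "ennreal (1 / L) * hausdorff1_pre \<delta> (f ` S) \<le> (\<Sum>i. ennreal (diameter (U i)))" .
    qed
    also have "\<dots> \<le> hausdorff1 S" using L \<delta> by (intro hausdorff1_pre_le_hausdorff1) simp
    finally have "ennreal L * (ennreal (1 / L) * hausdorff1_pre \<delta> (f ` S)) \<le> ennreal L * hausdorff1 S"
      by (rule mult_left_mono) simp
    then show ?thesis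
      using L by (simp add: mult.assoc[symmetric] ennreal_mult[symmetric])
  qed
  show ?thesis
    unfolding hausdorff1_def[of "f ` S"] by (rule SUP_least) (use pre in auto)
qed

lemma hausdorff1_mult:
  assumes "c \<noteq> 0"
  shows "hausdorff1 ((*) c ` S) = ennreal (norm c) * hausdorff1 S"
proof (rule antisym)
  show "hausdorff1 ((*) c ` S) \<le> ennreal (norm c) * hausdorff1 S"
    using assms by (intro hausdorff1_lipschitz_image)
      (auto simp: dist_norm norm_mult[symmetric] algebra_simps)
  have "hausdorff1 ((*) (1/c) ` ((*) c ` S)) \<le> ennreal (norm (1/c)) * hausdorff1 ((*) c ` S)"
    using assms by (intro hausdorff1_lipschitz_image)
      (auto simp: dist_norm norm_mult[symmetric] norm_divide diff_divide_distrib[symmetric])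
  also have "(*) (1/c) ` ((*) c ` S) = S" using assms by (auto simp: image_image)
  finally have "ennreal (norm c) * hausdorff1 S
      \<le> ennreal (norm c) * (ennreal (norm (1/c)) * hausdorff1 ((*) c ` S))"
    by (rule mult_left_mono) simp
  also have "\<dots> = hausdorff1 ((*) c ` S)"
    using assms by (simp add: mult.assoc[symmetric] ennreal_mult[symmetric] norm_divide)
  finally show "ennreal (norm c) * hausdorff1 S \<le> hausdorff1 ((*) c ` S)" .
qed

text \<open>The source of all lower bounds for length: a cover of \<open>S\<close> projects to a cover of \<open>f ` S\<close> by
  intervals.  The image need not be measurable, so the conclusion speaks of a Borel set around it.\<close>

lemma hausdorff1_covers_projection:
  fixes f :: "complex \<Rightarrow> real"
  assumes L: "0 \<le> L" and f: "\<And>x y. x \<in> S \<Longrightarrow> y \<in> S \<Longrightarrow> \<bar>f x - f y\<bar> \<le> L * dist x y"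
  obtains T where "T \<in> sets borel" "f ` S \<subseteq> T" "emeasure lborel T \<le> ennreal L * hausdorff1 S"
proof -
  have cov: "\<exists>a b. f ` (U \<inter> S) \<subseteq> {a..b} \<and> a \<le> b \<and> b - a \<le> L * diameter U" if U: "bounded U" for U
  proof (cases "U \<inter> S = {}")
    case True
    then show ?thesis using L diameter_ge_0[OF U] by (intro exI[of _ 0]) auto
  next
    case False
    let ?I = "f ` (U \<inter> S)"
    have le: "x - y \<le> L * diameter U" if xy: "x \<in> ?I" "y \<in> ?I" for x y
    proof -
      obtain a b where ab: "a \<in> U" "a \<in> S" "b \<in> U" "b \<in> S" "x = f a" "y = f b" using xy by blast
      have "x - y \<le> L * dist a b" using f[of a b] ab by simp
      also have "\<dots> \<le> L * diameter U"
        using diameter_bounded_bound[OF U ab(1,3)] L by (simp add: mult_left_mono)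
      finally show ?thesis .
    qed
    obtain x0 where x0: "x0 \<in> ?I" using False by blast
    have bdd: "bdd_above ?I" "bdd_below ?I"
    proof -
      show "bdd_above ?I" using le[OF _ x0]
        by (intro bdd_aboveI[of _ "x0 + L * diameter U"]) (simp add: diff_le_eq add.commute)
      show "bdd_below ?I" using le[OF x0]
        by (intro bdd_belowI[of _ "x0 - L * diameter U"]) (simp add: algebra_simps)
    qed
    have "Sup ?I \<le> Inf ?I + L * diameter U"
    proof (rule cSup_least)
      fix x assume x: "x \<in> ?I"
      have "x - L * diameter U \<le> Inf ?I"
        using le[OF x] x0 by (intro cInf_greatest) (auto simp: diff_le_eq add.commute)
      then show "x \<le> Inf ?I + L * diameter U" by simp
    qed (use x0 in auto)
    moreover have "?I \<subseteq> {Inf ?I..Sup ?I}"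
    proof
      fix x assume "x \<in> ?I"
      then show "x \<in> {Inf ?I..Sup ?I}" using cInf_lower[OF _ bdd(2)] cSup_upper[OF _ bdd(1)] by simp
    qed
    moreover have "Inf ?I \<le> Sup ?I"
      using cInf_lower[OF x0 bdd(2)] cSup_upper[OF x0 bdd(1)] by simp
    ultimately show ?thesis by (intro exI[of _ "Inf ?I"] exI[of _ "Sup ?I"]) auto
  qed
  have "outer_measure_of lborel (f ` S) \<le> ennreal L * hausdorff1 S"
  proof (cases "L = 0")
    case True
    have "f ` S \<subseteq> {f x}" if "x \<in> S" for x using f[OF that] True by force
    then have "\<exists>a. f ` S \<subseteq> {a}" by (metis all_not_in_conv empty_subsetI image_is_empty)
    then obtain a where "f ` S \<subseteq> {a}" by blast
    then have "outer_measure_of lborel (f ` S) \<le> outer_measure_of lborel {a}"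
      by (rule outer_measure_of_mono)
    then show ?thesis using True by simp
  next
    case False
    then have L: "0 < L" using L by simp
    have "ennreal (1 / L) * outer_measure_of lborel (f ` S) \<le> hausdorff1_pre 1 S"
      unfolding hausdorff1_pre_def
    proof (rule INF_greatest, clarify)
      fix U :: "nat \<Rightarrow> complex set"
      assume US: "S \<subseteq> (\<Union>i. U i)" and U: "\<forall>i. bounded (U i) \<and> diameter (U i) \<le> 1"
      have "\<forall>i. \<exists>a b. f ` (U i \<inter> S) \<subseteq> {a..b} \<and> a \<le> b \<and> b - a \<le> L * diameter (U i)"
        using cov U by blast
      then obtain a b where ab: "\<And>i. f ` (U i \<inter> S) \<subseteq> {a i..b i}" "\<And>i. a i \<le> b i"
          "\<And>i. b i - a i \<le> L * diameter (U i)"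
        by metis
      have "outer_measure_of lborel (f ` S) \<le> outer_measure_of lborel (\<Union>i. {a i..b i})"
      proof (rule outer_measure_of_mono, rule image_subsetI)
        fix x assume x: "x \<in> S"
        then obtain i where "x \<in> U i" using US by blast
        then have "f x \<in> {a i..b i}" using ab(1)[of i] x by blast
        then show "f x \<in> (\<Union>i. {a i..b i})" by blast
      qed
      also have "\<dots> = emeasure lborel (\<Union>i. {a i..b i})" by (intro outer_measure_of_eq) simp
      also have "\<dots> \<le> (\<Sum>i. emeasure lborel {a i..b i})"
        by (rule emeasure_subadditive_countably) auto
      also have "\<dots> \<le> (\<Sum>i. ennreal L * ennreal (diameter (U i)))"
      proof (intro suminf_le summableI)
        fix i
        have "ennreal (b i - a i) \<le> ennreal (L * diameter (U i))" using ab(3) by (rule ennreal_leI)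
        then show "emeasure lborel {a i..b i} \<le> ennreal L * ennreal (diameter (U i))"
          using ab(2) L U diameter_ge_0[of "U i"] by (simp add: ennreal_mult)
      qed
      also have "\<dots> = ennreal L * (\<Sum>i. ennreal (diameter (U i)))"
        by (rule ennreal_suminf_cmult)
      finally have "ennreal (1 / L) * outer_measure_of lborel (f ` S)
          \<le> ennreal (1 / L) * (ennreal L * (\<Sum>i. ennreal (diameter (U i))))"
        by (rule mult_left_mono) simp
      also have "\<dots> = (\<Sum>i. ennreal (diameter (U i)))"
        using L by (simp add: mult.assoc[symmetric] ennreal_mult[symmetric])
      finally show "ennreal (1 / L) * outer_measure_of lborel (f ` S) \<le> (\<Sum>i. ennreal (diameter (U i)))" .
    qed
    also have "\<dots> \<le> hausdorff1 S" by (intro hausdorff1_pre_le_hausdorff1) simp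
    finally have "ennreal L * (ennreal (1 / L) * outer_measure_of lborel (f ` S)) \<le> ennreal L * hausdorff1 S"
      by (rule mult_left_mono) simp
    then show ?thesis
      using L by (simp add: mult.assoc[symmetric] ennreal_mult[symmetric])
  qed
  moreover obtain T where "T \<in> sets lborel" "f ` S \<subseteq> T"
      "outer_measure_of lborel (f ` S) = emeasure lborel T"
    using outer_measure_of_attain[of "f ` S" lborel] by auto
  ultimately show thesis using that by auto
qed

text \<open>A cover of \<open>S\<close> by sets of diameter at most \<open>\<delta>\<close> is contained in discs of total area at most
  \<open>\<pi> \<delta>\<close> times the sum of the diameters.  This is what makes boundaries of finite length negligible.\<close>

lemma hausdorff1_finite_imp_null:
  assumes S: "S \<in> sets borel" and fin: "hausdorff1 S < \<infinity>"
  shows "emeasure lborel S = 0"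
proof -
  obtain m where m: "0 \<le> m" "hausdorff1 S = ennreal m"
    using fin by (cases "hausdorff1 S") (auto simp: top_unique)
  have bound: "emeasure lborel S \<le> ennreal (pi * \<delta> * (m + 1))" if \<delta>: "0 < \<delta>" for \<delta>
  proof -
    have "hausdorff1_pre \<delta> S \<le> ennreal m"
      using hausdorff1_pre_le_hausdorff1[OF \<delta>, of S] m by simp
    also have "\<dots> < ennreal (m + 1)" using m by (simp add: ennreal_less_iff)
    finally obtain U :: "nat \<Rightarrow> complex set" where U: "S \<subseteq> (\<Union>i. U i)" "\<And>i. bounded (U i)"
        "\<And>i. diameter (U i) \<le> \<delta>" "(\<Sum>i. ennreal (diameter (U i))) < ennreal (m + 1)"
      unfolding hausdorff1_pre_def INF_less_iff by auto
    have "\<exists>x. U i \<subseteq> cball x (diameter (U i))" for i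
    proof (cases "U i = {}")
      case False
      then obtain x where "x \<in> U i" by blast
      then show ?thesis using diameter_bounded_bound[OF U(2)] by (intro exI[of _ x]) auto
    qed auto
    then obtain x where x: "\<And>i. U i \<subseteq> cball (x i) (diameter (U i))" by metis
    have "emeasure lborel S \<le> emeasure lborel (\<Union>i. cball (x i) (diameter (U i)))"
    proof (rule emeasure_mono)
      show "S \<subseteq> (\<Union>i. cball (x i) (diameter (U i)))" using U(1) x by blast
    qed simp
    also have "\<dots> \<le> (\<Sum>i. emeasure lborel (cball (x i) (diameter (U i))))"
      by (rule emeasure_subadditive_countably) auto
    also have "\<dots> \<le> (\<Sum>i. ennreal (pi * \<delta>) * ennreal (diameter (U i)))"
    proof (intro suminf_le summableI)
      fix i
      have d: "0 \<le> diameter (U i)" using U(2) by (rule diameter_ge_0)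
      have "emeasure lborel (cball (x i) (diameter (U i))) = ennreal (pi * diameter (U i) * diameter (U i))"
        using emeasure_cball[of "diameter (U i)" "x i"] d
        by (simp add: power2_eq_square eval_unit_ball_vol mult.assoc)
      also have "\<dots> \<le> ennreal (pi * \<delta> * diameter (U i))"
        using d U(3)[of i] by (intro ennreal_leI mult_right_mono mult_left_mono) auto
      also have "\<dots> = ennreal (pi * \<delta>) * ennreal (diameter (U i))"
        using d \<delta> by (simp add: ennreal_mult)
      finally show "emeasure lborel (cball (x i) (diameter (U i))) \<le> ennreal (pi * \<delta>) * ennreal (diameter (U i))" .
    qed
    also have "\<dots> = ennreal (pi * \<delta>) * (\<Sum>i. ennreal (diameter (U i)))"
      by (rule ennreal_suminf_cmult)
    also have "\<dots> \<le> ennreal (pi * \<delta>) * ennreal (m + 1)"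
      using U(4) by (intro mult_left_mono) auto
    also have "\<dots> = ennreal (pi * \<delta> * (m + 1))" using \<delta> m by (simp add: ennreal_mult)
    finally show ?thesis .
  qed
  have "emeasure lborel S \<le> ennreal e" if "0 < e" for e
  proof -
    have "pi * (e / (pi * (m + 1))) * (m + 1) = e" using m by simp
    then show ?thesis using bound[of "e / (pi * (m + 1))"] that m by simp
  qed
  then have "emeasure lborel S \<le> 0"
    using ennreal_le_epsilon[of 0 "emeasure lborel S"] by simp
  then show ?thesis by simp
qed

lemma hausdorff1_vertical_interval:
  assumes "l \<le> r"
  shows "hausdorff1 (Complex u ` {l<..<r}) = ennreal (r - l)"
proof (rule antisym)
  show "hausdorff1 (Complex u ` {l<..<r}) \<le> ennreal (r - l)"
    unfolding hausdorff1_def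
  proof (rule SUP_least)
    fix \<delta> :: real assume "\<delta> \<in> {0<..}"
    then have \<delta>: "0 < \<delta>" by simp
    obtain N where N: "(r - l) / \<delta> < real N" using reals_Archimedean2 by blast
    have N0: "0 < real N" using N assms \<delta> by (smt (verit) divide_nonneg_pos)
    define h where "h = (r - l) / N"
    have h: "0 \<le> h" "h \<le> \<delta>" using N N0 \<delta> assms by (auto simp: h_def field_simps)
    define U where "U i = (if i < N then Complex u ` {l + real i * h..l + real (Suc i) * h} else {})" for i
    have diam: "bounded (U i) \<and> diameter (U i) \<le> h" for i
    proof -
      have le: "dist x y \<le> h" if "x \<in> U i" "y \<in> U i" for x y
      proof -
        obtain a b where ab: "x = Complex u a" "y = Complex u b"
            "l + real i * h \<le> a" "a \<le> l + real (Suc i) * h" "l + real i * h \<le> b" "b \<le> l + real (Suc i) * h"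
          using \<open>x \<in> U i\<close> \<open>y \<in> U i\<close> by (auto simp: U_def split: if_splits)
        then have "\<bar>a - b\<bar> \<le> h" by (simp add: algebra_simps)
        then show ?thesis using ab by (simp add: dist_norm complex_diff cmod_def)
      qed
      then show ?thesis unfolding bounded_two_points using h
        by (auto intro!: diameter_le simp: dist_norm)
    qed
    have "hausdorff1_pre \<delta> (Complex u ` {l<..<r}) \<le> (\<Sum>i. ennreal (diameter (U i)))"
    proof (rule hausdorff1_pre_le)
      show "bounded (U i)" "diameter (U i) \<le> \<delta>" for i using diam[of i] h by auto
      show "Complex u ` {l<..<r} \<subseteq> (\<Union>i. U i)"
      proof
        fix z assume "z \<in> Complex u ` {l<..<r}"
        then obtain y where y: "z = Complex u y" "l < y" "y < r" by auto
        then have hpos: "0 < h" using N0 by (simp add: h_def)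
        define i where "i = nat \<lfloor>(y - l) / h\<rfloor>"
        have i: "real i \<le> (y - l) / h" "(y - l) / h < real i + 1"
          using y hpos by (auto simp: i_def)
        have "(y - l) / h < real N" using y N0 hpos by (simp add: h_def field_simps)
        then have "i < N" using i by linarith
        moreover have "y \<in> {l + real i * h..l + real (Suc i) * h}"
          using i hpos by (simp add: field_simps)
        ultimately have "z \<in> U i" using y by (simp add: U_def)
        then show "z \<in> (\<Union>i. U i)" by blast
      qed
    qed
    also have "\<dots> = (\<Sum>i<N. ennreal (diameter (U i)))"
      by (rule suminf_finite) (auto simp: U_def)
    also have "\<dots> \<le> (\<Sum>i<N. ennreal h)"
      using diam by (intro sum_mono ennreal_leI) auto
    also have "\<dots> = ennreal (r - l)"
      using N0 h(1) by (simp add: h_def ennreal_mult[symmetric] ennreal_of_nat_eq_real_of_nat)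
    finally show "hausdorff1_pre \<delta> (Complex u ` {l<..<r}) \<le> ennreal (r - l)" .
  qed
  obtain T where T: "T \<in> sets borel" "Im ` (Complex u ` {l<..<r}) \<subseteq> T"
      "emeasure lborel T \<le> ennreal 1 * hausdorff1 (Complex u ` {l<..<r})"
  proof (rule hausdorff1_covers_projection[of 1 "Complex u ` {l<..<r}" Im])
    fix x y :: complex
    show "\<bar>Im x - Im y\<bar> \<le> 1 * dist x y"
      using abs_Im_le_cmod[of "x - y"] by (simp add: dist_norm)
  qed simp
  have "{l<..<r} \<subseteq> T" using T(2) by (auto simp: image_image)
  then have "emeasure lborel {l<..<r} \<le> emeasure lborel T" using T(1) by (intro emeasure_mono) auto
  then show "ennreal (r - l) \<le> hausdorff1 (Complex u ` {l<..<r})" using T(3) assms by simp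
qed

lemma borel_vertical:
  assumes "T \<in> sets borel"
  shows "Complex u ` T \<in> sets borel"
proof -
  have "Complex u ` T = Im -` T \<inter> Re -` {u}" by (auto simp: complex_eq_iff image_iff)
  moreover have "Im -` T \<in> sets borel"
    using measurable_sets[of Im borel borel T] assms by simp
  moreover have "Re -` {u} \<in> sets borel" using measurable_sets[of Re borel borel "{u}"] by simp
  ultimately show ?thesis by simp
qed

text \<open>On a vertical line, length is a Borel measure that gives every interval its length; hence it is
  Lebesgue measure.\<close>

lemma hausdorff1_vertical:
  assumes T: "T \<in> sets borel"
  shows "hausdorff1 (Complex u ` T) = emeasure lborel T"
proof -
  define D where "D = Complex u ` UNIV"
  have DB: "D \<in> sets borel" unfolding D_def by (rule borel_vertical) simp
  define \<mu> where "\<mu> = distr (restrict_space arclength D) borel Im"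
  have \<mu>: "emeasure \<mu> X = hausdorff1 (Complex u ` X)" if X: "X \<in> sets borel" for X
  proof -
    have "Im \<in> restrict_space arclength D \<rightarrow>\<^sub>M borel"
      by (rule measurable_restrict_space1) (simp add: measurable_def sets_arclength
           arclength_def space_measure_of_conv measurable_sets[of Im borel borel, simplified])
    then have "emeasure \<mu> X = emeasure (restrict_space arclength D) (Im -` X \<inter> space (restrict_space arclength D))"
      unfolding \<mu>_def using X by (rule emeasure_distr)
    also have "Im -` X \<inter> space (restrict_space arclength D) = Complex u ` X"
      by (auto simp: space_restrict_space arclength_def space_measure_of_conv D_def)
    also have "emeasure (restrict_space arclength D) (Complex u ` X) = emeasure arclength (Complex u ` X)"
      using DB by (intro emeasure_restrict_space) (auto simp: sets_arclength D_def arclength_def space_measure_of_conv)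
    also have "\<dots> = hausdorff1 (Complex u ` X)"
      using X by (intro emeasure_arclength borel_vertical)
    finally show ?thesis .
  qed
  have "lborel = \<mu>"
  proof (rule lborel_eqI)
    fix l r :: real assume "\<And>b. b \<in> Basis \<Longrightarrow> l \<bullet> b \<le> r \<bullet> b"
    then have "l \<le> r" by simp
    then show "emeasure \<mu> (box l r) = ennreal (\<Prod>b\<in>Basis. (r - l) \<bullet> b)"
      by (simp add: \<mu> hausdorff1_vertical_interval)
  qed (simp add: \<mu>_def)
  then show ?thesis using \<mu>[OF T] by simp
qed

section \<open>Linear maps and Lebesgue measure\<close>

lemma image_homeomorphism_topology:
  assumes "homeomorphism UNIV UNIV f g"
  shows "f ` interior S = interior (f ` S)"
    and "f ` closure S = closure (f ` S)"
    and "f ` frontier S = frontier (f ` S)"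
proof -
  have c: "continuous_on UNIV f" "continuous_on UNIV g" and fg: "\<And>x. f (g x) = x" "\<And>x. g (f x) = x"
    using assms by (auto simp: homeomorphism_def)
  have img: "f ` X = g -` X" for X
  proof
    show "f ` X \<subseteq> g -` X" using fg by auto
    show "g -` X \<subseteq> f ` X"
    proof
      fix x assume "x \<in> g -` X"
      then have "f (g x) \<in> f ` X" by blast
      then show "x \<in> f ` X" by (simp add: fg)
    qed
  qed
  have int: "f ` interior X = interior (f ` X)" for X
  proof
    show "f ` interior X \<subseteq> interior (f ` X)"
      using open_vimage[OF open_interior c(2), of X] interior_subset[of X]
      unfolding img by (intro interior_maximal) auto
    have "open (f -` interior (f ` X))" by (rule open_vimage[OF open_interior c(1)])
    moreover have "f -` interior (f ` X) \<subseteq> X"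
      using interior_subset[of "f ` X"] fg unfolding img by auto
    ultimately have "f -` interior (f ` X) \<subseteq> interior X" by (rule interior_maximal[rotated])
    moreover have "interior (f ` X) = f ` (f -` interior (f ` X))"
      unfolding img[of "f -` interior (f ` X)"] using fg by auto
    ultimately show "interior (f ` X) \<subseteq> f ` interior X" by blast
  qed
  show "f ` interior S = interior (f ` S)" by (rule int)
  have cmp: "f ` (- X) = - f ` X" for X unfolding img by auto
  show clo: "f ` closure S = closure (f ` S)"
    by (simp add: closure_interior cmp int)
  have diff: "f ` (X - Y) = f ` X - f ` Y" for X Y unfolding img by auto
  show "f ` frontier S = frontier (f ` S)"
    unfolding frontier_def diff clo int ..
qed

lemma homeomorphism_mult:
  fixes c :: complex
  assumes "c \<noteq> 0"
  shows "homeomorphism UNIV UNIV ((*) c) ((*) (1 / c))"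
  using assms by (intro homeomorphismI) (auto intro!: continuous_intros)

lemmas interior_mult = image_homeomorphism_topology(1)[OF homeomorphism_mult, symmetric]
lemmas closure_mult = image_homeomorphism_topology(2)[OF homeomorphism_mult, symmetric]
lemmas frontier_mult = image_homeomorphism_topology(3)[OF homeomorphism_mult, symmetric]

lemma emeasure_lborel_affine_vimage:
  fixes X :: "'a::euclidean_space set"
  assumes r: "\<bar>r\<bar> = 1" and X: "X \<in> sets borel"
  shows "emeasure lborel ((\<lambda>x. t + r *\<^sub>R x) -` X) = emeasure lborel X"
proof -
  have "(lborel :: 'a measure) = density (distr lborel borel (\<lambda>x. t + r *\<^sub>R x)) (\<lambda>_. 1)"
    using lborel_affine[of r t] r by force
  then have "emeasure lborel X = emeasure (distr lborel borel (\<lambda>x. t + r *\<^sub>R x)) X"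
    by (simp add: density_1)
  also have "\<dots> = emeasure lborel ((\<lambda>x. t + r *\<^sub>R x) -` X)" using X by (subst emeasure_distr) auto
  finally show ?thesis by simp
qed

lemma translation_image_eq_vimage:
  fixes S :: "'a::real_vector set"
  shows "(+) a ` S = (\<lambda>x. - a + 1 *\<^sub>R x) -` S"
proof (intro equalityI subsetI)
  fix x assume "x \<in> (\<lambda>x. - a + 1 *\<^sub>R x) -` S"
  then have "- a + x \<in> S" by simp
  then have "a + (- a + x) \<in> (+) a ` S" by (rule imageI)
  then show "x \<in> (+) a ` S" by simp
qed auto

lemma linear_inv_bij:
  assumes "linear T" "bij T"
  shows "linear (inv T)" "T (inv T x) = x" "inv T (T y) = y"
proof -
  have inv: "T (inv T x) = x" "inv T (T y) = y" for x y
    using assms by (simp_all add: bij_is_surj surj_f_inv_f bij_is_inj inv_f_f)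
  show "linear (inv T)"
  proof (rule linearI)
    show "inv T (x + y) = inv T x + inv T y" for x y using inv by (metis linear_add[OF assms(1)])
    show "inv T (r *\<^sub>R x) = r *\<^sub>R inv T x" for r x using inv by (metis linear_scale[OF assms(1)])
  qed
  show "T (inv T x) = x" "inv T (T y) = y" by (rule inv)+
qed

text \<open>Uniqueness of Haar measure, by Tonelli: with \<open>Q\<close> the unit cube, integrate
  \<open>1\<^sub>A(y) 1\<^sub>Q(x + y)\<close> in both orders.\<close>

lemma translation_invariant_measure:
  fixes \<nu> :: "'a::euclidean_space measure"
  assumes sf: "sigma_finite_measure \<nu>" and sets: "sets \<nu> = sets borel"
    and inv: "\<And>A a. A \<in> sets borel \<Longrightarrow> emeasure \<nu> ((+) a -` A) = emeasure \<nu> A"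
    and A: "A \<in> sets borel"
  shows "emeasure \<nu> A = emeasure \<nu> (box 0 One) * emeasure lborel A"
proof -
  let ?Q = "box 0 One :: 'a set"
  interpret \<nu>: sigma_finite_measure \<nu> by fact
  interpret P: pair_sigma_finite lborel \<nu> ..
  note [measurable_cong] = sets
  have space: "space \<nu> = UNIV" using sets_eq_imp_space_eq[OF sets] by simp
  have [measurable]: "A \<in> sets borel" by fact
  have distr: "distr \<nu> borel ((+) a) = \<nu>" for a
    using inv by (intro measure_eqI) (auto simp: sets emeasure_distr space)
  have tr: "(\<integral>\<^sup>+y. f (a + y) \<partial>\<nu>) = (\<integral>\<^sup>+y. f y \<partial>\<nu>)" if [measurable]: "f \<in> borel_measurable borel" for f and a
  proof -
    have "(\<integral>\<^sup>+y. f y \<partial>\<nu>) = (\<integral>\<^sup>+y. f y \<partial>(distr \<nu> borel ((+) a)))" by (simp add: distr)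
    also have "\<dots> = (\<integral>\<^sup>+y. f (a + y) \<partial>\<nu>)"
      by (rule nn_integral_distr) (simp_all add: measurable_cong_sets[OF sets refl])
    finally show ?thesis by simp
  qed
  have l1: "emeasure lborel ((+) y -` X) = emeasure lborel X" if X: "X \<in> sets borel" for X :: "'a set" and y
    using emeasure_lborel_affine_vimage[OF _ X, of 1 y] by simp
  \<comment> \<open>Every translate of \<open>?Q\<close> has Lebesgue measure 1.\<close>
  have "emeasure \<nu> A = (\<integral>\<^sup>+y. indicator A y * emeasure lborel ((+) y -` ?Q) \<partial>\<nu>)"
    using A by (subst l1) (auto simp: sets emeasure_lborel_box_eq)
  also have "\<dots> = (\<integral>\<^sup>+y. \<integral>\<^sup>+x. indicator A y * indicator ?Q (x + y) \<partial>lborel \<partial>\<nu>)"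
  proof (rule nn_integral_cong)
    fix y
    have "emeasure lborel ((+) y -` ?Q) = (\<integral>\<^sup>+x. indicator ?Q (x + y) \<partial>lborel)"
      by (subst nn_integral_indicator[symmetric])
        (auto intro!: nn_integral_cong measurable_sets_borel[of "(+) y" borel] simp: indicator_def add.commute)
    then show "indicator A y * emeasure lborel ((+) y -` ?Q) = (\<integral>\<^sup>+x. indicator A y * indicator ?Q (x + y) \<partial>lborel)"
      by (simp add: nn_integral_cmult)
  qed
  also have "\<dots> = (\<integral>\<^sup>+x. \<integral>\<^sup>+y. indicator A y * indicator ?Q (x + y) \<partial>\<nu> \<partial>lborel)"
    by (rule P.Fubini') simp
  also have "\<dots> = (\<integral>\<^sup>+x. \<integral>\<^sup>+y. indicator A (y - x) * indicator ?Q y \<partial>\<nu> \<partial>lborel)"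
  proof (rule nn_integral_cong)
    fix x
    show "(\<integral>\<^sup>+y. indicator A y * indicator ?Q (x + y) \<partial>\<nu>) = (\<integral>\<^sup>+y. indicator A (y - x) * indicator ?Q y \<partial>\<nu>)"
      using tr[of "\<lambda>y. indicator A (y - x) * indicator ?Q y" x] by simp
  qed
  also have "\<dots> = (\<integral>\<^sup>+y. \<integral>\<^sup>+x. indicator A (y - x) * indicator ?Q y \<partial>lborel \<partial>\<nu>)"
    by (rule P.Fubini'[symmetric]) simp
  also have "\<dots> = (\<integral>\<^sup>+y. emeasure lborel A * indicator ?Q y \<partial>\<nu>)"
  proof (rule nn_integral_cong)
    fix y
    have "(\<lambda>x. indicator A (y - x)) = (indicator ((\<lambda>x. y + (-1) *\<^sub>R x) -` A) :: 'a \<Rightarrow> ennreal)"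
      by (auto simp: indicator_def)
    moreover have "(\<lambda>x. y + (-1) *\<^sub>R x) -` A \<in> sets borel"
      using A by (rule measurable_sets_borel[rotated]) measurable
    ultimately have "(\<integral>\<^sup>+x. indicator A (y - x) \<partial>lborel) = emeasure lborel ((\<lambda>x. y + (-1) *\<^sub>R x) -` A)"
      by (simp only: nn_integral_indicator sets_lborel)
    also have "\<dots> = emeasure lborel A" by (rule emeasure_lborel_affine_vimage) (simp_all add: A)
    finally show "(\<integral>\<^sup>+x. indicator A (y - x) * indicator ?Q y \<partial>lborel) = emeasure lborel A * indicator ?Q y"
      by (simp add: nn_integral_multc)
  qed
  also have "\<dots> = emeasure \<nu> ?Q * emeasure lborel A"
    by (simp add: nn_integral_cmult sets mult.commute)
  finally show ?thesis .
qed

text \<open>The image measure of Lebesgue measure under the inverse map is translation invariant.  The factor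
  \<open>k\<close> is the absolute value of the determinant of \<open>T\<close> in orthonormal bases.\<close>

lemma emeasure_linear_image:
  fixes T :: "'a::euclidean_space \<Rightarrow> 'b::euclidean_space"
  assumes T: "linear T" "bij T"
  obtains k where "0 < k" "\<And>A. A \<in> sets borel \<Longrightarrow> T ` A \<in> sets borel"
    "\<And>A. A \<in> sets borel \<Longrightarrow> emeasure lborel (T ` A) = ennreal k * emeasure lborel A"
proof -
  define g where "g = inv T"
  note g = linear_inv_bij(1)[OF T, folded g_def] and fg = linear_inv_bij(2,3)[OF T, folded g_def]
  have img: "T ` A = g -` A" for A
  proof
    show "T ` A \<subseteq> g -` A" using fg by auto
    show "g -` A \<subseteq> T ` A" using fg by (metis image_eqI subsetI vimageE)
  qed
  have gm[measurable]: "g \<in> borel_measurable borel"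
    by (intro borel_measurable_continuous_onI linear_continuous_on linear_conv_bounded_linear[THEN iffD1] g)
  have bor: "T ` A \<in> sets borel" if "A \<in> sets borel" for A
    unfolding img using measurable_sets_borel[OF gm that] by simp
  define \<nu> where "\<nu> = distr lborel borel g"
  have \<nu>: "emeasure \<nu> A = emeasure lborel (T ` A)" if "A \<in> sets borel" for A
    unfolding \<nu>_def img using that by (subst emeasure_distr) auto
  have fin: "emeasure \<nu> A < \<infinity>" if "A \<in> sets borel" "bounded A" for A
    unfolding \<nu>[OF that(1)]
    by (intro emeasure_bounded_finite bounded_linear_image that linear_conv_bounded_linear[THEN iffD1] T)
  have sf: "sigma_finite_measure \<nu>"
  proof
    show "\<exists>A. countable A \<and> A \<subseteq> sets \<nu> \<and> \<Union>A = space \<nu> \<and> (\<forall>a\<in>A. emeasure \<nu> a \<noteq> \<infinity>)"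
    proof (intro exI[of _ "range (\<lambda>n::nat. ball 0 (real n))"] conjI ballI)
      show "\<Union> (range (\<lambda>n::nat. ball (0::'a) (real n))) = space \<nu>"
        using reals_Archimedean2 by (auto simp: \<nu>_def)
      show "range (\<lambda>n::nat. ball (0::'a) (real n)) \<subseteq> sets \<nu>" by (auto simp: \<nu>_def)
      fix a assume "a \<in> range (\<lambda>n::nat. ball (0::'a) (real n))"
      then show "emeasure \<nu> a \<noteq> \<infinity>" using fin[of a] by auto
    qed simp
  qed
  have lt: "emeasure lborel ((+) y -` X) = emeasure lborel X" if X: "X \<in> sets borel" for X :: "'b set" and y
    using emeasure_lborel_affine_vimage[OF _ X, of 1 y] by simp
  have key: "emeasure \<nu> A = emeasure \<nu> (box 0 One) * emeasure lborel A" if A: "A \<in> sets borel" for A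
  proof (rule translation_invariant_measure[OF sf _ _ A])
    show "sets \<nu> = sets borel" by (simp add: \<nu>_def)
    fix X a assume X: "X \<in> sets (borel :: 'a measure)"
    have X': "(+) a -` X \<in> sets borel" using X by (rule measurable_sets_borel[rotated]) simp
    have "T ` ((+) a -` X) = (+) (T a) -` (T ` X)"
      unfolding img by (auto simp: linear_add[OF g] fg)
    then show "emeasure \<nu> ((+) a -` X) = emeasure \<nu> X"
      using X X' by (simp add: \<nu> lt bor)
  qed
  define k where "k = enn2real (emeasure \<nu> (box 0 One))"
  have k: "emeasure \<nu> (box 0 One) = ennreal k"
    using fin[of "box 0 One"] by (simp add: k_def bounded_box)
  have "k \<noteq> 0"
  proof
    assume "k = 0"
    then have "emeasure \<nu> UNIV = 0" using key[of UNIV] k by simp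
    moreover have "T ` UNIV = UNIV" using T bij_is_surj by blast
    ultimately show False using \<nu>[of UNIV] by simp
  qed
  then have "0 < k" by (simp add: k_def order.strict_iff_order)
  then show thesis using that[of k] bor key \<nu> k by simp
qed

text \<open>Multiplication by \<open>c\<close> maps the unit disc to a disc of radius \<open>norm c\<close>, which identifies the
  factor of the previous lemma.\<close>

lemma emeasure_lborel_mult:
  fixes c :: complex
  assumes c: "c \<noteq> 0" and A: "A \<in> sets borel"
  shows "emeasure lborel ((*) c ` A) = ennreal ((norm c)\<^sup>2) * emeasure lborel A"
proof -
  have b: "bij ((*) c)" using c by (intro o_bij[of "(*) (1/c)"]) auto
  have l: "linear ((*) c)" by (rule linear_times)
  obtain k where k: "0 < k" "\<And>A. A \<in> sets borel \<Longrightarrow> emeasure lborel ((*) c ` A) = ennreal k * emeasure lborel A"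
    using emeasure_linear_image[OF l b] by metis
  have "(*) c ` cball 0 1 = cball 0 (norm c)"
  proof
    show "(*) c ` cball 0 1 \<subseteq> cball 0 (norm c)" by (auto simp: norm_mult mult_left_le)
    show "cball (0::complex) (norm c) \<subseteq> (*) c ` cball 0 1"
    proof
      fix z :: complex assume z: "z \<in> cball 0 (norm c)"
      have "z = c * (z / c)" using c by simp
      moreover have "z / c \<in> cball 0 1" using z c by (simp add: norm_divide divide_le_eq)
      ultimately show "z \<in> (*) c ` cball 0 1" by blast
    qed
  qed
  then have "emeasure lborel (cball (0::complex) (norm c)) = ennreal k * emeasure lborel (cball (0::complex) 1)"
    using k(2)[of "cball 0 1"] by simp
  then have "ennreal (pi * (norm c)\<^sup>2) = ennreal (k * pi)"
    using k(1) by (simp add: emeasure_cball eval_unit_ball_vol ennreal_mult)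
  then have "k = (norm c)\<^sup>2" using k(1) by (simp add: mult.commute)
  then show ?thesis using k(2)[OF A] by simp
qed

section \<open>Similarities and weighted measures\<close>

lemma nn_integral_scaled:
  fixes M :: "complex measure" and c :: complex
  assumes sets: "sets M = sets borel" and c: "c \<noteq> 0" and r: "0 \<le> r"
    and scale: "\<And>A. A \<in> sets borel \<Longrightarrow> emeasure M ((*) c ` A) = ennreal r * emeasure M A"
    and f[measurable]: "f \<in> borel_measurable borel"
  shows "(\<integral>\<^sup>+z. f z \<partial>M) = ennreal r * (\<integral>\<^sup>+z. f (c * z) \<partial>M)"
proof -
  note [measurable_cong] = sets
  have space: "space M = UNIV" using sets_eq_imp_space_eq[OF sets] by simp
  have img: "(*) c ` A = (*) (1/c) -` A" for A
    using c by (force simp: image_iff)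
  have D: "distr M borel ((*) (1/c)) = scale_measure (ennreal r) M"
  proof (rule measure_eqI)
    fix A assume "A \<in> sets (distr M borel ((*) (1/c)))"
    then have A: "A \<in> sets borel" by simp
    have "emeasure (distr M borel ((*) (1/c))) A = emeasure M ((*) (1/c) -` A)"
      using A by (subst emeasure_distr) (auto simp: space)
    then show "emeasure (distr M borel ((*) (1/c))) A = emeasure (scale_measure (ennreal r) M) A"
      using scale[OF A] img by simp
  qed (simp add: sets)
  have "(\<integral>\<^sup>+z. f z \<partial>M) = (\<integral>\<^sup>+z. f (c * ((1/c) * z)) \<partial>M)" using c by simp
  also have "\<dots> = (\<integral>\<^sup>+z. f (c * z) \<partial>(distr M borel ((*) (1/c))))"
    by (rule nn_integral_distr[symmetric]) auto
  also have "\<dots> = ennreal r * (\<integral>\<^sup>+z. f (c * z) \<partial>M)"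
    unfolding D by (rule nn_integral_scale_measure) simp
  finally show ?thesis .
qed

lemma space_arclength [simp]: "space arclength = UNIV"
  using sets_eq_imp_space_eq[OF sets_arclength] by simp

lemma measurable_norm_powr [measurable]: "(\<lambda>z::complex. ennreal (norm z powr p)) \<in> borel_measurable borel"
  by measurable

lemma mult_image_borel:
  fixes c :: complex
  assumes c: "c \<noteq> 0" and E: "E \<in> sets borel" shows "(*) c ` E \<in> sets borel"
proof -
  have "(*) c ` E = (*) (1/c) -` E" using c by (force simp: image_iff)
  then show ?thesis using measurable_sets_borel[of "(*) (1/c)" borel E] E by simp
qed

text \<open>Area and length scale with the exponents \<open>s = 2\<close> and \<open>s = 1\<close>; the density adds \<open>p\<close>.\<close>

lemma weighted_nn_integral_mult:
  fixes c :: complex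
  assumes sets: "sets M = sets borel" and c: "c \<noteq> 0"
    and scale: "\<And>A. A \<in> sets borel \<Longrightarrow> emeasure M ((*) c ` A) = ennreal (norm c powr s) * emeasure M A"
    and E: "E \<in> sets borel"
  shows "(\<integral>\<^sup>+z\<in>(*) c ` E. ennreal (norm z powr p) \<partial>M)
    = ennreal (norm c powr (p + s)) * (\<integral>\<^sup>+z\<in>E. ennreal (norm z powr p) \<partial>M)"
proof -
  have [measurable]: "(*) c ` E \<in> sets borel" "E \<in> sets borel" using mult_image_borel[OF c E] E by auto
  note [measurable_cong] = sets
  have ind: "indicator ((*) c ` E) (c * z) = (indicator E z :: ennreal)" for z
    using c by (auto simp: indicator_def)
  have "(\<integral>\<^sup>+z\<in>(*) c ` E. ennreal (norm z powr p) \<partial>M)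
    = ennreal (norm c powr s) * (\<integral>\<^sup>+z. ennreal (norm (c * z) powr p) * indicator ((*) c ` E) (c * z) \<partial>M)"
    by (rule nn_integral_scaled[OF sets c _ scale]) auto
  also have "(\<integral>\<^sup>+z. ennreal (norm (c * z) powr p) * indicator ((*) c ` E) (c * z) \<partial>M)
     = (\<integral>\<^sup>+z. ennreal (norm c powr p) * (ennreal (norm z powr p) * indicator E z) \<partial>M)"
    unfolding ind
    by (intro nn_integral_cong) (simp add: norm_mult powr_mult ennreal_mult mult.assoc)
  also have "\<dots> = ennreal (norm c powr p) * (\<integral>\<^sup>+z. ennreal (norm z powr p) * indicator E z \<partial>M)"
    by (rule nn_integral_cmult) measurable
  finally show ?thesis by (simp add: powr_add ennreal_mult ac_simps)
qed

lemma weighted_area_mult: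
  fixes c :: complex
  assumes c: "c \<noteq> 0" and E: "E \<in> sets borel"
  shows "weighted_area p ((*) c ` E) = ennreal (norm c powr (p + 2)) * weighted_area p E"
  unfolding weighted_area_def using c E
  by (intro weighted_nn_integral_mult) (auto simp: emeasure_lborel_mult powr_numeral)

lemma weighted_perimeter_mult:
  fixes c :: complex
  assumes c: "c \<noteq> 0"
  shows "weighted_perimeter p ((*) c ` M) ((*) c ` E) = ennreal (norm c powr (p + 1)) * weighted_perimeter p M E"
proof -
  have inj: "inj ((*) c)" using c by (simp add: inj_def)
  have "frontier ((*) c ` E) - frontier ((*) c ` M) = (*) c ` (frontier E - frontier M)"
    by (simp add: frontier_mult[OF c] image_set_diff[OF inj])
  moreover have "(\<integral>\<^sup>+z\<in>(*) c ` (frontier E - frontier M). ennreal (norm z powr p) \<partial>arclength)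
    = ennreal (norm c powr (p + 1)) * (\<integral>\<^sup>+z\<in>frontier E - frontier M. ennreal (norm z powr p) \<partial>arclength)"
  proof (rule weighted_nn_integral_mult[OF sets_arclength c])
    fix A assume A: "A \<in> sets (borel :: complex measure)"
    then show "emeasure arclength ((*) c ` A) = ennreal (norm c powr 1) * emeasure arclength A"
      using c by (simp add: emeasure_arclength mult_image_borel hausdorff1_mult)
  qed simp
  ultimately show ?thesis unfolding weighted_perimeter_def by simp
qed

lemma region_mult:
  fixes c :: complex
  assumes c: "c \<noteq> 0" and "region M E"
  shows "region ((*) c ` M) ((*) c ` E)"
  using assms unfolding region_def by (auto simp: interior_mult[OF c] closure_mult[OF c])

lemma isoperimetric_mult:
  fixes c :: complex
  assumes c: "norm c = 1"
  shows "isoperimetric p ((*) c ` M) A ((*) c ` E) \<longleftrightarrow> isoperimetric p M A E"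
proof -
  have "isoperimetric p ((*) c ` M) A ((*) c ` E)" if c: "norm c = 1" and iso: "isoperimetric p M A E" for c :: complex and M E
  proof -
    have c0: "c \<noteq> 0" "1 / c \<noteq> 0" "norm (1 / c) = 1" using c by (auto simp: norm_divide)
    have cl: "X \<in> sets borel" if "region N X" for N X
      using that unfolding region_def by (metis borel_closed closed_closure)
    have cancel: "(*) (1/c) ` ((*) c ` X) = X" for X using c0 by (auto simp: image_image)
    have forth: "(*) c ` ((*) (1/c) ` X) = X" for X using c0 by (auto simp: image_image)
    show ?thesis unfolding isoperimetric_def
    proof (intro conjI allI impI)
      have E: "region M E" "weighted_area p E = ennreal A" using iso by (auto simp: isoperimetric_def)
      show "region ((*) c ` M) ((*) c ` E)" using region_mult c0 E by blast
      show "weighted_area p ((*) c ` E) = ennreal A"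
        using weighted_area_mult[OF c0(1) cl[OF E(1)], of p] E c by simp
      fix F assume F: "region ((*) c ` M) F \<and> weighted_area p F = ennreal A"
      define G where "G = (*) (1/c) ` F"
      have FG: "F = (*) c ` G" unfolding G_def by (rule forth[symmetric])
      have "region M G" using region_mult[OF c0(2), of "(*) c ` M" F] F by (simp only: cancel G_def)
      moreover have "weighted_area p G = ennreal A"
        using weighted_area_mult[OF c0(2) cl, of _ F p] F c0(3) by (auto simp: G_def)
      ultimately have "weighted_perimeter p M E \<le> weighted_perimeter p M G"
        using iso by (auto simp: isoperimetric_def)
      then show "weighted_perimeter p ((*) c ` M) ((*) c ` E) \<le> weighted_perimeter p ((*) c ` M) F"
        using c by (simp add: FG weighted_perimeter_mult[OF c0(1)])
    qed
  qed note one_direction = this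
  show ?thesis
  proof
    assume "isoperimetric p ((*) c ` M) A ((*) c ` E)"
    then have "isoperimetric p ((*) (1/c) ` ((*) c ` M)) A ((*) (1/c) ` ((*) c ` E))"
      by (rule one_direction[rotated]) (use c in \<open>simp add: norm_divide\<close>)
    moreover have cancel: "(*) (1/c) ` ((*) c ` X) = X" for X using c by (auto simp: image_image)
    ultimately show "isoperimetric p M A E" by (simp only: cancel)
  qed (use one_direction c in blast)
qed

section \<open>The relative isoperimetric inequality in a parallelogram\<close>

text \<open>The relative isoperimetric inequality in the unit square.  A horizontal or vertical line in the
  square that misses the frontier of \<open>E\<close> lies in \<open>E\<close> or is disjoint from it.  If all such lines are
  disjoint from \<open>E\<close>, then \<open>E\<close> is contained in the product \<open>X \<times> Y\<close> of the two projections of its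
  frontier, which has measure at most \<open>h * h\<close>.  A line contained in \<open>E\<close> is excluded when \<open>h < 3/4\<close>:
  either some parallel line misses \<open>E\<close>, and then every perpendicular line crosses the frontier, or
  nearly all parallel lines lie in \<open>E\<close>, which has too small an area for that.\<close>

lemma square_projections:
  fixes E :: "(real \<times> real) set" and J :: "real set"
  defines "J \<equiv> {0<..<1}"
  assumes E: "E \<in> sets borel" and X: "X \<in> sets borel" and Y: "Y \<in> sets borel"
    and fr: "\<And>x y. (x, y) \<in> frontier E \<Longrightarrow> x \<in> J \<Longrightarrow> y \<in> J \<Longrightarrow> x \<in> X \<and> y \<in> Y"
    and h: "0 \<le> h" "emeasure lborel X \<le> ennreal h" "emeasure lborel Y \<le> ennreal h"
    and small: "emeasure lborel (E \<inter> J \<times> J) \<le> ennreal (1/4)"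
  shows "emeasure lborel (E \<inter> J \<times> J) \<le> ennreal (h * h)"
proof (cases "3/4 \<le> h")
  case True
  have "(1/4::real) \<le> (3/4) * (3/4)" by simp
  also have "\<dots> \<le> h * h" using True by (intro mult_mono) auto
  finally show ?thesis using small by (meson ennreal_leI order_trans)
next
  case False
  have J: "J \<in> sets borel" "emeasure lborel J = 1" by (auto simp: J_def)
  have prod: "emeasure lborel (A \<times> B) = emeasure lborel A * emeasure lborel B"
    if "A \<in> sets borel" "B \<in> sets borel" for A B :: "real set"
    using that unfolding lborel_prod[symmetric] by (subst lborel.emeasure_pair_measure_Times) auto
  have big: "ennreal (1/4) < emeasure lborel (J - Z)"
    if Z: "Z \<in> sets borel" "emeasure lborel Z \<le> ennreal h" for Z :: "real set"
  proof -
    have "ennreal 1 = emeasure lborel J" using J by simp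
    also have "\<dots> \<le> emeasure lborel ((J - Z) \<union> Z)" using J Z by (intro emeasure_mono) auto
    also have "\<dots> \<le> emeasure lborel (J - Z) + emeasure lborel Z"
      using J Z by (intro emeasure_subadditive) auto
    also have "\<dots> \<le> emeasure lborel (J - Z) + ennreal h" using Z by (intro add_left_mono)
    finally have 1: "ennreal 1 \<le> emeasure lborel (J - Z) + ennreal h" .
    show ?thesis
    proof (rule ccontr)
      assume "\<not> ennreal (1/4) < emeasure lborel (J - Z)"
      then have "emeasure lborel (J - Z) + ennreal h \<le> ennreal (1/4) + ennreal h"
        by (intro add_right_mono) auto
      also have "\<dots> = ennreal (1/4 + h)" using h(1) by (intro ennreal_plus[symmetric]) auto
      finally have "ennreal 1 \<le> ennreal (1/4 + h)" using 1 by (rule order_trans[rotated])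
      then show False using False h(1) by (subst (asm) ennreal_le_iff) auto
    qed
  qed
  have not_cover: "\<not> J \<subseteq> Z" if "Z \<in> sets borel" "emeasure lborel Z \<le> ennreal h" for Z :: "real set"
  proof
    assume "J \<subseteq> Z"
    then have "J - Z = {}" by blast
    then have "emeasure lborel (J - Z) = 0" by (simp only: emeasure_empty)
    then show False using big[OF that] by simp
  qed
  have con: "connected ({x} \<times> J)" "connected (J \<times> {y})" for x y :: real
    unfolding J_def by (intro connected_Times; simp)+
  have vert: "x \<in> X" if "x \<in> J" "a \<in> J" "b \<in> J" "(x, a) \<in> E" "(x, b) \<notin> E" for x a b
  proof -
    have "{x} \<times> J \<inter> frontier E \<noteq> {}"
      by (rule connected_Int_frontier[OF con(1)]) (use that in auto)
    then obtain y where "y \<in> J" "(x, y) \<in> frontier E" by auto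
    then show ?thesis using fr that(1) by simp
  qed
  have horiz: "y \<in> Y" if "y \<in> J" "a \<in> J" "b \<in> J" "(a, y) \<in> E" "(b, y) \<notin> E" for y a b
  proof -
    have "J \<times> {y} \<inter> frontier E \<noteq> {}"
      by (rule connected_Int_frontier[OF con(2)]) (use that in auto)
    then obtain x where "x \<in> J" "(x, y) \<in> frontier E" by auto
    then show ?thesis using fr that(1) by simp
  qed
  \<comment> \<open>The next two facts exclude lines contained in \<open>E\<close>.\<close>
  have no_vertical: "\<exists>y\<in>J. (u, y) \<notin> E" if u: "u \<in> J" for u
  proof (rule ccontr)
    assume "\<not> (\<exists>y\<in>J. (u, y) \<notin> E)"
    then have full: "(u, y) \<in> E" if "y \<in> J" for y using that by blast
    have "(v, y) \<in> E" if v: "v \<in> J" "v \<notin> X" and y: "y \<in> J" for v y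
    proof (rule ccontr)
      assume "(v, y) \<notin> E"
      then have empty: "(v, y') \<notin> E" if "y' \<in> J" for y' using vert[OF v(1) that y] v(2) by blast
      have "y' \<in> Y" if "y' \<in> J" for y' by (rule horiz[OF that u v(1) full[OF that] empty[OF that]])
      then show False using not_cover[OF Y h(3)] by blast
    qed
    then have "(J - X) \<times> J \<subseteq> E \<inter> J \<times> J" by auto
    then have "emeasure lborel ((J - X) \<times> J) \<le> emeasure lborel (E \<inter> J \<times> J)"
      using E J by (intro emeasure_mono) (auto intro!: sets.Int borel_Times)
    also have "\<dots> \<le> ennreal (1/4)" by (rule small)
    finally have "emeasure lborel (J - X) \<le> ennreal (1/4)"
      using prod[of "J - X" J] J X by simp
    then show False using big[OF X h(2)] by simp
  qed
  have no_horizontal: "\<exists>x\<in>J. (x, u) \<notin> E" if u: "u \<in> J" for u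
  proof (rule ccontr)
    assume "\<not> (\<exists>x\<in>J. (x, u) \<notin> E)"
    then have full: "(x, u) \<in> E" if "x \<in> J" for x using that by blast
    have "(x, v) \<in> E" if v: "v \<in> J" "v \<notin> Y" and x: "x \<in> J" for v x
    proof (rule ccontr)
      assume "(x, v) \<notin> E"
      then have empty: "(x', v) \<notin> E" if "x' \<in> J" for x' using horiz[OF v(1) that x] v(2) by blast
      have "x' \<in> X" if "x' \<in> J" for x' by (rule vert[OF that u v(1) full[OF that] empty[OF that]])
      then show False using not_cover[OF X h(2)] by blast
    qed
    then have "J \<times> (J - Y) \<subseteq> E \<inter> J \<times> J" by auto
    then have "emeasure lborel (J \<times> (J - Y)) \<le> emeasure lborel (E \<inter> J \<times> J)"
      using E J by (intro emeasure_mono) (auto intro!: sets.Int borel_Times)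
    also have "\<dots> \<le> ennreal (1/4)" by (rule small)
    finally have "emeasure lborel (J - Y) \<le> ennreal (1/4)"
      using prod[of J "J - Y"] J Y by simp
    then show False using big[OF Y h(3)] by simp
  qed
  have "E \<inter> J \<times> J \<subseteq> X \<times> Y"
  proof
    fix z assume "z \<in> E \<inter> J \<times> J"
    then obtain x y where z: "z = (x, y)" and xy: "(x, y) \<in> E" "x \<in> J" "y \<in> J" by auto
    obtain a b where "a \<in> J" "(x, a) \<notin> E" "b \<in> J" "(b, y) \<notin> E"
      using no_vertical[OF xy(2)] no_horizontal[OF xy(3)] by blast
    then show "z \<in> X \<times> Y" unfolding z using vert[OF xy(2,3)] horiz[OF xy(3,2)] xy by simp
  qed
  then have "emeasure lborel (E \<inter> J \<times> J) \<le> emeasure lborel (X \<times> Y)"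
    using X Y by (intro emeasure_mono) (auto intro!: borel_Times)
  also have "\<dots> \<le> ennreal h * ennreal h" unfolding prod[OF X Y] using h by (intro mult_mono) auto
  finally show ?thesis using h by (simp add: ennreal_mult)
qed

lemma homeomorphism_UNIV_I:
  assumes "continuous_on UNIV f" "continuous_on UNIV g" "\<And>x. f (g x) = x" "\<And>x. g (f x) = x"
  shows "homeomorphism UNIV UNIV f g"
  using assms by (intro homeomorphismI) auto

text \<open>The frontier is counted only inside \<open>Q\<close>; the smallness condition keeps \<open>E\<close> from filling \<open>Q\<close>.\<close>

definition relatively_isoperimetric :: "real \<Rightarrow> real \<Rightarrow> complex set \<Rightarrow> bool" where
  "relatively_isoperimetric K q Q \<longleftrightarrow>
     (\<forall>E\<in>sets borel. emeasure lborel (E \<inter> Q) \<le> ennreal q \<longrightarrow>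
        emeasure lborel (E \<inter> Q) \<le> ennreal K * (hausdorff1 (frontier E \<inter> Q))\<^sup>2)"

text \<open>Pull back to the unit square.  The two coordinates of the inverse map are Lipschitz, so the
  projections of the frontier have measure at most \<open>L\<close> times its length, and \<open>K\<close>, \<open>q\<close> depend on the
  linear map \<open>T\<close> only, not on the position \<open>a\<close>.\<close>

lemma parallelogram_relatively_isoperimetric:
  fixes T :: "real \<times> real \<Rightarrow> complex"
  assumes T: "linear T" "bij T"
  obtains K q where "0 < K" "0 < q"
    "\<And>a. relatively_isoperimetric K q ((\<lambda>z. a + T z) ` ({0<..<1} \<times> {0<..<1}))"
proof -
  obtain k where k: "0 < k" "\<And>A. A \<in> sets borel \<Longrightarrow> T ` A \<in> sets borel"
    "\<And>A. A \<in> sets borel \<Longrightarrow> emeasure lborel (T ` A) = ennreal k * emeasure lborel A"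
    by (rule emeasure_linear_image[OF T]) blast
  define g where "g = inv T"
  note g = linear_inv_bij(1)[OF T, folded g_def] and fg = linear_inv_bij(2,3)[OF T, folded g_def]
  obtain L where L: "0 < L" "\<And>x. norm (g x) \<le> L * norm x"
    using linear_bounded_pos[OF g] by blast
  let ?J = "{0<..<1} :: real set"
  have "relatively_isoperimetric (k * L * L) (k / 4) ((\<lambda>z. a + T z) ` (?J \<times> ?J))" for a
    unfolding relatively_isoperimetric_def
  proof (intro ballI impI)
    let ?Q = "(\<lambda>z. a + T z) ` (?J \<times> ?J)"
    fix E :: "complex set"
    assume E: "E \<in> sets borel" and small: "emeasure lborel (E \<inter> ?Q) \<le> ennreal (k / 4)"
    let ?f = "\<lambda>z. a + T z" and ?g = "\<lambda>w. g (w - a)"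
    have cT: "continuous_on S T" "continuous_on S' g" for S S'
      using T(1) g by (auto intro!: linear_continuous_on simp: linear_linear)
    have cont: "continuous_on UNIV ?f" by (intro continuous_intros cT)
    have contg: "continuous_on UNIV ?g"
      by (rule continuous_on_compose2[OF cT(2)[of UNIV]]) (auto intro!: continuous_intros)
    have hom: "homeomorphism UNIV UNIV ?f ?g"
      by (rule homeomorphism_UNIV_I[OF cont contg]) (simp_all add: fg)
    define E' where "E' = ?f -` E"
    have E': "E' \<in> sets borel" unfolding E'_def
      using borel_measurable_continuous_onI[OF cont] E by (rule measurable_sets_borel)
    have fE': "?f ` E' = E"
    proof
      show "E \<subseteq> ?f ` E'"
      proof
        fix x assume "x \<in> E"
        moreover have "x = ?f (?g x)" by (simp add: fg)
        ultimately show "x \<in> ?f ` E'" unfolding E'_def by (intro image_eqI[of _ _ "?g x"]) auto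
      qed
    qed (auto simp: E'_def)
    have frE': "?f z \<in> frontier E" if "z \<in> frontier E'" for z
      using image_homeomorphism_topology(3)[OF hom, of E'] that fE' by blast
    have area: "emeasure lborel (E \<inter> ?Q) = ennreal k * emeasure lborel (E' \<inter> ?J \<times> ?J)"
    proof -
      have b: "E' \<inter> ?J \<times> ?J \<in> sets borel" using E' by (intro sets.Int borel_Times) auto
      have "E \<inter> ?Q = ?f ` (E' \<inter> ?J \<times> ?J)" by (auto simp: E'_def)
      also have "\<dots> = (+) a ` (T ` (E' \<inter> ?J \<times> ?J))" by (simp add: image_image)
      also have "\<dots> = (\<lambda>x. - a + 1 *\<^sub>R x) -` (T ` (E' \<inter> ?J \<times> ?J))" by (rule translation_image_eq_vimage)
      finally show ?thesis
        using emeasure_lborel_affine_vimage[OF _ k(2)[OF b], of 1 "-a"] k(3)[OF b] by simp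
    qed
    let ?S = "frontier E \<inter> ?Q"
    show "emeasure lborel (E \<inter> ?Q) \<le> ennreal (k * L * L) * (hausdorff1 ?S)\<^sup>2"
    proof (cases "hausdorff1 ?S = \<infinity>")
      case True
      then show ?thesis using k L by (simp add: power2_eq_square ennreal_mult_top)
    next
      case False
      then obtain m where m: "0 \<le> m" "hausdorff1 ?S = ennreal m"
        by (cases "hausdorff1 ?S") (auto simp: top_unique)
      have lip: "\<bar>fst (?g x) - fst (?g y)\<bar> \<le> L * dist x y" "\<bar>snd (?g x) - snd (?g y)\<bar> \<le> L * dist x y" for x y
      proof -
        have f: "\<bar>fst u\<bar> \<le> norm u" "\<bar>snd u\<bar> \<le> norm u" for u :: "real \<times> real"
          using norm_fst_le[of "fst u" "snd u"] norm_snd_le[of "snd u" "fst u"] by simp_all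
        have "?g x - ?g y = g (x - y)" by (simp add: linear_diff[OF g, symmetric])
        then have "norm (?g x - ?g y) \<le> L * dist x y" using L(2)[of "x - y"] by (simp add: dist_norm)
        then show "\<bar>fst (?g x) - fst (?g y)\<bar> \<le> L * dist x y" "\<bar>snd (?g x) - snd (?g y)\<bar> \<le> L * dist x y"
          using f[of "?g x - ?g y"] unfolding fst_diff snd_diff by linarith+
      qed
      obtain X where X: "X \<in> sets borel" "(\<lambda>x. fst (?g x)) ` ?S \<subseteq> X" "emeasure lborel X \<le> ennreal L * hausdorff1 ?S"
        by (rule hausdorff1_covers_projection[of L ?S "\<lambda>x. fst (?g x)"]) (use L lip in auto)
      obtain Y where Y: "Y \<in> sets borel" "(\<lambda>x. snd (?g x)) ` ?S \<subseteq> Y" "emeasure lborel Y \<le> ennreal L * hausdorff1 ?S"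
        by (rule hausdorff1_covers_projection[of L ?S "\<lambda>x. snd (?g x)"]) (use L lip in auto)
      have "emeasure lborel (E' \<inter> ?J \<times> ?J) \<le> ennreal ((L * m) * (L * m))"
      proof (rule square_projections[OF E' X(1) Y(1)])
        fix x y assume xy: "(x, y) \<in> frontier E'" "x \<in> ?J" "y \<in> ?J"
        have S: "?f (x, y) \<in> ?S" using frE'[OF xy(1)] xy(2,3) by blast
        have "fst (?g (?f (x, y))) \<in> X" "snd (?g (?f (x, y))) \<in> Y" using S X(2) Y(2) by blast+
        then show "x \<in> X \<and> y \<in> Y" by (simp add: fg)
      next
        show "0 \<le> L * m" using L m by simp
        show "emeasure lborel X \<le> ennreal (L * m)" "emeasure lborel Y \<le> ennreal (L * m)"
          using X(3) Y(3) m L by (simp_all add: ennreal_mult)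
        have "ennreal k * emeasure lborel (E' \<inter> ?J \<times> ?J) \<le> ennreal k * ennreal (1/4)"
          using small k(1) by (simp add: area ennreal_mult[symmetric])
        then show "emeasure lborel (E' \<inter> ?J \<times> ?J) \<le> ennreal (1/4)"
          using k(1) by (subst (asm) ennreal_mult_le_mult_iff) auto
      qed
      then have "ennreal k * emeasure lborel (E' \<inter> ?J \<times> ?J) \<le> ennreal k * ennreal ((L * m) * (L * m))"
        by (rule mult_left_mono) simp
      also have "\<dots> = ennreal (k * L * L) * (hausdorff1 ?S)\<^sup>2"
        using k L m by (simp add: power2_eq_square ennreal_mult[symmetric] ac_simps)
      finally show ?thesis unfolding area .
    qed
  qed
  then show thesis using that[of "k * L * L" "k / 4"] k L by simp
qed

section \<open>The isoperimetric inequality away from the origin\<close>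

lemma weighted_integral_bounds:
  fixes M :: "complex measure"
  assumes sets: "sets M = sets borel" and S: "S \<in> sets borel"
  shows "(\<And>z. z \<in> S \<Longrightarrow> m \<le> norm z powr p) \<Longrightarrow> ennreal m * emeasure M S \<le> (\<integral>\<^sup>+z\<in>S. ennreal (norm z powr p) \<partial>M)"
    and "(\<And>z. z \<in> S \<Longrightarrow> norm z powr p \<le> m) \<Longrightarrow> (\<integral>\<^sup>+z\<in>S. ennreal (norm z powr p) \<partial>M) \<le> ennreal m * emeasure M S"
proof -
  have SM: "S \<in> sets M" using sets S by simp
  have eq: "ennreal m * emeasure M S = (\<integral>\<^sup>+z. ennreal m * indicator S z \<partial>M)"
    using SM by (simp add: nn_integral_cmult_indicator)
  show "ennreal m * emeasure M S \<le> (\<integral>\<^sup>+z\<in>S. ennreal (norm z powr p) \<partial>M)"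
    if "\<And>z. z \<in> S \<Longrightarrow> m \<le> norm z powr p"
    unfolding eq using that by (intro nn_integral_mono) (auto simp: indicator_def ennreal_leI)
  show "(\<integral>\<^sup>+z\<in>S. ennreal (norm z powr p) \<partial>M) \<le> ennreal m * emeasure M S"
    if "\<And>z. z \<in> S \<Longrightarrow> norm z powr p \<le> m"
    unfolding eq using that by (intro nn_integral_mono) (auto simp: indicator_def ennreal_leI)
qed

lemma nn_integral_set_mono:
  fixes f :: "'a \<Rightarrow> ennreal"
  assumes "S \<subseteq> T"
  shows "(\<integral>\<^sup>+z\<in>S. f z \<partial>M) \<le> (\<integral>\<^sup>+z\<in>T. f z \<partial>M)"
proof (rule nn_integral_mono)
  fix z
  show "f z * indicator S z \<le> f z * indicator T z"
    using assms by (cases "z \<in> S") auto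
qed

lemma weighted_area_mono: "E \<subseteq> F \<Longrightarrow> weighted_area p E \<le> weighted_area p F"
  unfolding weighted_area_def by (rule nn_integral_set_mono)

text \<open>On the part of a tile at distance at least \<open>t\<close> from the origin, the density varies at most by the
  factor \<open>\<kappa> powr (2 * p)\<close>, because the tile has diameter at most \<open>D\<close>.  So the unweighted inequality
  carries over to each tile with a common constant.  Adding up uses that a sum of squares is at most
  the square of the sum.\<close>

lemma tiling_isoperimetric:
  fixes Q :: "nat \<Rightarrow> complex set"
  assumes p: "0 < p" and t: "0 < t" and K: "0 < K" and q: "0 < q" and D: "0 \<le> D"
    and disj: "disjoint_family Q" and op: "\<And>i. open (Q i)" and N: "\<And>i. Q i \<subseteq> interior N"
    and iso: "\<And>i. relatively_isoperimetric K q (Q i)"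
    and diam: "\<And>i x y. x \<in> Q i \<Longrightarrow> y \<in> Q i \<Longrightarrow> dist x y \<le> D"
  obtains C a where "0 < C" "0 < a"
    "\<And>E. E \<in> sets borel \<Longrightarrow> (\<And>z. z \<in> E \<Longrightarrow> t \<le> norm z) \<Longrightarrow> weighted_area p E \<le> ennreal a \<Longrightarrow>
       weighted_area p (E \<inter> (\<Union>i. Q i)) \<le> ennreal C * (weighted_perimeter p N E)\<^sup>2"
proof -
  define \<kappa> where "\<kappa> = 1 + D / t"
  have \<kappa>: "1 \<le> \<kappa>" using D t by (simp add: \<kappa>_def)
  define m0 where "m0 = (t / \<kappa>) powr p"
  have m0: "0 < m0" using t \<kappa> by (simp add: m0_def)
  define C where "C = \<kappa> powr (2 * p) * K / m0"
  have C: "0 < C" using \<kappa> K m0 by (simp add: C_def)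
  show thesis
  proof (rule that[of C "q * m0"])
    show "0 < C" by fact
    show "0 < q * m0" using q m0 by simp
    fix E :: "complex set"
    assume E: "E \<in> sets borel" and far: "\<And>z. z \<in> E \<Longrightarrow> t \<le> norm z"
      and small: "weighted_area p E \<le> ennreal (q * m0)"
    let ?w = "\<lambda>z. ennreal (norm z powr p)"
    define P where "P i = (\<integral>\<^sup>+z\<in>frontier E \<inter> Q i. ?w z \<partial>arclength)" for i
    have bor: "E \<inter> Q i \<in> sets borel" "frontier E \<inter> Q i \<in> sets borel" for i
      using E op by auto
    have farf: "t \<le> norm z" if "z \<in> frontier E" for z
    proof -
      have "closure E \<subseteq> {z. t \<le> norm z}"
        using far by (intro closure_minimal) (auto intro!: closed_Collect_le continuous_intros)
      then show ?thesis using that by (auto simp: frontier_def)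
    qed
    have tile: "weighted_area p (E \<inter> Q i) \<le> ennreal C * (P i)\<^sup>2" for i
    proof (cases "\<exists>z0. z0 \<in> Q i \<and> t \<le> norm z0")
      case False
      then have "E \<inter> Q i = {}" using far by blast
      then show ?thesis by (simp add: weighted_area_def)
    next
      case True
      then obtain z0 where z0: "z0 \<in> Q i" "t \<le> norm z0" by blast
      define R where "R = norm z0"
      have R: "t \<le> R" "0 < R" using z0 t by (auto simp: R_def)
      define m where "m = (R / \<kappa>) powr p"
      have m: "m0 \<le> m" "0 < m"
        using R t \<kappa> p unfolding m_def m0_def by (auto intro!: powr_mono2 divide_right_mono)
      have bound: "m \<le> norm z powr p \<and> norm z powr p \<le> \<kappa> powr (2 * p) * m"
        if z: "z \<in> Q i" "t \<le> norm z" for z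
      proof -
        have d: "norm z \<le> R + D" "R \<le> norm z + D"
          using diam[OF z(1) z0(1)] norm_triangle_ineq2[of z z0] norm_triangle_ineq2[of z0 z]
          by (auto simp: R_def dist_norm norm_minus_commute)
        have "D \<le> D / t * R" "D \<le> D / t * norm z"
          using D t R(1) z(2) by (simp_all add: field_simps mult_left_mono)
        then have "norm z \<le> \<kappa> * R" "R \<le> \<kappa> * norm z" using d by (auto simp: \<kappa>_def algebra_simps)
        then have "R / \<kappa> \<le> norm z" "norm z \<le> \<kappa>\<^sup>2 * (R / \<kappa>)"
          using \<kappa> by (auto simp: field_simps power2_eq_square)
        then have 1: "m \<le> norm z powr p" "norm z powr p \<le> (\<kappa>\<^sup>2 * (R / \<kappa>)) powr p"
          using p R \<kappa> unfolding m_def by (auto intro!: powr_mono2)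
        have "(\<kappa>\<^sup>2 * (R / \<kappa>)) powr p = (\<kappa>\<^sup>2) powr p * m"
          using \<kappa> R unfolding m_def by (subst powr_mult) auto
        also have "(\<kappa>\<^sup>2) powr p = \<kappa> powr (2 * p)"
          using \<kappa> by (simp add: powr_powr[symmetric] powr_numeral)
        finally show ?thesis using 1 by simp
      qed
      have alg: "ennreal (x / m) * (ennreal m * H)\<^sup>2 = ennreal (x * m) * H\<^sup>2" if "0 \<le> x" for x H
      proof -
        have "ennreal (x / m) * (ennreal m * H)\<^sup>2 = ennreal (x / m) * ennreal (m\<^sup>2) * H\<^sup>2"
          using m by (simp add: power_mult_distrib ennreal_power mult.assoc)
        also have "ennreal (x / m) * ennreal (m\<^sup>2) = ennreal (x * m)"
          using m that by (simp add: ennreal_mult[symmetric] power2_eq_square)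
        finally show ?thesis .
      qed
      have lower: "ennreal m * emeasure lborel (E \<inter> Q i) \<le> weighted_area p (E \<inter> Q i)"
        unfolding weighted_area_def using bound far bor
        by (intro weighted_integral_bounds(1)) auto
      have "ennreal m * emeasure lborel (E \<inter> Q i) \<le> ennreal (q * m0)"
        using lower weighted_area_mono[of "E \<inter> Q i" E p] small by (meson inf_le1 order_trans)
      also have "\<dots> \<le> ennreal m * ennreal q"
        using m q m0 by (simp add: ennreal_mult[symmetric] mult.commute mult_left_mono)
      finally have "emeasure lborel (E \<inter> Q i) \<le> ennreal q"
        using m by (subst (asm) ennreal_mult_le_mult_iff) auto
      then have 2: "emeasure lborel (E \<inter> Q i) \<le> ennreal K * (hausdorff1 (frontier E \<inter> Q i))\<^sup>2"
        using iso[of i] E unfolding relatively_isoperimetric_def by blast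
      have 3: "ennreal m * hausdorff1 (frontier E \<inter> Q i) \<le> P i"
        unfolding P_def emeasure_arclength[OF bor(2), symmetric]
        using bound farf bor by (intro weighted_integral_bounds(1)) (auto simp: sets_arclength)
      have "weighted_area p (E \<inter> Q i) \<le> ennreal (\<kappa> powr (2 * p) * m) * emeasure lborel (E \<inter> Q i)"
        unfolding weighted_area_def using bound far bor
        by (intro weighted_integral_bounds(2)) auto
      also have "\<dots> \<le> ennreal (\<kappa> powr (2 * p) * m) * (ennreal K * (hausdorff1 (frontier E \<inter> Q i))\<^sup>2)"
        using 2 by (rule mult_left_mono) simp
      also have "\<dots> = ennreal (\<kappa> powr (2 * p) * K * m) * (hausdorff1 (frontier E \<inter> Q i))\<^sup>2"
        using m K by (simp add: ennreal_mult ac_simps)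
      also have "\<dots> = ennreal (\<kappa> powr (2 * p) * K / m) * (ennreal m * hausdorff1 (frontier E \<inter> Q i))\<^sup>2"
        using K by (intro alg[symmetric]) simp
      also have "\<dots> \<le> ennreal C * (P i)\<^sup>2"
      proof (rule mult_mono)
        show "ennreal (\<kappa> powr (2 * p) * K / m) \<le> ennreal C"
          unfolding C_def using m m0 K \<kappa> by (intro ennreal_leI divide_left_mono) auto
        show "(ennreal m * hausdorff1 (frontier E \<inter> Q i))\<^sup>2 \<le> (P i)\<^sup>2"
          using 3 by (intro power_mono) auto
      qed auto
      finally show ?thesis .
    qed
    \<comment> \<open>The tiles lie in the interior of \<open>N\<close>, so the frontier inside them is counted in the perimeter.\<close>
    have sumP: "(\<Sum>i. P i) \<le> weighted_perimeter p N E"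
    proof -
      have "(\<Sum>i. P i) = (\<integral>\<^sup>+z. (\<Sum>i. ?w z * indicator (frontier E \<inter> Q i) z) \<partial>arclength)"
        unfolding P_def using bor
        by (intro nn_integral_suminf[symmetric]) (simp add: measurable_cong_sets[OF sets_arclength refl])
      also have "\<dots> \<le> (\<integral>\<^sup>+z. ?w z * indicator (frontier E - frontier N) z \<partial>arclength)"
      proof (rule nn_integral_mono)
        fix z
        have "(\<Sum>i. ?w z * indicator (frontier E \<inter> Q i) z)
            = ?w z * (\<Sum>i. indicator (frontier E \<inter> Q i) z)"
          by (rule ennreal_suminf_cmult)
        also have "(\<Sum>i. indicator (frontier E \<inter> Q i) z) = (indicator (\<Union>i. frontier E \<inter> Q i) z :: ennreal)"
          using disj by (intro suminf_indicator) (auto simp: disjoint_family_on_def)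
        also have "\<dots> \<le> indicator (frontier E - frontier N) z"
          using N by (auto simp: indicator_def frontier_def)
        finally show "(\<Sum>i. ?w z * indicator (frontier E \<inter> Q i) z) \<le> ?w z * indicator (frontier E - frontier N) z"
          by (simp add: mult_left_mono)
      qed
      finally show ?thesis unfolding weighted_perimeter_def .
    qed
    have "weighted_area p (E \<inter> (\<Union>i. Q i)) = (\<integral>\<^sup>+z. (\<Sum>i. ?w z * indicator (E \<inter> Q i) z) \<partial>lborel)"
      unfolding weighted_area_def
    proof (rule nn_integral_cong)
      fix z
      have "(\<Sum>i. indicator (E \<inter> Q i) z) = (indicator (\<Union>i. E \<inter> Q i) z :: ennreal)"
        using disj by (intro suminf_indicator) (auto simp: disjoint_family_on_def)
      then show "?w z * indicator (E \<inter> (\<Union>i. Q i)) z = (\<Sum>i. ?w z * indicator (E \<inter> Q i) z)"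
        unfolding ennreal_suminf_cmult by simp
    qed
    also have "\<dots> = (\<Sum>i. weighted_area p (E \<inter> Q i))"
      unfolding weighted_area_def using bor by (intro nn_integral_suminf) simp
    also have "\<dots> \<le> (\<Sum>i. ennreal C * weighted_perimeter p N E * P i)"
    proof (intro suminf_le summableI)
      fix i
      have "P i \<le> (\<Sum>i. P i)" using sum_le_suminf[of P "{i}"] by simp
      then have "P i \<le> weighted_perimeter p N E" using sumP by (rule order_trans)
      then have "ennreal C * (P i)\<^sup>2 \<le> ennreal C * weighted_perimeter p N E * P i"
        unfolding power2_eq_square mult.assoc by (intro mult_left_mono mult_right_mono) auto
      then show "weighted_area p (E \<inter> Q i) \<le> ennreal C * weighted_perimeter p N E * P i"
        using tile order_trans by blast
    qed
    also have "\<dots> = ennreal C * weighted_perimeter p N E * (\<Sum>i. P i)"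
      by (rule ennreal_suminf_cmult)
    also have "\<dots> \<le> ennreal C * weighted_perimeter p N E * weighted_perimeter p N E"
      using sumP by (rule mult_left_mono) simp
    finally show "weighted_area p (E \<inter> (\<Union>i. Q i)) \<le> ennreal C * (weighted_perimeter p N E)\<^sup>2"
      by (simp add: power2_eq_square mult.assoc)
  qed
qed

text \<open>An isoperimetric inequality with the exponent of the Euclidean plane, for sets of small area at
  distance at least \<open>t\<close> from the origin.\<close>

definition exterior_isoperimetric :: "real \<Rightarrow> complex set \<Rightarrow> real \<Rightarrow> bool" where
  "exterior_isoperimetric p N t \<longleftrightarrow> (\<exists>C a. 0 < C \<and> 0 < a \<and>
     (\<forall>E\<in>sets borel. E \<subseteq> N \<longrightarrow> (\<forall>z\<in>E. t \<le> norm z) \<longrightarrow> weighted_area p E \<le> ennreal a \<longrightarrow>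
        weighted_area p E \<le> ennreal C * (weighted_perimeter p N E)\<^sup>2))"

text \<open>Pairwise disjoint open translates of one parallelogram.  Empty members allow finite families.\<close>

definition tiling :: "complex set \<Rightarrow> (nat \<Rightarrow> complex set) \<Rightarrow> bool" where
  "tiling N Q \<longleftrightarrow> disjoint_family Q \<and> (\<forall>i. Q i \<subseteq> N) \<and>
     (\<exists>T. linear T \<and> bij T \<and>
       (\<forall>i. Q i = {} \<or> (\<exists>a. Q i = (\<lambda>z::real \<times> real. a + T z) ` ({0<..<1} \<times> {0<..<1}))))"

lemma open_parallelogram:
  fixes T :: "real \<times> real \<Rightarrow> complex"
  assumes T: "linear T" "bij T"
  shows "open ((\<lambda>z. a + T z) ` ({0<..<1} \<times> {0<..<1}))"
proof -
  have "open (T ` ({0<..<1} \<times> {0<..<1}))"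
    using T by (intro open_surjective_linear_image) (auto simp: open_Times bij_is_surj)
  then have "open ((+) a ` T ` ({0<..<1} \<times> {0<..<1}))" by (rule open_translation)
  then show ?thesis by (simp add: image_image)
qed

lemma tiling_open:
  assumes "tiling N Q" shows "open (Q i)"
proof -
  obtain T :: "real \<times> real \<Rightarrow> complex" where T: "linear T" "bij T"
      "Q i = {} \<or> (\<exists>a. Q i = (\<lambda>z. a + T z) ` ({0<..<1} \<times> {0<..<1}))"
    using assms unfolding tiling_def by blast
  then show ?thesis using open_parallelogram[OF T(1,2)] by auto
qed

text \<open>The constants of the finitely many tilings are added, and the null set \<open>Z\<close> carries no area.\<close>

lemma exterior_isoperimetric_if_tilings:
  fixes Q :: "nat \<Rightarrow> nat \<Rightarrow> complex set"
  assumes p: "0 < p" and t: "0 < t" and til: "\<And>j. j < n \<Longrightarrow> tiling N (Q j)"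
    and Z: "Z \<in> sets borel" "emeasure lborel Z = 0" and cover: "N \<subseteq> (\<Union>j<n. \<Union>i. Q j i) \<union> Z"
  shows "exterior_isoperimetric p N t"
proof -
  define good where "good j C a \<longleftrightarrow> 0 < C \<and> 0 < a \<and>
    (\<forall>E\<in>sets borel. (\<forall>z\<in>E. t \<le> norm z) \<longrightarrow> weighted_area p E \<le> ennreal a \<longrightarrow>
       weighted_area p (E \<inter> (\<Union>i. Q j i)) \<le> ennreal C * (weighted_perimeter p N E)\<^sup>2)" for j C a
  have ex: "\<exists>C a. good j C a" if j: "j < n" for j
  proof -
    obtain T where T: "linear T" "bij T" and disj: "disjoint_family (Q j)" and N: "\<And>i. Q j i \<subseteq> N"
      and Q: "\<And>i. Q j i = {} \<or> (\<exists>a. Q j i = (\<lambda>z::real \<times> real. a + T z) ` ({0<..<1} \<times> {0<..<1}))"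
      using til[OF j] unfolding tiling_def by blast
    obtain K q where Kq: "0 < K" "0 < q"
      "\<And>a. relatively_isoperimetric K q ((\<lambda>z. a + T z) ` ({0<..<1} \<times> {0<..<1}))"
      using parallelogram_relatively_isoperimetric[OF T] by blast
    obtain L where L: "0 < L" "\<And>x. norm (T x) \<le> L * norm x"
      using linear_bounded_pos[OF T(1)] by blast
    have op: "open (Q j i)" for i using tiling_open[OF til[OF j]] .
    have "relatively_isoperimetric K q (Q j i)" for i
    proof (cases "Q j i = {}")
      case True
      then show ?thesis by (simp add: relatively_isoperimetric_def)
    next
      case False
      then show ?thesis using Q[of i] Kq(3) by auto
    qed
    moreover have "dist x y \<le> L * 2" if xy: "x \<in> Q j i" "y \<in> Q j i" for i x y
    proof -
      obtain a where "Q j i = (\<lambda>z. a + T z) ` ({0<..<1} \<times> {0<..<1})" using Q[of i] xy by auto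
      then obtain u v where uv: "u \<in> {0<..<1} \<times> {0<..<1}" "v \<in> {0<..<1} \<times> {0<..<1}" "x = a + T u" "y = a + T v"
        using xy by blast
      have "dist x y = norm (T (u - v))" using uv by (simp add: dist_norm linear_diff[OF T(1)])
      also have "\<dots> \<le> L * norm (u - v)" by (rule L)
      also have "\<dots> \<le> L * 2"
      proof (rule mult_left_mono)
        have "norm (u - v) \<le> norm (fst (u - v)) + norm (snd (u - v))"
          using norm_Pair_le[of "fst (u - v)" "snd (u - v)"] unfolding prod.collapse .
        also have "\<dots> \<le> 1 + 1" using uv by (intro add_mono) auto
        finally show "norm (u - v) \<le> 2" by simp
      qed (use L in simp)
      finally show ?thesis .
    qed
    moreover have "Q j i \<subseteq> interior N" for i using N op by (simp add: interior_maximal)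
    ultimately obtain C a where C: "0 < C" and a: "0 < a"
      and Ca: "\<And>E. E \<in> sets borel \<Longrightarrow> (\<And>z. z \<in> E \<Longrightarrow> t \<le> norm z) \<Longrightarrow> weighted_area p E \<le> ennreal a \<Longrightarrow>
       weighted_area p (E \<inter> (\<Union>i. Q j i)) \<le> ennreal C * (weighted_perimeter p N E)\<^sup>2"
      using tiling_isoperimetric[OF p t Kq(1,2) _ disj op, of "L * 2" N] L(1)
      by (metis less_eq_real_def zero_le_mult_iff zero_le_numeral)
    have "good j C a" unfolding good_def by (intro conjI ballI impI C a Ca) auto
    then show ?thesis by blast
  qed
  then obtain C a where good: "\<And>j. j < n \<Longrightarrow> good j (C j) (a j)" by metis
  have Ca: "0 < C j" "0 < a j"
    "E \<in> sets borel \<Longrightarrow> (\<forall>z\<in>E. t \<le> norm z) \<Longrightarrow> weighted_area p E \<le> ennreal (a j) \<Longrightarrow>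
       weighted_area p (E \<inter> (\<Union>i. Q j i)) \<le> ennreal (C j) * (weighted_perimeter p N E)\<^sup>2"
    if "j < n" for j E
    using good[OF that] unfolding good_def by auto
  define C' where "C' = 1 + (\<Sum>j<n. C j)"
  define a' where "a' = Min (insert 1 (a ` {..<n}))"
  show ?thesis unfolding exterior_isoperimetric_def
  proof (rule exI[of _ C'], rule exI[of _ a'], intro conjI ballI impI)
    show "0 < C'" using Ca(1) unfolding C'_def by (intro add_pos_nonneg sum_nonneg) (auto intro: less_imp_le)
    show "0 < a'" using Ca(2) unfolding a'_def by (subst Min_gr_iff) auto
    fix E :: "complex set"
    assume E: "E \<in> sets borel" "E \<subseteq> N" "\<forall>z\<in>E. t \<le> norm z" "weighted_area p E \<le> ennreal a'"
    let ?P = "weighted_perimeter p N E"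
    have le: "weighted_area p E \<le> ennreal (a j)" if "j < n" for j
    proof -
      have "a' \<le> a j" unfolding a'_def using that by (intro Min_le) auto
      then show ?thesis using E(4) by (meson ennreal_leI order_trans)
    qed
    have bor: "E \<inter> (\<Union>i. Q j i) \<in> sets borel" if "j < n" for j
      using E(1) tiling_open[OF til[OF that]] by (intro sets.Int sets.countable_UN) auto
    have "weighted_area p E \<le> (\<integral>\<^sup>+z. (\<Sum>j<n. ennreal (norm z powr p) * indicator (E \<inter> (\<Union>i. Q j i)) z) + ennreal (norm z powr p) * indicator Z z \<partial>lborel)"
      unfolding weighted_area_def
    proof (rule nn_integral_mono)
      fix z
      show "ennreal (norm z powr p) * indicator E z \<le> (\<Sum>j<n. ennreal (norm z powr p) * indicator (E \<inter> (\<Union>i. Q j i)) z) + ennreal (norm z powr p) * indicator Z z"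
      proof (cases "z \<in> E \<and> z \<notin> Z")
        case True
        then obtain j where j: "j < n" "z \<in> E \<inter> (\<Union>i. Q j i)" using cover E(2) by blast
        have "ennreal (norm z powr p) * indicator E z = ennreal (norm z powr p) * indicator (E \<inter> (\<Union>i. Q j i)) z"
          using j True by (simp add: indicator_def)
        also have "\<dots> \<le> (\<Sum>j<n. ennreal (norm z powr p) * indicator (E \<inter> (\<Union>i. Q j i)) z)"
          using j(1) by (intro member_le_sum) auto
        finally show ?thesis using add_increasing2 by (metis zero_le)
      qed (auto simp: indicator_def)
    qed
    also have "\<dots> = (\<Sum>j<n. weighted_area p (E \<inter> (\<Union>i. Q j i))) + (\<integral>\<^sup>+z. ennreal (norm z powr p) * indicator Z z \<partial>lborel)"
    proof -
      have m: "(\<lambda>z. ennreal (norm z powr p) * indicator (E \<inter> (\<Union>i. Q j i)) z) \<in> borel_measurable lborel" if "j < n" for j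
        using bor[OF that] by simp
      have "(\<lambda>z. \<Sum>j<n. ennreal (norm z powr p) * indicator (E \<inter> (\<Union>i. Q j i)) z) \<in> borel_measurable lborel"
        using m by (intro borel_measurable_sum) simp
      moreover have "(\<lambda>z. ennreal (norm z powr p) * indicator Z z) \<in> borel_measurable lborel"
        using Z(1) by simp
      moreover have "(\<integral>\<^sup>+z. (\<Sum>j<n. ennreal (norm z powr p) * indicator (E \<inter> (\<Union>i. Q j i)) z) \<partial>lborel)
          = (\<Sum>j<n. weighted_area p (E \<inter> (\<Union>i. Q j i)))"
        unfolding weighted_area_def using m by (intro nn_integral_sum) simp
      ultimately show ?thesis by (simp only: nn_integral_add)
    qed
    also have "(\<integral>\<^sup>+z. ennreal (norm z powr p) * indicator Z z \<partial>lborel) = 0"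
      using Z by (intro nn_integral_null_set) (auto simp: null_sets_def)
    also have "(\<Sum>j<n. weighted_area p (E \<inter> (\<Union>i. Q j i))) + 0 \<le> (\<Sum>j<n. ennreal (C j) * ?P\<^sup>2)"
      using Ca(3) E le by (auto intro!: sum_mono)
    also have "\<dots> = ennreal (\<Sum>j<n. C j) * ?P\<^sup>2"
    proof -
      have "ennreal (\<Sum>j<n. C j) = (\<Sum>j<n. ennreal (C j))"
        using Ca(1) by (intro sum_ennreal[symmetric]) (simp add: less_imp_le)
      then show ?thesis by (simp add: sum_distrib_right)
    qed
    also have "\<dots> \<le> ennreal C' * ?P\<^sup>2"
      unfolding C'_def by (intro mult_right_mono ennreal_leI) auto
    finally show "weighted_area p E \<le> ennreal C' * ?P\<^sup>2" .
  qed
qed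

section \<open>Weighted length and negligible frontiers\<close>

definition weighted_length :: "real \<Rightarrow> complex set \<Rightarrow> ennreal" where
  "weighted_length p S = (\<integral>\<^sup>+z\<in>S. ennreal (norm z powr p) \<partial>arclength)"

lemma weighted_perimeter_eq_length: "weighted_perimeter p M E = weighted_length p (frontier E - frontier M)"
  by (simp add: weighted_perimeter_def weighted_length_def)

lemma weighted_length_mono: "S \<subseteq> T \<Longrightarrow> weighted_length p S \<le> weighted_length p T"
  unfolding weighted_length_def by (rule nn_integral_set_mono)

lemma weighted_length_Un_disjoint:
  assumes "S \<in> sets borel" "T \<in> sets borel" "S \<inter> T = {}"
  shows "weighted_length p (S \<union> T) = weighted_length p S + weighted_length p T"
proof -
  have "(\<lambda>z. ennreal (norm z powr p)) \<in> borel_measurable arclength"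
    by (subst measurable_cong_sets[OF sets_arclength refl]) (rule measurable_norm_powr)
  then show ?thesis
    unfolding weighted_length_def using assms by (intro nn_integral_disjoint_pair) (simp_all add: sets_arclength)
qed

lemma weighted_length_Un:
  assumes "S \<in> sets borel" "T \<in> sets borel"
  shows "weighted_length p (S \<union> T) \<le> weighted_length p S + weighted_length p T"
proof -
  have "weighted_length p (S \<union> T) = weighted_length p (S \<union> (T - S))" by simp
  also have "\<dots> = weighted_length p S + weighted_length p (T - S)"
    using assms by (intro weighted_length_Un_disjoint) auto
  also have "\<dots> \<le> weighted_length p S + weighted_length p T"
    by (intro add_left_mono weighted_length_mono) auto
  finally show ?thesis .
qed

lemma weighted_area_Un_disjoint:
  assumes "S \<in> sets borel" "T \<in> sets borel" "S \<inter> T = {}"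
  shows "weighted_area p (S \<union> T) = weighted_area p S + weighted_area p T"
proof -
  have "(\<lambda>z. ennreal (norm z powr p)) \<in> borel_measurable lborel"
    using measurable_norm_powr by simp
  then show ?thesis
    unfolding weighted_area_def using assms by (intro nn_integral_disjoint_pair) simp_all
qed

lemma weighted_area_null:
  assumes "S \<in> sets borel" "emeasure lborel S = 0"
  shows "weighted_area p S = 0"
  unfolding weighted_area_def using assms by (intro nn_integral_null_set) (simp add: null_sets_def)

text \<open>Where the density is bounded below, finite weighted length means finite length, and the plane without
  the origin is a countable union of annuli of this kind.\<close>

lemma weighted_perimeter_finite_imp_null_frontier:
  assumes fin: "weighted_perimeter p N F < \<infinity>" and N: "emeasure lborel (frontier N) = 0"
  shows "emeasure lborel (frontier F) = 0"
proof -
  define S where "S n = (frontier F - frontier N) \<inter> {z. 1 / real (Suc n) \<le> norm z \<and> norm z \<le> real (Suc n)}" for n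
  have S: "S n \<in> sets borel" for n
  proof -
    have "closed {z::complex. 1 / real (Suc n) \<le> norm z \<and> norm z \<le> real (Suc n)}"
      by (intro closed_Collect_conj closed_Collect_le continuous_intros)
    then show ?thesis unfolding S_def by auto
  qed
  have null: "emeasure lborel (S n) = 0" for n
  proof -
    define m where "m = min ((1 / real (Suc n)) powr p) (real (Suc n) powr p)"
    have m: "0 < m" by (simp add: m_def)
    have bound: "m \<le> norm z powr p" if "z \<in> S n" for z
    proof (cases "0 \<le> p")
      case True
      then have "(1 / real (Suc n)) powr p \<le> norm z powr p"
        using that by (intro powr_mono2) (auto simp: S_def)
      then show ?thesis by (simp add: m_def)
    next
      case False
      have "0 < norm z" using that less_le_trans[of 0 "1 / real (Suc n)" "norm z"] by (auto simp: S_def)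
      then have "real (Suc n) powr p \<le> norm z powr p"
        using False that by (intro powr_mono2') (auto simp: S_def)
      then show ?thesis by (simp add: m_def)
    qed
    have "ennreal m * hausdorff1 (S n) \<le> weighted_length p (S n)"
      unfolding weighted_length_def emeasure_arclength[OF S, symmetric]
      by (rule weighted_integral_bounds(1)[OF sets_arclength S bound])
    also have "\<dots> \<le> weighted_perimeter p N F"
      unfolding weighted_perimeter_eq_length by (rule weighted_length_mono) (auto simp: S_def)
    finally have "ennreal m * hausdorff1 (S n) < \<infinity>" using fin by (rule le_less_trans)
    then have "hausdorff1 (S n) < \<infinity>" using m by (auto simp: ennreal_mult_less_top)
    then show ?thesis by (rule hausdorff1_finite_imp_null[OF S])
  qed
  have "frontier F \<subseteq> (frontier N \<union> {0}) \<union> (\<Union>n. S n)"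
  proof
    fix z assume z: "z \<in> frontier F"
    show "z \<in> (frontier N \<union> {0}) \<union> (\<Union>n. S n)"
    proof (cases "z \<in> frontier N \<or> z = 0")
      case False
      then have z0: "0 < norm z" by simp
      obtain n1 :: nat where n1: "1 / norm z \<le> real n1" using real_arch_simple by blast
      obtain n2 :: nat where n2: "norm z \<le> real n2" using real_arch_simple by blast
      have "1 / norm z \<le> real (Suc (n1 + n2))" "norm z \<le> real (Suc (n1 + n2))" using n1 n2 by auto
      then have "z \<in> S (n1 + n2)" using z False z0 by (simp add: S_def field_simps)
      then show ?thesis by blast
    qed auto
  qed
  then have "emeasure lborel (frontier F) \<le> emeasure lborel ((frontier N \<union> {0}) \<union> (\<Union>n. S n))"
    using S by (intro emeasure_mono) auto
  also have "\<dots> = 0"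
  proof -
    have "S n \<in> null_sets lborel" for n using S null by (simp add: null_sets_def)
    then have "(\<Union>n. S n) \<in> null_sets lborel" by (rule null_sets_UN)
    moreover have "frontier N \<in> null_sets lborel" "{0::complex} \<in> null_sets lborel"
      using N by (simp_all add: null_sets_def)
    ultimately have "(frontier N \<union> {0}) \<union> (\<Union>n. S n) \<in> null_sets lborel" by (intro null_sets.Un)
    then show ?thesis by (rule null_setsD1)
  qed
  finally show ?thesis by simp
qed

section \<open>Slicing by squares\<close>

text \<open>Regions are cut by the boundaries of squares and not by circles, because slices by the four sides are
  slices by coordinate lines, for which Fubini's theorem is directly available.\<close>

definition square :: "real \<Rightarrow> complex set" where
  "square t = {z. \<bar>Re z\<bar> \<le> t \<and> \<bar>Im z\<bar> \<le> t}"

definition open_square :: "real \<Rightarrow> complex set" where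
  "open_square t = {z. \<bar>Re z\<bar> < t \<and> \<bar>Im z\<bar> < t}"

definition rim :: "real \<Rightarrow> complex set" where
  "rim t = square t - open_square t"

definition right_side :: "real \<Rightarrow> complex set" where
  "right_side t = {z. Re z = t \<and> \<bar>Im z\<bar> \<le> t}"

lemma closed_square: "closed (square t)"
  unfolding square_def by (intro closed_Collect_conj closed_Collect_le continuous_intros)

lemma open_open_square: "open (open_square t)"
  unfolding open_square_def by (intro open_Collect_conj open_Collect_less continuous_intros)

lemma closed_rim: "closed (rim t)"
  unfolding rim_def by (intro closed_Diff closed_square open_open_square)

lemma open_square_subset: "open_square t \<subseteq> square t"
  by (auto simp: open_square_def square_def)

lemma square_mono: "s \<le> t \<Longrightarrow> square s \<subseteq> square t"
  by (auto simp: square_def)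

lemma square_norm_le: "z \<in> square t \<Longrightarrow> norm z \<le> sqrt 2 * t"
proof -
  assume z: "z \<in> square t"
  then have "(Re z)\<^sup>2 \<le> t\<^sup>2" "(Im z)\<^sup>2 \<le> t\<^sup>2" and t: "0 \<le> t"
    by (auto simp: square_def abs_le_square_iff[symmetric])
  then have "(Re z)\<^sup>2 + (Im z)\<^sup>2 \<le> 2 * t\<^sup>2" by simp
  then have "norm z \<le> sqrt (2 * t\<^sup>2)" unfolding cmod_def by (rule real_sqrt_le_mono)
  then show "norm z \<le> sqrt 2 * t" using t by (simp add: real_sqrt_mult)
qed

lemma norm_ge_outside_open_square: "z \<notin> open_square t \<Longrightarrow> t \<le> norm z"
  using abs_Re_le_cmod[of z] abs_Im_le_cmod[of z] by (auto simp: open_square_def)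

lemma ii_cubed: "\<i> ^ 3 = - \<i>"
  by (simp add: power3_eq_cube)

lemma rim_eq: "0 \<le> t \<Longrightarrow> rim t = (\<Union>j<4. (*) (\<i> ^ j) ` right_side t)"
proof
  assume t: "0 \<le> t"
  show "rim t \<subseteq> (\<Union>j<4. (*) (\<i> ^ j) ` right_side t)"
  proof
    fix z assume "z \<in> rim t"
    then have z: "\<bar>Re z\<bar> \<le> t" "\<bar>Im z\<bar> \<le> t" "Re z = t \<or> Im z = t \<or> Re z = - t \<or> Im z = - t"
      by (auto simp: rim_def square_def open_square_def)
    have ex: "\<exists>j<4. z \<in> (*) (\<i> ^ j) ` right_side t"
    proof (cases "Re z = t")
      case True
      then have "z \<in> (*) (\<i> ^ 0) ` right_side t" using z by (simp add: right_side_def)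
      then show ?thesis by (intro exI[of _ 0]) simp
    next
      case 1: False
      show ?thesis
      proof (cases "Im z = t")
        case True
        then have "z = \<i> ^ 1 * Complex t (- Re z)" by (simp add: complex_eq_iff)
        moreover have "Complex t (- Re z) \<in> right_side t" using z by (simp add: right_side_def)
        ultimately have "z \<in> (*) (\<i> ^ 1) ` right_side t" by (rule image_eqI)
        then show ?thesis by (intro exI[of _ 1]) simp
      next
        case 2: False
        show ?thesis
        proof (cases "Re z = - t")
          case True
          then have "z = \<i> ^ 2 * Complex t (- Im z)" by (simp add: complex_eq_iff)
          moreover have "Complex t (- Im z) \<in> right_side t" using z by (simp add: right_side_def)
          ultimately have "z \<in> (*) (\<i> ^ 2) ` right_side t" by (rule image_eqI)
          then show ?thesis by (intro exI[of _ 2]) simp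
        next
          case 3: False
          then have "Im z = - t" using z 1 2 by simp
          then have "z = \<i> ^ 3 * Complex t (Re z)" unfolding ii_cubed by (simp add: complex_eq_iff)
          moreover have "Complex t (Re z) \<in> right_side t" using z by (simp add: right_side_def)
          ultimately have "z \<in> (*) (\<i> ^ 3) ` right_side t" by (rule image_eqI)
          then show ?thesis by (intro exI[of _ 3]) simp
        qed
      qed
    qed
    then show "z \<in> (\<Union>j<4. (*) (\<i> ^ j) ` right_side t)" by blast
  qed
  have "(*) (\<i> ^ j) ` right_side t \<subseteq> rim t" if "j < 4" for j
  proof -
    have "j = 0 \<or> j = 1 \<or> j = 2 \<or> j = 3" using that by auto
    then show ?thesis using t
      by (elim disjE) (auto simp: right_side_def rim_def square_def open_square_def ii_cubed)
  qed
  then show "(\<Union>j<4. (*) (\<i> ^ j) ` right_side t) \<subseteq> rim t" by blast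
qed

lemma right_side_eq: "right_side t = Complex t ` {-t..t}"
  by (auto simp: right_side_def image_iff complex_eq_iff abs_le_iff)

lemma hausdorff1_rim_finite:
  assumes "0 \<le> t" shows "hausdorff1 (rim t) < \<infinity>"
proof -
  have side: "hausdorff1 ((*) (\<i> ^ j) ` right_side t) < \<infinity>" for j
    using assms by (simp add: hausdorff1_mult norm_power right_side_eq hausdorff1_vertical)
  have "finite A \<Longrightarrow> hausdorff1 (\<Union>j\<in>A. (*) (\<i> ^ j) ` right_side t) < \<infinity>" for A :: "nat set"
  proof (induction A rule: finite_induct)
    case (insert j A)
    have "hausdorff1 (\<Union>j\<in>insert j A. (*) (\<i> ^ j) ` right_side t)
        \<le> hausdorff1 ((*) (\<i> ^ j) ` right_side t) + hausdorff1 (\<Union>j\<in>A. (*) (\<i> ^ j) ` right_side t)"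
      using hausdorff1_Un by simp
    also have "\<dots> < \<infinity>" using insert side by simp
    finally show ?case .
  qed (simp add: hausdorff1_empty)
  then show ?thesis using rim_eq[OF assms] by simp
qed

lemma rim_null: "0 \<le> t \<Longrightarrow> emeasure lborel (rim t) = 0"
  by (intro hausdorff1_finite_imp_null hausdorff1_rim_finite borel_closed closed_rim)

lemma right_side_integral:
  obtains k where "0 < k" "\<And>F t s. closed F \<Longrightarrow>
    (\<lambda>u. hausdorff1 (F \<inter> right_side u) * indicator {t<..s} u) \<in> borel_measurable borel \<and>
    (\<integral>\<^sup>+u. hausdorff1 (F \<inter> right_side u) * indicator {t<..s} u \<partial>lborel)
      = ennreal k * emeasure lborel (F \<inter> {z. t < Re z \<and> Re z \<le> s \<and> \<bar>Im z\<bar> \<le> Re z})"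
proof -
  let ?T = "\<lambda>(x, y). Complex x y"
  have l: "linear ?T" by (rule linearI) (auto simp: complex_eq_iff)
  have b: "bij ?T" by (rule o_bij[of "\<lambda>z. (Re z, Im z)"]) (auto simp: complex_eq_iff)
  obtain k where k: "0 < k"
    "\<And>A. A \<in> sets borel \<Longrightarrow> emeasure lborel (?T ` A) = ennreal k * emeasure lborel A"
    using emeasure_linear_image[OF l b] by metis
  show thesis
  proof (rule that[of "1 / k"])
    show "0 < 1 / k" using k by simp
    fix F :: "complex set" and t s :: real
    assume F: "closed F"
    let ?R = "F \<inter> {z. t < Re z \<and> Re z \<le> s \<and> \<bar>Im z\<bar> \<le> Re z}"
    define A where "A = ?T -` ?R"
    have R: "?R \<in> sets borel"
    proof -
      have "?R = F \<inter> {z. t < Re z} \<inter> {z. Re z \<le> s} \<inter> {z. \<bar>Im z\<bar> \<le> Re z}" by auto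
      also have "\<dots> \<in> sets borel"
        using F by (intro sets.Int borel_closed borel_open open_Collect_less closed_Collect_le continuous_intros) auto
      finally show ?thesis .
    qed
    have A: "A \<in> sets borel" unfolding A_def
      using R by (rule measurable_sets_borel[rotated])
        (intro borel_measurable_continuous_onI linear_continuous_on, use l in \<open>simp add: linear_linear\<close>)
    have TA: "?T ` A = ?R" unfolding A_def by (rule surj_image_vimage_eq[OF bij_is_surj[OF b]])
    have slice: "emeasure lborel (Pair u -` A) = hausdorff1 (F \<inter> right_side u) * indicator {t<..s} u" for u
    proof (cases "u \<in> {t<..s}")
      case True
      have "F \<inter> right_side u = Complex u ` (Pair u -` A)"
        using True by (force simp: A_def right_side_def image_iff complex_eq_iff)
      moreover have "Pair u -` A \<in> sets borel"
        using A by (rule measurable_sets_borel[rotated]) simp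
      ultimately show ?thesis using True by (simp add: hausdorff1_vertical)
    next
      case False
      then have "Pair u -` A = {}" by (auto simp: A_def)
      then show ?thesis using False by simp
    qed
    have AP: "A \<in> sets (lborel \<Otimes>\<^sub>M lborel)" unfolding lborel_prod using A by simp
    have "(\<lambda>u. emeasure lborel (Pair u -` A)) \<in> borel_measurable borel"
      using lborel.measurable_emeasure_Pair[OF AP] by simp
    then have m: "(\<lambda>u. hausdorff1 (F \<inter> right_side u) * indicator {t<..s} u) \<in> borel_measurable borel"
      by (simp add: slice)
    have "emeasure lborel A = emeasure (lborel \<Otimes>\<^sub>M lborel) A" by (simp add: lborel_prod)
    also have "\<dots> = (\<integral>\<^sup>+u. emeasure lborel (Pair u -` A) \<partial>lborel)"
      by (rule lborel.emeasure_pair_measure_alt[OF AP])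
    finally have "emeasure lborel A = (\<integral>\<^sup>+u. hausdorff1 (F \<inter> right_side u) * indicator {t<..s} u \<partial>lborel)"
      by (simp add: slice)
    moreover have "ennreal (1 / k) * emeasure lborel ?R = emeasure lborel A"
      using k(2)[OF A] k(1) unfolding TA by (simp add: mult.assoc[symmetric] ennreal_mult[symmetric])
    ultimately show "(\<lambda>u. hausdorff1 (F \<inter> right_side u) * indicator {t<..s} u) \<in> borel_measurable borel \<and>
      (\<integral>\<^sup>+u. hausdorff1 (F \<inter> right_side u) * indicator {t<..s} u \<partial>lborel) = ennreal (1 / k) * emeasure lborel ?R"
      using m by simp
  qed
qed

text \<open>The coarea inequality for the growing squares.  Rotating by multiples of a right angle reduces each
  side to the right one, where it is Fubini's theorem.\<close>

lemma rim_integral: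
  obtains c where "0 < c" "\<And>F t s h. closed F \<Longrightarrow> 0 \<le> t \<Longrightarrow> t \<le> s \<Longrightarrow> 0 \<le> h \<Longrightarrow>
    (\<And>u. t < u \<Longrightarrow> u \<le> s \<Longrightarrow> ennreal h \<le> hausdorff1 (F \<inter> rim u)) \<Longrightarrow>
    ennreal (h * (s - t)) \<le> ennreal c * emeasure lborel (F \<inter> (square s - square t))"
proof -
  obtain k where k: "0 < k" "\<And>F t s. closed F \<Longrightarrow>
    (\<lambda>u. hausdorff1 (F \<inter> right_side u) * indicator {t<..s} u) \<in> borel_measurable borel \<and>
    (\<integral>\<^sup>+u. hausdorff1 (F \<inter> right_side u) * indicator {t<..s} u \<partial>lborel)
      = ennreal k * emeasure lborel (F \<inter> {z. t < Re z \<and> Re z \<le> s \<and> \<bar>Im z\<bar> \<le> Re z})"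
    using right_side_integral by blast
  show thesis
  proof (rule that[of "4 * k"])
    show "0 < 4 * k" using k by simp
    fix F :: "complex set" and t s h :: real
    assume F: "closed F" and t: "0 \<le> t" and ts: "t \<le> s" and h: "0 \<le> h"
      and le: "\<And>u. t < u \<Longrightarrow> u \<le> s \<Longrightarrow> ennreal h \<le> hausdorff1 (F \<inter> rim u)"
    define G where "G j = (*) (1 / \<i> ^ j) ` F" for j :: nat
    have ij: "\<i> ^ j \<noteq> 0" "1 / \<i> ^ j \<noteq> 0" "norm (\<i> ^ j) = 1" for j :: nat by (auto simp: norm_power)
    have G: "closed (G j)" for j
      unfolding G_def using F closure_mult[OF ij(2), of j F] by (metis closed_closure closure_closed)
    have rot: "(*) (\<i> ^ j) ` (G j \<inter> S) = F \<inter> (*) (\<i> ^ j) ` S" for j S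
    proof -
      have "inj ((*) (\<i> ^ j))" using ij by (simp add: inj_def)
      moreover have "(*) (\<i> ^ j) ` G j = F" by (auto simp: G_def image_image)
      ultimately show ?thesis by (simp add: image_Int)
    qed
    let ?R = "{z. t < Re z \<and> Re z \<le> s \<and> \<bar>Im z\<bar> \<le> Re z}"
    have area: "emeasure lborel (G j \<inter> ?R) \<le> emeasure lborel (F \<inter> (square s - square t))" if j: "j < 4" for j
    proof -
      have Rb: "?R \<in> sets borel"
      proof -
        have "?R = {z. t < Re z} \<inter> {z. Re z \<le> s} \<inter> {z. \<bar>Im z\<bar> \<le> Re z}" by auto
        also have "\<dots> \<in> sets borel"
          by (intro sets.Int borel_closed borel_open open_Collect_less closed_Collect_le continuous_intros)
        finally show ?thesis .
      qed
      have "emeasure lborel (G j \<inter> ?R) = emeasure lborel ((*) (\<i> ^ j) ` (G j \<inter> ?R))"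
        using emeasure_lborel_mult[OF ij(1), of "G j \<inter> ?R" j] Rb G ij(3)[of j] by auto
      also have "\<dots> = emeasure lborel (F \<inter> (*) (\<i> ^ j) ` ?R)" by (simp only: rot)
      also have "\<dots> \<le> emeasure lborel (F \<inter> (square s - square t))"
      proof (rule emeasure_mono)
        have "j = 0 \<or> j = 1 \<or> j = 2 \<or> j = 3" using j by auto
        then have "(*) (\<i> ^ j) ` ?R \<subseteq> square s - square t"
          by (elim disjE) (auto simp: square_def ii_cubed)
        then show "F \<inter> (*) (\<i> ^ j) ` ?R \<subseteq> F \<inter> (square s - square t)" by blast
        show "F \<inter> (square s - square t) \<in> sets lborel" using F closed_square by auto
      qed
      finally show ?thesis .
    qed
    have "ennreal (h * (s - t)) = (\<integral>\<^sup>+u. ennreal h * indicator {t<..s} u \<partial>lborel)"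
      using h ts by (simp add: nn_integral_cmult_indicator ennreal_mult)
    also have "\<dots> \<le> (\<integral>\<^sup>+u. (\<Sum>j<4. hausdorff1 (G j \<inter> right_side u) * indicator {t<..s} u) \<partial>lborel)"
    proof (rule nn_integral_mono)
      fix u
      show "ennreal h * indicator {t<..s} u \<le> (\<Sum>j<4. hausdorff1 (G j \<inter> right_side u) * indicator {t<..s} u)"
      proof (cases "u \<in> {t<..s}")
        case True
        have "ennreal h \<le> hausdorff1 (F \<inter> rim u)" using le True by simp
        also have "F \<inter> rim u = (\<Union>j<4. F \<inter> (*) (\<i> ^ j) ` right_side u)"
          using rim_eq[of u] True t by auto
        also have "hausdorff1 \<dots> \<le> (\<Sum>j<4::nat. hausdorff1 (F \<inter> (*) (\<i> ^ j) ` right_side u))"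
        proof -
          have "hausdorff1 (\<Union>j<n. X j) \<le> (\<Sum>j<n. hausdorff1 (X j))" for n and X :: "nat \<Rightarrow> complex set"
          proof (induction n)
            case (Suc n)
            have "hausdorff1 (\<Union>j<Suc n. X j) \<le> hausdorff1 (\<Union>j<n. X j) + hausdorff1 (X n)"
              using hausdorff1_Un[of "\<Union>j<n. X j" "X n"] by (simp add: lessThan_Suc Un_commute)
            also have "\<dots> \<le> (\<Sum>j<n. hausdorff1 (X j)) + hausdorff1 (X n)" using Suc by (intro add_right_mono)
            finally show ?case by simp
          qed (simp add: hausdorff1_empty)
          then show ?thesis .
        qed
        also have "\<dots> = (\<Sum>j<4. hausdorff1 (G j \<inter> right_side u))"
          using hausdorff1_mult[OF ij(1)] ij(3) by (intro sum.cong refl) (simp flip: rot)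
        finally show ?thesis using True by simp
      qed simp
    qed
    also have "\<dots> = (\<Sum>j<4. ennreal k * emeasure lborel (G j \<inter> ?R))"
      using k(2)[OF G] by (subst nn_integral_sum) auto
    also have "\<dots> \<le> (\<Sum>j<4::nat. ennreal k * emeasure lborel (F \<inter> (square s - square t)))"
      using area by (intro sum_mono mult_left_mono) auto
    also have "\<dots> = ennreal (4 * k) * emeasure lborel (F \<inter> (square s - square t))"
      using k by (simp add: ennreal_mult mult.assoc)
    finally show "ennreal (h * (s - t)) \<le> ennreal (4 * k) * emeasure lborel (F \<inter> (square s - square t))" .
  qed
qed

text \<open>A discrete form of the differential inequality \<open>a' \<le> - \<kappa> sqrt a\<close>, whose solutions vanish after
  time \<open>2 sqrt (a t0) / \<kappa>\<close>.  At the times \<open>T n\<close>, whose gaps are halved in each step, \<open>a\<close> is at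
  most \<open>a t0 / 4 ^ n\<close>.\<close>

lemma finite_time_extinction:
  fixes a :: "real \<Rightarrow> real"
  assumes \<kappa>: "0 < \<kappa>" and nonneg: "\<And>t. 0 \<le> a t"
    and dec: "\<And>t s. t0 \<le> t \<Longrightarrow> t \<le> s \<Longrightarrow> s \<le> t1 \<Longrightarrow> \<kappa> * sqrt (a s) * (s - t) \<le> a t - a s"
    and long: "4 * sqrt (a t0) / \<kappa> \<le> t1 - t0"
  shows "a t1 = 0"
proof -
  define d where "d = 2 * sqrt (a t0) / \<kappa>"
  have d: "0 \<le> d" "2 * d \<le> t1 - t0" using \<kappa> nonneg[of t0] long by (auto simp: d_def)
  define T where "T n = t0 + 2 * d * (1 - (1/2) ^ n)" for n
  have Tr: "t0 \<le> T n" "T n \<le> t1" for n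
  proof -
    have q: "0 \<le> 1 - (1/2::real) ^ n" "1 - (1/2::real) ^ n \<le> 1" by (auto simp: power_le_one)
    have "0 \<le> 2 * d * (1 - (1/2) ^ n)" using q(1) d(1) by simp
    moreover have "2 * d * (1 - (1/2) ^ n) \<le> 2 * d * 1" using q(2) d(1) by (intro mult_left_mono) auto
    ultimately show "t0 \<le> T n" "T n \<le> t1" using d unfolding T_def by linarith+
  qed
  have step: "T (Suc n) - T n = d * (1/2) ^ n" for n by (simp add: T_def algebra_simps)
  have le: "sqrt (a (T n)) \<le> sqrt (a t0) * (1/2) ^ n" for n
  proof (induction n)
    case 0
    show ?case by (simp add: T_def)
  next
    case (Suc n)
    show ?case
    proof (rule ccontr)
      assume "\<not> ?thesis"
      then have gt: "sqrt (a t0) * (1/2) ^ Suc n < sqrt (a (T (Suc n)))" by simp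
      have n1: "0 \<le> sqrt (a t0)" using nonneg by simp
      have "0 \<le> d * (1/2) ^ n" using d by simp
      then have "T n \<le> T (Suc n)" using step[of n] by linarith
      then have D: "\<kappa> * sqrt (a (T (Suc n))) * (T (Suc n) - T n) \<le> a (T n) - a (T (Suc n))"
        using Tr by (intro dec)
      have "a (T n) = (sqrt (a (T n)))\<^sup>2" using nonneg by simp
      also have "\<dots> \<le> (sqrt (a t0) * (1/2) ^ n)\<^sup>2" using Suc nonneg by (intro power_mono) auto
      finally have u: "a (T n) \<le> (sqrt (a t0) * (1/2) ^ n)\<^sup>2" .
      have "0 \<le> sqrt (a t0) * (1/2) ^ Suc n" using n1 by simp
      then have pos: "0 < a (T (Suc n))"
        using gt nonneg[of "T (Suc n)"] by (metis le_less_trans real_sqrt_gt_0_iff)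
      have "\<kappa> * (sqrt (a t0) * (1/2) ^ Suc n) * (d * (1/2) ^ n) \<le> \<kappa> * sqrt (a (T (Suc n))) * (d * (1/2) ^ n)"
        using gt \<kappa> d by (intro mult_right_mono mult_left_mono) auto
      also have "\<kappa> * (sqrt (a t0) * (1/2) ^ Suc n) * (d * (1/2) ^ n) = (sqrt (a t0) * (1/2) ^ n)\<^sup>2"
        using \<kappa> by (simp add: d_def power2_eq_square)
      finally show False using D u pos step[of n] by simp
    qed
  qed
  have anti: "a t1 \<le> a (T n)" for n
  proof -
    have "0 \<le> \<kappa> * sqrt (a t1) * (t1 - T n)" using \<kappa> nonneg Tr[of n] by simp
    then show ?thesis using dec[of "T n" t1] Tr[of n] by simp
  qed
  have "sqrt (a t1) \<le> sqrt (a t0) * (1/2) ^ n" for n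
    using le[of n] anti[of n] real_sqrt_le_mono order_trans by blast
  moreover have "(\<lambda>n. sqrt (a t0) * (1/2) ^ n) \<longlonglongrightarrow> sqrt (a t0) * 0"
    by (intro tendsto_mult tendsto_const LIMSEQ_power_zero) simp
  ultimately have "sqrt (a t1) \<le> sqrt (a t0) * 0"
    by (intro LIMSEQ_le_const[of _ "sqrt (a t0) * 0"]) auto
  then show ?thesis using nonneg[of t1] by simp
qed

section \<open>Truncation and dilation of regions\<close>

lemma frontier_local:
  assumes U: "open U" and eq: "S \<inter> U = T \<inter> U"
  shows "frontier S \<inter> U = frontier T \<inter> U"
proof -
  have half: "frontier S \<inter> U \<subseteq> frontier T" if eq: "S \<inter> U = T \<inter> U" for S T
  proof
    fix z assume z: "z \<in> frontier S \<inter> U"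
    have "z \<in> closure (S \<inter> U)"
      using open_Int_closure_subset[OF U, of S] z by (auto simp: frontier_def Int_commute)
    then have "z \<in> closure T" unfolding eq using closure_mono[of "T \<inter> U" T] by blast
    moreover have "z \<notin> interior T"
    proof
      assume "z \<in> interior T"
      then have "z \<in> interior (T \<inter> U)" using z U by (simp add: interior_open)
      then have "z \<in> interior S" unfolding eq[symmetric] by simp
      then show False using z by (simp add: frontier_def)
    qed
    ultimately show "z \<in> frontier T" by (simp add: frontier_def)
  qed
  show ?thesis using half[OF eq] half[OF eq[symmetric]] by blast
qed

lemma region_borel: "region M E \<Longrightarrow> E \<in> sets borel"
  unfolding region_def by (metis borel_closed closed_closure)

lemma region_closed: "region M E \<Longrightarrow> closed E"
  unfolding region_def by (metis closed_closure)

text \<open>Taking the closure of an open set makes the result a region; cutting with a closed square could leave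
  lower-dimensional parts.\<close>

definition truncation :: "real \<Rightarrow> complex set \<Rightarrow> complex set" where
  "truncation t F = closure (interior F \<inter> open_square t)"

lemma truncation_subset: "closed F \<Longrightarrow> truncation t F \<subseteq> F \<inter> square t"
  unfolding truncation_def
  using interior_subset[of F] open_square_subset[of t] closed_square[of t]
  by (intro closure_minimal) auto

lemma closure_interior_closure_open:
  assumes "open G" shows "closure (interior (closure G)) = closure G"
proof
  show "closure (interior (closure G)) \<subseteq> closure G"
    by (intro closure_minimal interior_subset closed_closure)
  show "closure G \<subseteq> closure (interior (closure G))"
    by (intro closure_mono interior_maximal closure_subset assms)
qed

lemma region_truncation:
  assumes "closed F" "F \<subseteq> N" shows "region N (truncation t F)"
  unfolding region_def
proof
  show "truncation t F \<subseteq> N" using truncation_subset[OF assms(1)] assms(2) by blast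
  show "closure (interior (truncation t F)) = truncation t F"
    unfolding truncation_def by (intro closure_interior_closure_open open_Int open_interior open_open_square)
qed

lemma frontier_truncation:
  assumes "closed F"
  shows "frontier (truncation t F) \<subseteq> (frontier F \<inter> open_square t) \<union> (F \<inter> rim t)"
proof
  fix z assume z: "z \<in> frontier (truncation t F)"
  have "interior F \<inter> open_square t \<subseteq> interior (truncation t F)"
    unfolding truncation_def by (intro interior_maximal closure_subset open_Int open_interior open_open_square)
  then have "z \<notin> interior F \<inter> open_square t" using z by (auto simp: frontier_def)
  moreover have "z \<in> F \<inter> square t"
    using z truncation_subset[OF assms, of t] by (auto simp: frontier_def truncation_def)
  ultimately show "z \<in> (frontier F \<inter> open_square t) \<union> (F \<inter> rim t)"
    using assms by (auto simp: frontier_def rim_def)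
qed

text \<open>The truncation differs from \<open>F \<inter> square t\<close> only on the frontier of \<open>F\<close> and on the rim.\<close>

lemma weighted_area_truncation:
  assumes F: "closed F" and null: "emeasure lborel (frontier F) = 0" and t: "0 \<le> t"
  shows "weighted_area p (truncation t F) = weighted_area p (F \<inter> square t)"
proof (rule antisym)
  show "weighted_area p (truncation t F) \<le> weighted_area p (F \<inter> square t)"
    by (rule weighted_area_mono[OF truncation_subset[OF F]])
  let ?R = "F \<inter> square t - truncation t F"
  have b: "truncation t F \<in> sets borel" "?R \<in> sets borel"
    using F closed_square by (auto simp: truncation_def)
  have "interior F \<inter> open_square t \<subseteq> truncation t F" unfolding truncation_def by (rule closure_subset)
  then have "?R \<subseteq> frontier F \<union> rim t" using F by (auto simp: frontier_def rim_def)
  then have "emeasure lborel ?R \<le> emeasure lborel (frontier F \<union> rim t)"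
    using closed_rim by (intro emeasure_mono) auto
  also have "\<dots> \<le> emeasure lborel (frontier F) + emeasure lborel (rim t)"
    using closed_rim by (intro emeasure_subadditive) auto
  finally have R: "emeasure lborel ?R = 0" using null rim_null[OF t] by simp
  have "weighted_area p (F \<inter> square t) \<le> weighted_area p (truncation t F \<union> ?R)"
    by (rule weighted_area_mono) auto
  also have "\<dots> = weighted_area p (truncation t F) + weighted_area p ?R"
    using b by (intro weighted_area_Un_disjoint) auto
  also have "weighted_area p ?R = 0" by (rule weighted_area_null[OF b(2) R])
  finally show "weighted_area p (F \<inter> square t) \<le> weighted_area p (truncation t F)" by simp
qed

lemma weighted_perimeter_local:
  assumes eq: "N \<inter> ball 0 \<rho> = C \<inter> ball 0 \<rho>" and X: "closed X" "X \<subseteq> ball 0 \<rho>"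
  shows "weighted_perimeter p N X = weighted_perimeter p C X"
proof -
  have "frontier N \<inter> ball 0 \<rho> = frontier C \<inter> ball 0 \<rho>" by (rule frontier_local[OF open_ball eq])
  moreover have "frontier X \<subseteq> ball 0 \<rho>" using X by (auto simp: frontier_def)
  ultimately have "frontier X - frontier N = frontier X - frontier C" by blast
  then show ?thesis by (simp add: weighted_perimeter_def)
qed

lemma region_local:
  assumes eq: "N \<inter> ball 0 \<rho> = C \<inter> ball 0 \<rho>" and X: "X \<subseteq> ball 0 \<rho>"
  shows "region N X \<longleftrightarrow> region C X"
  using assms unfolding region_def by blast

text \<open>Inside the ball the ambient space agrees with the cone \<open>C\<close>, and dilations preserve \<open>C\<close> and hence the
  part of a boundary that is not counted.\<close>

lemma rescale:
  fixes c :: real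
  assumes eq: "N \<inter> ball 0 \<rho> = C \<inter> ball 0 \<rho>"
    and cone: "\<forall>c>0. (*) (complex_of_real c) ` C = C"
    and X: "region N X" "X \<subseteq> ball 0 \<rho>" and c: "0 < c" and cX: "(*) (complex_of_real c) ` X \<subseteq> ball 0 \<rho>"
  shows "region N ((*) (complex_of_real c) ` X)"
    and "weighted_area p ((*) (complex_of_real c) ` X) = ennreal (c powr (p + 2)) * weighted_area p X"
    and "weighted_perimeter p N ((*) (complex_of_real c) ` X) = ennreal (c powr (p + 1)) * weighted_perimeter p N X"
proof -
  have c0: "complex_of_real c \<noteq> 0" using c by simp
  have XC: "region C X" using region_local[OF eq X(2)] X(1) by simp
  have "region ((*) (complex_of_real c) ` C) ((*) (complex_of_real c) ` X)"
    by (rule region_mult[OF c0 XC])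
  then have cXC: "region C ((*) (complex_of_real c) ` X)" by (simp add: cone[rule_format, OF c])
  then show "region N ((*) (complex_of_real c) ` X)" using region_local[OF eq cX] by simp
  show "weighted_area p ((*) (complex_of_real c) ` X) = ennreal (c powr (p + 2)) * weighted_area p X"
    using weighted_area_mult[OF c0 region_borel[OF XC], of p] c by simp
  have "weighted_perimeter p N ((*) (complex_of_real c) ` X) = weighted_perimeter p C ((*) (complex_of_real c) ` X)"
    by (rule weighted_perimeter_local[OF eq region_closed[OF cXC] cX])
  also have "\<dots> = ennreal (c powr (p + 1)) * weighted_perimeter p C X"
    using weighted_perimeter_mult[OF c0, of p C X] c by (simp add: cone[rule_format, OF c])
  also have "weighted_perimeter p C X = weighted_perimeter p N X"
    by (rule weighted_perimeter_local[OF eq region_closed[OF X(1)] X(2), symmetric])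
  finally show "weighted_perimeter p N ((*) (complex_of_real c) ` X) = ennreal (c powr (p + 1)) * weighted_perimeter p N X" .
qed

lemma weighted_length_rim:
  assumes "0 \<le> p" "S \<subseteq> rim t" "S \<in> sets borel" "0 \<le> t"
  shows "weighted_length p S \<le> ennreal ((2 * t) powr p) * hausdorff1 S"
  unfolding weighted_length_def emeasure_arclength[OF assms(3), symmetric]
proof (rule weighted_integral_bounds(2)[OF sets_arclength assms(3)])
  fix z assume "z \<in> S"
  then have "norm z \<le> sqrt 2 * t" using assms(2) by (intro square_norm_le) (auto simp: rim_def)
  also have "\<dots> \<le> 2 * t" using assms(4) by (intro mult_right_mono) (auto intro: real_le_lsqrt)
  finally show "norm z powr p \<le> (2 * t) powr p" using assms(1) by (intro powr_mono2) auto
qed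

lemma weighted_area_finite:
  assumes p: "0 \<le> p" and E: "E \<in> sets borel" and b: "\<And>z. z \<in> E \<Longrightarrow> norm z \<le> R"
  shows "weighted_area p E < \<infinity>"
proof -
  have "weighted_area p E \<le> ennreal (\<bar>R\<bar> powr p) * emeasure lborel E"
    unfolding weighted_area_def
  proof (rule weighted_integral_bounds(2)[OF sets_lborel E])
    fix z assume "z \<in> E"
    then show "norm z powr p \<le> \<bar>R\<bar> powr p" using b[of z] p by (intro powr_mono2) auto
  qed
  also have "\<dots> < \<infinity>"
  proof -
    have "bounded E" using b by (auto simp: bounded_iff)
    then show ?thesis using emeasure_bounded_finite[of E] by (simp add: ennreal_mult_less_top)
  qed
  finally show ?thesis .
qed

text \<open>The density vanishes at the origin only.\<close>

lemma weighted_area_zero_imp_empty_interior: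
  assumes E: "E \<in> sets borel" and zero: "weighted_area p E = 0"
  shows "interior E = {}"
proof (rule ccontr)
  assume ne: "interior E \<noteq> {}"
  have "AE z in lborel. ennreal (norm z powr p) * indicator E z = 0"
    using zero E unfolding weighted_area_def by (subst (asm) nn_integral_0_iff_AE) auto
  then have "AE z in lborel. z \<notin> interior E - {0}"
  proof (eventually_elim)
    fix z assume "ennreal (norm z powr p) * indicator E z = 0"
    then show "z \<notin> interior E - {0}" using interior_subset[of E] by (auto simp: indicator_def split: if_splits)
  qed
  then have "interior E - {0} \<in> null_sets lborel" by (subst (asm) AE_iff_null_sets[symmetric]) auto
  then have "negligible (interior E - {0})" by (simp add: negligible_iff_null_sets null_sets_completionI)
  then have "interior E - {0} = {}" using open_not_negligible[of "interior E - {0}"] by (auto simp: open_delete)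
  then have "interior E = {0}" using ne by blast
  then show False using open_interior[of E] not_open_singleton by metis
qed

section \<open>Localization near the origin\<close>

lemma square_subset_ball:
  assumes "0 < \<rho>" "t \<le> \<rho> / 4" "0 < c" "c \<le> 2"
  shows "(*) (complex_of_real c) ` square t \<subseteq> ball 0 \<rho>"
proof
  fix z assume "z \<in> (*) (complex_of_real c) ` square t"
  then obtain x where x: "x \<in> square t" "z = complex_of_real c * x" by blast
  have t: "0 \<le> t" using x(1) by (auto simp: square_def)
  have "norm z = c * norm x" using x(2) assms(3) by (simp add: norm_mult)
  also have "\<dots> \<le> 2 * (sqrt 2 * t)" using square_norm_le[OF x(1)] assms by (intro mult_mono) auto
  also have "\<dots> \<le> 2 * (sqrt 2 * (\<rho> / 4))" using assms by simp
  also have "\<dots> < \<rho>" using assms(1) sqrt2_less_2 by simp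
  finally show "z \<in> ball 0 \<rho>" by simp
qed

text \<open>Dilations of one fixed truncated piece of \<open>N\<close> at the origin have perimeter of order
  \<open>A powr ((p + 1) / (p + 2))\<close>, by the scaling exponents \<open>p + 2\<close> of area and \<open>p + 1\<close> of perimeter.\<close>

lemma small_competitors:
  fixes N C :: "complex set"
  assumes p: "0 < p" and \<rho>: "0 < \<rho>"
    and eq: "N \<inter> ball 0 \<rho> = C \<inter> ball 0 \<rho>"
    and cone: "\<forall>c>0. (*) (complex_of_real c) ` C = C"
    and N: "closed N" and int: "interior N \<inter> ball 0 \<rho> \<noteq> {}"
  obtains w P where "0 < w" "0 \<le> P"
    "\<And>A. 0 < A \<Longrightarrow> A \<le> w \<Longrightarrow> \<exists>G. region N G \<and> G \<subseteq> ball 0 \<rho> \<and> weighted_area p G = ennreal A \<and>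
       weighted_perimeter p N G = ennreal (P * (A / w) powr ((p + 1) / (p + 2)))"
proof -
  define t where "t = \<rho> / 4"
  have t: "0 < t" using \<rho> by (simp add: t_def)
  define X where "X = truncation t N"
  have Xsub: "X \<subseteq> N \<inter> square t" unfolding X_def by (rule truncation_subset[OF N])
  have sqb: "square t \<subseteq> ball 0 \<rho>" using square_subset_ball[of \<rho> t 1] \<rho> by (simp add: t_def)
  have Xb: "X \<subseteq> ball 0 \<rho>" using Xsub sqb by blast
  have reg: "region N X" unfolding X_def by (rule region_truncation[OF N order_refl])
  note bX = region_borel[OF reg]
  have "interior X \<noteq> {}"
  proof -
    obtain z where z: "z \<in> interior N" "z \<in> ball 0 \<rho>" using int by blast
    \<comment> \<open>An interior point of the cone is moved into the small square by a dilation.\<close>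
    have loc: "interior N \<inter> ball 0 \<rho> = interior C \<inter> ball 0 \<rho>"
      using interior_Int[of N "ball 0 \<rho>"] interior_Int[of C "ball 0 \<rho>"] eq by (simp add: interior_open)
    let ?c = "complex_of_real (1/8)"
    have "?c * z \<in> (*) ?c ` interior C" using loc z by blast
    also have "(*) ?c ` interior C = interior C"
      using interior_mult[of ?c C] cone[rule_format, of "1/8"] by simp
    finally have i: "?c * z \<in> interior C" .
    have n: "norm (?c * z) < t" using z(2) \<rho> by (simp add: norm_mult t_def)
    then have "?c * z \<in> ball 0 \<rho>" using \<rho> by (simp add: t_def)
    then have "?c * z \<in> interior N" using i loc by blast
    moreover have "?c * z \<in> open_square t" using norm_ge_outside_open_square[of "?c * z" t] n by linarith
    moreover have "interior N \<inter> open_square t \<subseteq> interior X"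
      unfolding X_def truncation_def
      by (intro interior_maximal closure_subset open_Int open_interior open_open_square)
    ultimately show ?thesis by blast
  qed
  then have "weighted_area p X \<noteq> 0" using weighted_area_zero_imp_empty_interior[OF bX] by blast
  moreover have "weighted_area p X < \<infinity>"
    using Xb by (intro weighted_area_finite[OF _ bX, of p \<rho>]) (use p in force)+
  ultimately obtain w where w: "0 < w" "weighted_area p X = ennreal w"
    by (cases "weighted_area p X") (auto simp: top_unique less_le)
  have "weighted_perimeter p N X \<le> weighted_length p (rim t)"
    unfolding weighted_perimeter_eq_length X_def
    using frontier_truncation[OF N, of t] by (intro weighted_length_mono) auto
  also have "\<dots> \<le> ennreal ((2 * t) powr p) * hausdorff1 (rim t)"
    using p t closed_rim by (intro weighted_length_rim) auto
  also have "\<dots> < \<infinity>" using hausdorff1_rim_finite[of t] t by (simp add: ennreal_mult_less_top)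
  finally obtain P where P: "0 \<le> P" "weighted_perimeter p N X = ennreal P"
    by (cases "weighted_perimeter p N X") (auto simp: top_unique)
  show thesis
  proof (rule that[OF w(1) P(1)])
    fix A assume A: "0 < A" "A \<le> w"
    define c where "c = (A / w) powr (1 / (p + 2))"
    have c: "0 < c" "c \<le> 1" using A w(1) p by (auto simp: c_def powr_le1)
    have cX: "(*) (complex_of_real c) ` X \<subseteq> ball 0 \<rho>"
      using square_subset_ball[of \<rho> t c] Xsub \<rho> c by (auto simp: t_def)
    have cw: "c powr (p + 2) = A / w" using A w(1) p by (simp add: c_def powr_powr)
    have 2: "c powr (p + 1) = (A / w) powr ((p + 1) / (p + 2))" by (simp add: c_def powr_powr)
    note resc = rescale[OF eq cone reg Xb c(1) cX]
    have "weighted_area p ((*) (complex_of_real c) ` X) = ennreal A"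
    proof -
      have "weighted_area p ((*) (complex_of_real c) ` X) = ennreal (c powr (p + 2)) * weighted_area p X"
        by (rule resc(2))
      also have "\<dots> = ennreal (A / w) * ennreal w"
        by (rule arg_cong2[where f="(*)", OF arg_cong[where f=ennreal, OF cw] w(2)])
      also have "\<dots> = ennreal A" using A(1) w(1) by (simp add: ennreal_mult[symmetric])
      finally show ?thesis .
    qed
    moreover have "weighted_perimeter p N ((*) (complex_of_real c) ` X) = ennreal (P * (A / w) powr ((p + 1) / (p + 2)))"
    proof -
      have "weighted_perimeter p N ((*) (complex_of_real c) ` X) = ennreal (c powr (p + 1)) * weighted_perimeter p N X"
        by (rule resc(3))
      also have "\<dots> = ennreal ((A / w) powr ((p + 1) / (p + 2))) * ennreal P"
        by (rule arg_cong2[where f="(*)", OF arg_cong[where f=ennreal, OF 2] P(2)])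
      also have "\<dots> = ennreal (P * (A / w) powr ((p + 1) / (p + 2)))"
        using P(1) by (simp add: ennreal_mult mult.commute)
      finally show ?thesis .
    qed
    ultimately show "\<exists>G. region N G \<and> G \<subseteq> ball 0 \<rho> \<and> weighted_area p G = ennreal A \<and>
       weighted_perimeter p N G = ennreal (P * (A / w) powr ((p + 1) / (p + 2)))"
      using resc(1) cX by (intro exI[of _ "(*) (complex_of_real c) ` X"] conjI)
  qed
qed

text \<open>The real-number content of the comparison.  Here \<open>a\<close> is the area removed, \<open>Pin\<close> and \<open>Pout\<close> are the
  perimeters kept and removed, \<open>s\<close> bounds the length of the cut, \<open>D\<close> bounds the whole perimeter, and
  \<open>1 + 2 * a / A\<close> is the price of restoring the area.  If more than half of the area is removed, the
  isoperimetric inequality alone forces a long cut.\<close>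

lemma slice_bound:
  fixes A a Pin Pout s K D :: real
  assumes A: "0 < A" and a: "0 \<le> a" "a \<le> A" and nn: "0 \<le> Pin" "0 \<le> Pout" "0 \<le> s" "0 \<le> K"
    and PF: "Pin + Pout \<le> D" and small: "K * D \<le> sqrt A / 4"
    and iso: "sqrt a \<le> K * (Pout + s)"
    and comp: "a \<le> A / 2 \<Longrightarrow> Pin + Pout \<le> (1 + 2 * a / A) * (Pin + s)"
  shows "sqrt a \<le> 6 * K * s"
proof (cases "a \<le> A / 2")
  case False
  have "sqrt A \<le> sqrt (4 * a)" using False a by (intro real_sqrt_le_mono) simp
  then have "sqrt A \<le> 2 * sqrt a" by (simp add: real_sqrt_mult)
  moreover have "K * Pout \<le> K * D" using PF nn by (intro mult_left_mono) auto
  ultimately have "sqrt a \<le> 2 * K * s" using iso small by (simp add: algebra_simps)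
  moreover have "0 \<le> K * s" using nn by simp
  ultimately show ?thesis by simp
next
  case True
  define \<theta> where "\<theta> = 2 * a / A"
  have \<theta>: "0 \<le> \<theta>" "\<theta> \<le> 1" using True A a by (auto simp: \<theta>_def field_simps)
  have "\<theta> * s \<le> 1 * s" using \<theta> nn by (intro mult_right_mono) auto
  moreover have "Pin + Pout \<le> Pin + s + \<theta> * Pin + \<theta> * s"
    using comp[OF True, folded \<theta>_def] by (simp add: algebra_simps)
  ultimately have "Pout \<le> \<theta> * Pin + 2 * s" by linarith
  then have "K * Pout \<le> K * (\<theta> * Pin + 2 * s)" using nn(4) by (rule mult_left_mono)
  moreover have "\<theta> * (K * Pin) \<le> \<theta> * (sqrt A / 4)"
  proof -
    have "K * Pin \<le> K * D" using PF nn by (intro mult_left_mono) auto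
    then show ?thesis using small \<theta> by (intro mult_left_mono) auto
  qed
  moreover have "\<theta> * (sqrt A / 4) \<le> sqrt a / 2"
  proof -
    define r b where "r = sqrt A" and "b = sqrt a"
    have rb: "0 < r" "0 \<le> b" "b \<le> r" "A = r * r" "a = b * b" using A a by (auto simp: r_def b_def)
    have "\<theta> * (r / 4) = b * b / (2 * r)" using rb by (simp add: \<theta>_def field_simps)
    also have "\<dots> \<le> b * r / (2 * r)" using rb by (intro divide_right_mono mult_left_mono) auto
    also have "\<dots> = b / 2" using rb by simp
    finally show ?thesis by (simp add: r_def b_def)
  qed
  ultimately have "sqrt a \<le> sqrt a / 2 + 3 * (K * s)" using iso by (simp add: algebra_simps)
  then show ?thesis by simp
qed

text \<open>The heart of the proof: a region of small area whose perimeter does not exceed that of any region of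
  the same area inside \<open>ball 0 \<rho>\<close> lies in this ball.  For \<open>t\<close> between \<open>\<rho> / 8\<close> and \<open>\<rho> / 4\<close> the
  truncation at \<open>t\<close>, dilated so as to have area \<open>A\<close> again, is a competitor.  By \<open>slice_bound\<close> this gives
  \<open>sqrt (a t) \<le> const * H t\<close> for the area \<open>a t\<close> outside the square and the length \<open>H t\<close> of the slice by
  its rim; since \<open>H\<close> controls the decrease of \<open>a\<close> by \<open>rim_integral\<close>, the area outside the square is
  used up before \<open>t = \<rho> / 4\<close>.\<close>

lemma localization:
  fixes N C :: "complex set"
  assumes p: "0 < p" and \<rho>: "0 < \<rho>"
    and eq: "N \<inter> ball 0 \<rho> = C \<inter> ball 0 \<rho>"
    and cone: "\<forall>c>0. (*) (complex_of_real c) ` C = C"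
    and N: "closed N" and Nnull: "emeasure lborel (frontier N) = 0"
    and int: "interior N \<inter> ball 0 \<rho> \<noteq> {}"
    and iso: "exterior_isoperimetric p N (\<rho> / 8)"
  obtains Astar where "0 < Astar"
    "\<And>A F. 0 < A \<Longrightarrow> A < Astar \<Longrightarrow> region N F \<Longrightarrow> weighted_area p F = ennreal A \<Longrightarrow>
       (\<And>G. region N G \<Longrightarrow> G \<subseteq> ball 0 \<rho> \<Longrightarrow> weighted_area p G = ennreal A \<Longrightarrow>
          weighted_perimeter p N F \<le> weighted_perimeter p N G) \<Longrightarrow> F \<subseteq> ball 0 \<rho>"
proof -
  obtain w P where w: "0 < w" and P: "0 \<le> P" and comp:
    "\<And>A. 0 < A \<Longrightarrow> A \<le> w \<Longrightarrow> \<exists>G. region N G \<and> G \<subseteq> ball 0 \<rho> \<and> weighted_area p G = ennreal A \<and>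
       weighted_perimeter p N G = ennreal (P * (A / w) powr ((p + 1) / (p + 2)))"
    by (rule small_competitors[OF p \<rho> eq cone N int]) (rule that)
  obtain C0 a0 where C0: "0 < C0" and a0: "0 < a0" and ext:
    "\<forall>E\<in>sets borel. E \<subseteq> N \<longrightarrow> (\<forall>z\<in>E. \<rho> / 8 \<le> norm z) \<longrightarrow> weighted_area p E \<le> ennreal a0 \<longrightarrow>
        weighted_area p E \<le> ennreal C0 * (weighted_perimeter p N E)\<^sup>2"
    using iso unfolding exterior_isoperimetric_def by (elim exE conjE) (rule that)
  obtain c where c: "0 < c" and rimint: "\<And>F t s h. closed F \<Longrightarrow> 0 \<le> t \<Longrightarrow> t \<le> s \<Longrightarrow> 0 \<le> h \<Longrightarrow>
    (\<And>u. t < u \<Longrightarrow> u \<le> s \<Longrightarrow> ennreal h \<le> hausdorff1 (F \<inter> rim u)) \<Longrightarrow>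
    ennreal (h * (s - t)) \<le> ennreal c * emeasure lborel (F \<inter> (square s - square t))"
    by (rule rim_integral) (rule that, assumption, blast)
  \<comment> \<open>The excess of the scaling exponent \<open>(p + 1) / (p + 2)\<close> over \<open>1/2\<close>.  It is positive as \<open>p > 0\<close>,
    and it makes the cost of restoring area small against the square root of that area.\<close>
  define \<gamma> where "\<gamma> = p / (2 * (p + 2))"
  have \<gamma>: "0 < \<gamma>" "(p + 1) / (p + 2) = \<gamma> + 1/2" using p by (auto simp: \<gamma>_def field_simps)
  define K where "K = sqrt C0"
  have K: "0 < K" using C0 by (simp add: K_def)
  define D where "D = P * (1 / w) powr (\<gamma> + 1/2)"
  have D: "0 \<le> D" using P by (simp add: D_def)
  define t0 t1 where "t0 = \<rho> / 8" and "t1 = \<rho> / 4"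
  have t01: "0 < t0" "t0 < t1" "t1 - t0 = \<rho> / 8" using \<rho> by (auto simp: t0_def t1_def)
  define q where "q = (2 * t1) powr p"
  have q: "0 < q" using t01 by (simp add: q_def)
  define \<kappa> where "\<kappa> = t0 powr p / (6 * K * q * c)"
  have \<kappa>: "0 < \<kappa>" using t01 K q c by (simp add: \<kappa>_def)
  \<comment> \<open>In this order: competitors exist; the exterior inequality applies; restoring area is cheap; the area
    outside the square vanishes within time \<open>\<rho> / 8\<close>.\<close>
  define Astar where "Astar = Min {w, a0, (1 / (4 * (K * D + 1))) powr (1 / \<gamma>), (\<kappa> * \<rho> / 32)\<^sup>2}"
  have KD: "0 < 4 * (K * D + 1)" using K D by (simp add: add_nonneg_pos)
  show thesis
  proof (rule that)
    show "0 < Astar" unfolding Astar_def using w a0 KD \<kappa> \<rho> by (subst Min_gr_iff) auto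
    fix A F
    assume A0: "0 < A" and "A < Astar" and reg: "region N F" and area: "weighted_area p F = ennreal A"
      and least: "\<And>G. region N G \<Longrightarrow> G \<subseteq> ball 0 \<rho> \<Longrightarrow> weighted_area p G = ennreal A \<Longrightarrow>
          weighted_perimeter p N F \<le> weighted_perimeter p N G"
    then have A: "A \<le> w" "A \<le> a0" "A \<le> (1 / (4 * (K * D + 1))) powr (1 / \<gamma>)" "A \<le> (\<kappa> * \<rho> / 32)\<^sup>2"
      unfolding Astar_def by auto
    have F: "closed F" "F \<in> sets borel" "F \<subseteq> N"
      using region_closed[OF reg] region_borel[OF reg] reg by (auto simp: region_def)
    have small: "K * (D * A powr (\<gamma> + 1/2)) \<le> sqrt A / 4"
    proof -
      have "A powr \<gamma> \<le> ((1 / (4 * (K * D + 1))) powr (1 / \<gamma>)) powr \<gamma>"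
        using A(3) A0 \<gamma>(1) by (intro powr_mono2) auto
      also have "\<dots> = 1 / (4 * (K * D + 1))" using \<gamma>(1) KD by (simp add: powr_powr)
      finally have "K * D * A powr \<gamma> \<le> K * D * (1 / (4 * (K * D + 1)))"
        using K D by (intro mult_left_mono) auto
      also have "\<dots> \<le> 1 / 4" using K D by (simp add: divide_simps add_nonneg_pos)
      finally have "K * D * A powr \<gamma> * sqrt A \<le> 1 / 4 * sqrt A" using A0 by (intro mult_right_mono) auto
      then show ?thesis using A0 by (simp add: powr_add powr_half_sqrt mult.assoc)
    qed
    obtain G where G: "region N G" "G \<subseteq> ball 0 \<rho>" "weighted_area p G = ennreal A"
       "weighted_perimeter p N G = ennreal (P * (A / w) powr ((p + 1) / (p + 2)))"
      using comp[OF A0 A(1)] by blast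
    have "P * (A / w) powr ((p + 1) / (p + 2)) = D * A powr (\<gamma> + 1/2)"
      unfolding \<gamma>(2) D_def using A0 w powr_mult[of A "1 / w" "\<gamma> + 1/2"] by (simp add: mult_ac)
    then have PFle: "weighted_perimeter p N F \<le> ennreal (D * A powr (\<gamma> + 1/2))"
      using least[OF G(1-3)] G(4) by simp
    have PFfin: "weighted_perimeter p N F < \<infinity>" using PFle by (rule le_less_trans) simp
    have null: "emeasure lborel (frontier F) = 0"
      by (rule weighted_perimeter_finite_imp_null_frontier[OF PFfin Nnull])
    define a where "a t = enn2real (weighted_area p (F - square t))" for t
    have bF: "F - square t \<in> sets borel" "F \<inter> rim t \<in> sets borel" "F \<inter> square t \<in> sets borel" for t
      using F closed_square closed_rim by auto
    have a_le: "weighted_area p (F - square t) \<le> ennreal A" for t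
      unfolding area[symmetric] by (rule weighted_area_mono) auto
    have a: "weighted_area p (F - square t) = ennreal (a t)" "0 \<le> a t" "a t \<le> A" for t
    proof -
      show e: "weighted_area p (F - square t) = ennreal (a t)"
        using a_le[of t] unfolding a_def by (cases "weighted_area p (F - square t)") (auto simp: top_unique)
      show "0 \<le> a t" by (simp add: a_def)
      show "a t \<le> A" using a_le[of t] A0 unfolding e by simp
    qed
    define H where "H t = enn2real (hausdorff1 (F \<inter> rim t))" for t
    have H: "hausdorff1 (F \<inter> rim t) = ennreal (H t)" "0 \<le> H t" if "0 \<le> t" for t
    proof -
      have "hausdorff1 (F \<inter> rim t) \<le> hausdorff1 (rim t)" by (rule hausdorff1_mono) auto
      then have "hausdorff1 (F \<inter> rim t) < \<infinity>" using hausdorff1_rim_finite[OF that] by (rule le_less_trans)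
      then show "hausdorff1 (F \<inter> rim t) = ennreal (H t)" "0 \<le> H t"
        unfolding H_def by (auto simp: top_unique)
    qed
    have main: "sqrt (a t) \<le> 6 * K * (q * H t)" if t: "t0 \<le> t" "t \<le> t1" for t
    proof -
      have tpos: "0 < t" using t t01 by simp
      define s where "s = q * H t"
      have s: "0 \<le> s" using q H tpos by (simp add: s_def)
      have rimlen: "weighted_length p (F \<inter> rim t) \<le> ennreal s"
      proof -
        have "weighted_length p (F \<inter> rim t) \<le> ennreal ((2 * t) powr p) * hausdorff1 (F \<inter> rim t)"
          using p tpos bF by (intro weighted_length_rim) auto
        also have "\<dots> \<le> ennreal q * ennreal (H t)"
        proof -
          have "(2 * t) powr p \<le> q" unfolding q_def using p tpos t by (intro powr_mono2) auto
          then show ?thesis using H(1)[of t] tpos by (simp add: ennreal_leI mult_right_mono)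
        qed
        also have "\<dots> = ennreal s" using q H tpos by (simp add: s_def ennreal_mult)
        finally show ?thesis .
      qed
      let ?Sin = "(frontier F \<inter> open_square t) - frontier N"
      let ?Sout = "(frontier F - open_square t) - frontier N"
      have bS: "?Sin \<in> sets borel" "?Sout \<in> sets borel"
        using open_open_square by auto
      have split: "weighted_perimeter p N F = weighted_length p ?Sin + weighted_length p ?Sout"
      proof -
        have "frontier F - frontier N = ?Sin \<union> ?Sout" by blast
        then have "weighted_perimeter p N F = weighted_length p (?Sin \<union> ?Sout)"
          by (simp only: weighted_perimeter_eq_length)
        also have "\<dots> = weighted_length p ?Sin + weighted_length p ?Sout"
          by (rule weighted_length_Un_disjoint[OF bS]) blast
        finally show ?thesis .
      qed
      have "weighted_length p ?Sin < \<infinity>" "weighted_length p ?Sout < \<infinity>"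
        using PFfin split by (simp_all add: ennreal_add_less_top)
      then obtain Pin Pout where Pin: "0 \<le> Pin" "weighted_length p ?Sin = ennreal Pin"
        and Pout: "0 \<le> Pout" "weighted_length p ?Sout = ennreal Pout"
        by (cases "weighted_length p ?Sin"; cases "weighted_length p ?Sout") (auto simp: top_unique)
      have PF: "weighted_perimeter p N F = ennreal (Pin + Pout)"
        using split Pin Pout by simp
      have far: "\<forall>z\<in>F - square t. \<rho> / 8 \<le> norm z"
        using norm_ge_outside_open_square[of _ t] open_square_subset[of t] t(1) unfolding t0_def by force
      have "sqrt (a t) \<le> 6 * K * s"
      proof (rule slice_bound[OF A0 a(2,3) Pin(1) Pout(1) s less_imp_le[OF K]])
        show "Pin + Pout \<le> D * A powr (\<gamma> + 1/2)"
          using PFle D unfolding PF by simp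
        show "K * (D * A powr (\<gamma> + 1/2)) \<le> sqrt A / 4" by (rule small)
        have "weighted_area p (F - square t) \<le> ennreal C0 * (weighted_perimeter p N (F - square t))\<^sup>2"
        proof (rule ext[rule_format, OF bF(1)])
          show "\<rho> / 8 \<le> norm z" if "z \<in> F - square t" for z using far that by blast
          show "F - square t \<subseteq> N" using F by blast
          show "weighted_area p (F - square t) \<le> ennreal a0"
            using a_le[of t] A(2) by (meson ennreal_leI order_trans)
        qed
        moreover have "weighted_perimeter p N (F - square t) \<le> ennreal (Pout + s)"
        proof -
          have "frontier (F - square t) - frontier N \<subseteq> ?Sout \<union> (F \<inter> rim t)"
          proof
            fix z assume z: "z \<in> frontier (F - square t) - frontier N"
            have "closure (F - square t) \<subseteq> F - open_square t"
              using F open_square_subset[of t] open_open_square by (intro closure_minimal) auto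
            then have zF: "z \<in> F" "z \<notin> open_square t" using z by (auto simp: frontier_def)
            show "z \<in> ?Sout \<union> (F \<inter> rim t)"
            proof (cases "z \<in> rim t")
              case False
              then have zs: "z \<notin> square t" using zF by (auto simp: rim_def)
              have "z \<notin> interior F"
              proof
                assume "z \<in> interior F"
                then have "z \<in> interior F \<inter> - square t" using zs by blast
                also have "\<dots> \<subseteq> interior (F - square t)"
                  using closed_square interior_subset[of F] by (intro interior_maximal) auto
                finally show False using z by (auto simp: frontier_def)
              qed
              then show ?thesis using z zF F by (auto simp: frontier_def)
            qed (use zF in blast)
          qed
          then have "weighted_perimeter p N (F - square t) \<le> weighted_length p (?Sout \<union> (F \<inter> rim t))"
            unfolding weighted_perimeter_eq_length by (rule weighted_length_mono)
          also have "\<dots> \<le> weighted_length p ?Sout + weighted_length p (F \<inter> rim t)"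
            by (rule weighted_length_Un[OF bS(2) bF(2)])
          also have "\<dots> \<le> ennreal Pout + ennreal s" using rimlen Pout by (intro add_mono) auto
          finally show ?thesis using Pout s by simp
        qed
        ultimately have "ennreal (a t) \<le> ennreal C0 * (ennreal (Pout + s))\<^sup>2"
          unfolding a(1) using mult_left_mono power_mono by (meson order_trans zero_le)
        also have "\<dots> = ennreal (C0 * (Pout + s)\<^sup>2)"
          using C0 Pout s by (simp add: ennreal_mult ennreal_power del: ennreal_plus)
        finally have "a t \<le> C0 * (Pout + s)\<^sup>2" using C0 by simp
        then have "sqrt (a t) \<le> sqrt (C0 * (Pout + s)\<^sup>2)" by (rule real_sqrt_le_mono)
        also have "\<dots> = K * (Pout + s)" using Pout s by (simp add: K_def real_sqrt_mult)
        finally show "sqrt (a t) \<le> K * (Pout + s)" .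
      next
        assume half: "a t \<le> A / 2"
        define T where "T = truncation t F"
        have T: "region N T" unfolding T_def by (rule region_truncation) (use F in auto)
        have Tsq: "T \<subseteq> square t" unfolding T_def using truncation_subset[OF F(1)] by blast
        have areaT: "weighted_area p T = ennreal (A - a t)"
        proof -
          have "ennreal A = weighted_area p ((F \<inter> square t) \<union> (F - square t))"
            unfolding area[symmetric] by (rule arg_cong[where f="weighted_area p"]) blast
          also have "\<dots> = weighted_area p (F \<inter> square t) + weighted_area p (F - square t)"
            by (rule weighted_area_Un_disjoint[OF bF(3,1)]) blast
          also have "\<dots> = weighted_area p T + ennreal (a t)"
            unfolding T_def a(1) using weighted_area_truncation[OF F(1) null, of t p] tpos by simp
          finally have "ennreal A = weighted_area p T + ennreal (a t)" .
          then have "weighted_area p T = ennreal A - ennreal (a t)" by (simp add: ennreal_add_diff_cancel_right)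
          then show ?thesis using a(2) by (simp add: ennreal_minus)
        qed
        have perT: "weighted_perimeter p N T \<le> ennreal (Pin + s)"
        proof -
          have "frontier T - frontier N \<subseteq> ?Sin \<union> (F \<inter> rim t)"
            unfolding T_def using frontier_truncation[OF F(1), of t] by blast
          then have "weighted_perimeter p N T \<le> weighted_length p (?Sin \<union> (F \<inter> rim t))"
            unfolding weighted_perimeter_eq_length by (rule weighted_length_mono)
          also have "\<dots> \<le> weighted_length p ?Sin + weighted_length p (F \<inter> rim t)"
            by (rule weighted_length_Un[OF bS(1) bF(2)])
          also have "\<dots> \<le> ennreal Pin + ennreal s" using rimlen Pin by (intro add_mono) auto
          finally show ?thesis using Pin s by simp
        qed
        \<comment> \<open>The dilation factor that restores the area; it is at most 2, so the dilated truncation stays in the ball.\<close>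
        define \<mu> where "\<mu> = (A / (A - a t)) powr (1 / (p + 2))"
        have ratio: "1 \<le> A / (A - a t)" "A / (A - a t) \<le> 1 + 2 * a t / A" "A / (A - a t) \<le> 2"
        proof -
          have pos: "0 < A - a t" using half A0 by simp
          show "1 \<le> A / (A - a t)" using pos a(2)[of t] by (simp add: field_simps)
          show "A / (A - a t) \<le> 2" using pos half by (simp add: field_simps)
          have "A * A \<le> (A + 2 * a t) * (A - a t)"
            using mult_nonneg_nonneg[OF a(2)[of t], of "A - 2 * a t"] half by (simp add: algebra_simps)
          then have "A / (A - a t) \<le> (A + 2 * a t) / A" using pos A0 by (simp add: field_simps)
          then show "A / (A - a t) \<le> 1 + 2 * a t / A" using A0 by (simp add: add_divide_distrib)
        qed
        have \<mu>1: "1 \<le> \<mu>" unfolding \<mu>_def using ratio(1) p by (intro ge_one_powr_ge_zero) auto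
        have \<mu>p: "\<mu> powr (p + 2) = A / (A - a t)"
        proof -
          have "0 < A - a t" using half A0 by simp
          then show ?thesis unfolding \<mu>_def using A0 p by (simp add: powr_powr)
        qed
        have \<mu>2: "\<mu> \<le> 2" using powr_mono[of 1 "p + 2" \<mu>] \<mu>1 \<mu>p ratio(3) p by simp
        have \<mu>q: "\<mu> powr (p + 1) \<le> 1 + 2 * a t / A"
          using powr_mono[of "p + 1" "p + 2" \<mu>] \<mu>1 \<mu>p ratio(2) by simp
        have \<mu>0: "0 < \<mu>" using \<mu>1 by simp
        have \<mu>T: "(*) (complex_of_real \<mu>) ` T \<subseteq> ball 0 \<rho>"
          using square_subset_ball[OF \<rho> _ \<mu>0 \<mu>2, of t] t(2) Tsq unfolding t1_def by blast
        have Tb: "T \<subseteq> ball 0 \<rho>"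
          using square_subset_ball[OF \<rho>, of t 1] t(2) Tsq unfolding t1_def by auto
        note resc = rescale[OF eq cone T Tb \<mu>0 \<mu>T]
        have "weighted_area p ((*) (complex_of_real \<mu>) ` T) = ennreal A"
        proof -
          have pos: "0 < A - a t" using half A0 by simp
          have "weighted_area p ((*) (complex_of_real \<mu>) ` T) = ennreal (\<mu> powr (p + 2)) * weighted_area p T"
            by (rule resc(2))
          also have "\<dots> = ennreal (A / (A - a t)) * ennreal (A - a t)"
            by (rule arg_cong2[where f="(*)", OF arg_cong[where f=ennreal, OF \<mu>p] areaT])
          also have "\<dots> = ennreal A" using pos A0 by (simp add: ennreal_mult[symmetric])
          finally show ?thesis .
        qed
        then have "weighted_perimeter p N F \<le> weighted_perimeter p N ((*) (complex_of_real \<mu>) ` T)"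
          by (intro least resc(1) \<mu>T)
        also have "\<dots> \<le> ennreal (1 + 2 * a t / A) * ennreal (Pin + s)"
          by (subst resc(3)) (intro mult_mono ennreal_leI \<mu>q perT; simp)
        also have "\<dots> = ennreal ((1 + 2 * a t / A) * (Pin + s))"
          using Pin s A0 a(2)[of t] by (intro ennreal_mult[symmetric]) auto
        finally show "Pin + Pout \<le> (1 + 2 * a t / A) * (Pin + s)"
          unfolding PF using Pin s A0 a(2)[of t] by (subst (asm) ennreal_le_iff) auto
      qed
      then show ?thesis by (simp add: s_def)
    qed
    have mono_a: "a s \<le> a t" if "t \<le> s" for t s
    proof -
      have "weighted_area p (F - square s) \<le> weighted_area p (F - square t)"
        using square_mono[OF that] by (intro weighted_area_mono) blast
      then show ?thesis using a by simp
    qed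
    have "a t1 = 0"
    proof (rule finite_time_extinction[OF \<kappa> a(2)])
      have "sqrt (a t0) \<le> sqrt A" using a(3) by simp
      also have "\<dots> \<le> sqrt ((\<kappa> * \<rho> / 32)\<^sup>2)" using A(4) by (rule real_sqrt_le_mono)
      also have "\<dots> = \<kappa> * \<rho> / 32" using \<kappa> \<rho> by simp
      finally show "4 * sqrt (a t0) / \<kappa> \<le> t1 - t0"
        unfolding t01(3) using \<kappa> by (simp add: field_simps)
      fix t s assume ts: "t0 \<le> t" "t \<le> s" "s \<le> t1"
      define h where "h = sqrt (a s) / (6 * K * q)"
      have h: "0 \<le> h" using a(2) K q by (simp add: h_def)
      have swept: "ennreal (h * (s - t)) \<le> ennreal c * emeasure lborel (F \<inter> (square s - square t))"
      proof (rule rimint[OF F(1) _ ts(2) h])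
        show "0 \<le> t" using ts t01 by simp
        fix u assume u: "t < u" "u \<le> s"
        have "sqrt (a s) \<le> sqrt (a u)" using mono_a[OF u(2)] by simp
        also have "\<dots> \<le> 6 * K * (q * H u)" using main[of u] u ts by simp
        finally have "h \<le> H u" unfolding h_def using K q by (simp add: field_simps)
        then show "ennreal h \<le> hausdorff1 (F \<inter> rim u)" using H(1)[of u] u ts t01 by (simp add: ennreal_leI)
      qed
      have "ennreal (t0 powr p) * emeasure lborel (F \<inter> (square s - square t)) \<le> ennreal (a t - a s)"
      proof -
        have b: "F \<inter> (square s - square t) \<in> sets borel" using F closed_square by auto
        have "ennreal (t0 powr p) * emeasure lborel (F \<inter> (square s - square t))
            \<le> weighted_area p (F \<inter> (square s - square t))"
          unfolding weighted_area_def
        proof (rule weighted_integral_bounds(1)[OF sets_lborel b])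
          fix z assume z: "z \<in> F \<inter> (square s - square t)"
          then have "z \<notin> open_square t" using open_square_subset[of t] by blast
          then have "t0 \<le> norm z" using norm_ge_outside_open_square[of z t] ts(1) by simp
          then show "t0 powr p \<le> norm z powr p" using p t01 by (intro powr_mono2) auto
        qed
        moreover have "ennreal (a t) = weighted_area p (F \<inter> (square s - square t)) + ennreal (a s)"
        proof -
          have "F - square t = (F \<inter> (square s - square t)) \<union> (F - square s)"
            using square_mono[OF ts(2)] by blast
          then have "ennreal (a t) = weighted_area p ((F \<inter> (square s - square t)) \<union> (F - square s))"
            by (simp only: a(1)[symmetric])
          also have "\<dots> = weighted_area p (F \<inter> (square s - square t)) + weighted_area p (F - square s)"
            by (rule weighted_area_Un_disjoint[OF b bF(1)]) blast
          finally show ?thesis by (simp only: a(1))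
        qed
        then have "weighted_area p (F \<inter> (square s - square t)) = ennreal (a t) - ennreal (a s)"
          by (simp add: ennreal_add_diff_cancel_right)
        ultimately show ?thesis using a(2) by (simp add: ennreal_minus)
      qed
      note gap = this
      have "ennreal (t0 powr p) * ennreal (h * (s - t))
          \<le> ennreal (t0 powr p) * (ennreal c * emeasure lborel (F \<inter> (square s - square t)))"
        by (rule mult_left_mono[OF swept]) simp
      also have "\<dots> = ennreal c * (ennreal (t0 powr p) * emeasure lborel (F \<inter> (square s - square t)))"
        by (rule mult.left_commute)
      also have "\<dots> \<le> ennreal c * ennreal (a t - a s)"
        by (rule mult_left_mono[OF gap]) simp
      finally have "ennreal (t0 powr p) * ennreal (h * (s - t)) \<le> ennreal c * ennreal (a t - a s)" .
      then have "ennreal (t0 powr p * (h * (s - t))) \<le> ennreal (c * (a t - a s))"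
        using h ts c mono_a[OF ts(2)] by (simp add: ennreal_mult)
      then have "t0 powr p * (h * (s - t)) \<le> c * (a t - a s)"
        using c mono_a[OF ts(2)] by (subst (asm) ennreal_le_iff) auto
      then show "\<kappa> * sqrt (a s) * (s - t) \<le> a t - a s"
        unfolding \<kappa>_def h_def using K q c by (simp add: field_simps)
    qed
    then have "interior (F - square t1) = {}"
      using a(1)[of t1] by (intro weighted_area_zero_imp_empty_interior[OF bF(1)[of t1], of p]) simp
    moreover have "interior F - square t1 \<subseteq> interior (F - square t1)"
      using interior_subset[of F] closed_square by (intro interior_maximal open_Diff) auto
    ultimately have "interior F \<subseteq> square t1" by blast
    then have "closure (interior F) \<subseteq> square t1" by (intro closure_minimal closed_square)
    then have "F \<subseteq> square t1" using reg by (simp add: region_def)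
    then show "F \<subseteq> ball 0 \<rho>" using square_subset_ball[OF \<rho>, of t1 1] by (auto simp: t1_def)
  qed
qed

section \<open>Tilings of cones and of locally conical sets\<close>

abbreviation quadrant :: "(real \<times> real) set" where
  "quadrant \<equiv> {0..} \<times> {0..}"

lemma null_translation:
  fixes S :: "complex set"
  assumes "S \<in> sets borel" "emeasure lborel S = 0"
  shows "(+) x ` S \<in> sets borel" "emeasure lborel ((+) x ` S) = 0"
proof -
  note eq = translation_image_eq_vimage[of x S]
  show "(+) x ` S \<in> sets borel"
    unfolding eq using assms(1) by (rule measurable_sets_borel[rotated]) measurable
  show "emeasure lborel ((+) x ` S) = 0"
    unfolding eq using emeasure_lborel_affine_vimage[of 1 S "- x"] assms by simp
qed

text \<open>The part \<open>S\<close> of \<open>N\<close> is covered, up to a null set, by finitely many tilings inside \<open>N\<close>.\<close>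

definition tiled :: "complex set \<Rightarrow> complex set \<Rightarrow> bool" where
  "tiled N S \<longleftrightarrow> (\<exists>\<Q> Z. finite \<Q> \<and> (\<forall>Q\<in>\<Q>. tiling N Q) \<and>
     Z \<in> sets borel \<and> emeasure lborel Z = 0 \<and> S \<subseteq> (\<Union>Q\<in>\<Q>. \<Union>i. Q i) \<union> Z)"

lemma tiled_mono: "tiled N S \<Longrightarrow> S' \<subseteq> S \<Longrightarrow> tiled N S'"
  unfolding tiled_def by (meson order_trans)

lemma tiled_Un:
  assumes "tiled N S" "tiled N S'"
  shows "tiled N (S \<union> S')"
proof -
  obtain \<Q> Z where 1: "finite \<Q>" "\<forall>Q\<in>\<Q>. tiling N Q" "Z \<in> sets borel" "emeasure lborel Z = 0"
    "S \<subseteq> (\<Union>Q\<in>\<Q>. \<Union>i. Q i) \<union> Z" using assms(1) unfolding tiled_def by blast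
  obtain \<Q>' Z' where 2: "finite \<Q>'" "\<forall>Q\<in>\<Q>'. tiling N Q" "Z' \<in> sets borel" "emeasure lborel Z' = 0"
    "S' \<subseteq> (\<Union>Q\<in>\<Q>'. \<Union>i. Q i) \<union> Z'" using assms(2) unfolding tiled_def by blast
  have "Z \<union> Z' \<in> null_sets lborel" using 1 2 by (intro null_sets.Un) (auto simp: null_sets_def)
  then have "Z \<union> Z' \<in> sets borel" "emeasure lborel (Z \<union> Z') = 0" by (auto simp: null_sets_def)
  then show ?thesis unfolding tiled_def using 1 2
    by (intro exI[of _ "\<Q> \<union> \<Q>'"] exI[of _ "Z \<union> Z'"]) auto
qed

lemma tiled_UN:
  assumes "finite I" "\<And>i. i \<in> I \<Longrightarrow> tiled N (S i)"
  shows "tiled N (\<Union>i\<in>I. S i)"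
  using assms
proof (induction I rule: finite_induct)
  case empty
  show ?case unfolding tiled_def by (intro exI[of _ "{}"]) auto
next
  case (insert i I)
  then show ?case using tiled_Un[of N "S i" "\<Union>i\<in>I. S i"] by simp
qed

lemma tiled_exterior_isoperimetric:
  assumes "tiled N N" "0 < p" "0 < t"
  shows "exterior_isoperimetric p N t"
proof -
  obtain \<Q> Z where Q: "finite \<Q>" "\<forall>Q\<in>\<Q>. tiling N Q" "Z \<in> sets borel" "emeasure lborel Z = 0"
    "N \<subseteq> (\<Union>Q\<in>\<Q>. \<Union>i. Q i) \<union> Z" using assms(1) unfolding tiled_def by blast
  obtain f and n :: nat where f: "\<Q> = f ` {..<n}"
    using finite_imp_nat_seg_image_inj_on[OF Q(1)] by (metis lessThan_def)
  show ?thesis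
  proof (rule exterior_isoperimetric_if_tilings[OF assms(2,3)])
    show "tiling N (f j)" if "j < n" for j using Q(2) f that by blast
    show "Z \<in> sets borel" "emeasure lborel Z = 0" by fact+
    show "N \<subseteq> (\<Union>j<n. \<Union>i. f j i) \<union> Z" using Q(5) f by auto
  qed
qed

lemma tiled_frontier_null:
  assumes "tiled N N" "closed N"
  shows "emeasure lborel (frontier N) = 0"
proof -
  obtain \<Q> Z where Q: "finite \<Q>" "\<forall>Q\<in>\<Q>. tiling N Q" "Z \<in> sets borel" "emeasure lborel Z = 0"
    "N \<subseteq> (\<Union>Q\<in>\<Q>. \<Union>i. Q i) \<union> Z" using assms(1) unfolding tiled_def by blast
  have "Q i \<subseteq> interior N" if "Q \<in> \<Q>" for Q i
  proof (rule interior_maximal)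
    show "Q i \<subseteq> N" using Q(2) that unfolding tiling_def by blast
    show "open (Q i)" using Q(2) that tiling_open by blast
  qed
  note inner = this
  have "frontier N \<subseteq> Z"
  proof
    fix z assume "z \<in> frontier N"
    then have z: "z \<in> N" "z \<notin> interior N" using assms(2) by (auto simp: frontier_def)
    show "z \<in> Z"
    proof (rule ccontr)
      assume "z \<notin> Z"
      then obtain P i where "P \<in> \<Q>" "z \<in> P i" using Q(5) z(1) by blast
      then show False using inner[of P i] z(2) by blast
    qed
  qed
  then have "emeasure lborel (frontier N) \<le> emeasure lborel Z" using Q(3) by (intro emeasure_mono) auto
  then show ?thesis using Q(4) by simp
qed

lemma axes_null:
  assumes "countable A"
  shows "A \<times> UNIV \<union> UNIV \<times> A \<in> sets (borel :: (real \<times> real) measure)"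
    and "emeasure lborel (A \<times> UNIV \<union> UNIV \<times> A :: (real \<times> real) set) = 0"
proof -
  have A: "A \<in> sets borel" "emeasure lborel A = 0"
    using assms countable_imp_null_set_lborel[of A] by (auto simp: null_sets_def)
  have b: "A \<times> UNIV \<in> sets borel" "UNIV \<times> A \<in> sets (borel :: (real \<times> real) measure)"
    using A by (auto intro!: borel_Times)
  have "emeasure lborel (A \<times> (UNIV :: real set)) = 0" "emeasure lborel ((UNIV :: real set) \<times> A) = 0"
    unfolding lborel_prod[symmetric] using A by (simp_all add: lborel.emeasure_pair_measure_Times)
  then have "A \<times> UNIV \<union> UNIV \<times> A \<in> null_sets (lborel :: (real \<times> real) measure)"
    using b by (intro null_sets.Un) (auto simp: null_sets_def)
  then show "A \<times> UNIV \<union> UNIV \<times> A \<in> sets (borel :: (real \<times> real) measure)"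
    "emeasure lborel (A \<times> UNIV \<union> UNIV \<times> A :: (real \<times> real) set) = 0" by (auto simp: null_sets_def)
qed

lemma null_linear_image:
  fixes T :: "real \<times> real \<Rightarrow> complex"
  assumes T: "linear T" "bij T" and A: "A \<in> sets borel" "emeasure lborel A = 0"
  shows "T ` A \<in> sets borel" "emeasure lborel (T ` A) = 0"
proof -
  obtain k where "\<And>A. A \<in> sets borel \<Longrightarrow> T ` A \<in> sets borel"
    "\<And>A. A \<in> sets borel \<Longrightarrow> emeasure lborel (T ` A) = ennreal k * emeasure lborel A"
    by (rule emeasure_linear_image[OF T]) blast
  then show "T ` A \<in> sets borel" "emeasure lborel (T ` A) = 0" using A by simp_all
qed

text \<open>The tiles are the images of the unit squares with integer corners.\<close>

lemma tiled_quadrant_image: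
  fixes T :: "real \<times> real \<Rightarrow> complex"
  assumes T: "linear T" "bij T" and N: "T ` quadrant \<subseteq> N"
  shows "tiled N (T ` quadrant)"
proof -
  define sq where "sq i = (\<lambda>z. (real (fst (prod_decode i)), real (snd (prod_decode i))) + z) ` ({0<..<1} \<times> {0<..<1})" for i
  define Q where "Q i = T ` sq i" for i
  define Z where "Z = T ` (\<int> \<times> UNIV \<union> UNIV \<times> \<int>)"
  have "countable (\<int> :: real set)" by (rule countable_int)
  note ax = axes_null[OF this]
  have Z: "Z \<in> sets borel" "emeasure lborel Z = 0" unfolding Z_def by (rule null_linear_image[OF T ax])+
  have fl: "(\<lfloor>fst z\<rfloor>, \<lfloor>snd z\<rfloor>) = (int (fst (prod_decode i)), int (snd (prod_decode i)))" if "z \<in> sq i" for z i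
    using that by (auto simp: sq_def floor_eq_iff)
  have "disjoint_family sq"
    unfolding disjoint_family_on_def
  proof (intro ballI impI)
    fix i j :: nat assume "i \<noteq> j"
    then have "prod_decode i \<noteq> prod_decode j" by (metis prod_decode_inverse)
    then show "sq i \<inter> sq j = {}" using fl by (auto simp: prod_eq_iff) (metis Pair_inject fl of_nat_eq_iff)+
  qed
  then have disj: "disjoint_family Q"
    unfolding disjoint_family_on_def Q_def using bij_is_inj[OF T(2)] by (metis image_Int image_empty)
  have sub: "sq i \<subseteq> quadrant" for i by (auto simp: sq_def)
  have "tiling N Q" unfolding tiling_def
  proof (intro conjI exI[of _ T] allI disjI2)
    fix i
    show "Q i \<subseteq> N" using sub N unfolding Q_def by blast
    show "\<exists>a. Q i = (\<lambda>z. a + T z) ` ({0<..<1} \<times> {0<..<1})"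
      by (intro exI[of _ "T (real (fst (prod_decode i)), real (snd (prod_decode i)))"])
        (simp add: Q_def sq_def image_image linear_add[OF T(1)])
  qed (use T disj in auto)
  moreover have "T ` quadrant \<subseteq> (\<Union>i. Q i) \<union> Z"
  proof
    fix w assume "w \<in> T ` quadrant"
    then obtain x y where xy: "0 \<le> x" "0 \<le> y" "w = T (x, y)" by auto
    show "w \<in> (\<Union>i. Q i) \<union> Z"
    proof (cases "x \<in> \<int> \<or> y \<in> \<int>")
      case True
      then show ?thesis using xy by (auto simp: Z_def)
    next
      case False
      define i where "i = prod_encode (nat \<lfloor>x\<rfloor>, nat \<lfloor>y\<rfloor>)"
      have fx: "of_int \<lfloor>x\<rfloor> < x" "of_int \<lfloor>y\<rfloor> < y" using False
        by (metis Ints_of_int of_int_floor_le order_le_less)+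
      have "(x, y) = (real (fst (prod_decode i)), real (snd (prod_decode i))) + (x - of_int \<lfloor>x\<rfloor>, y - of_int \<lfloor>y\<rfloor>)"
        using xy by (simp add: i_def)
      moreover have "(x - of_int \<lfloor>x\<rfloor>, y - of_int \<lfloor>y\<rfloor>) \<in> {0<..<1} \<times> {0<..<1}"
        using fx real_of_int_floor_add_one_gt[of x] real_of_int_floor_add_one_gt[of y]
        by (simp add: diff_less_eq add.commute)
      ultimately have "(x, y) \<in> sq i" unfolding sq_def by (rule image_eqI)
      then show ?thesis using xy by (auto simp: Q_def)
    qed
  qed
  ultimately show ?thesis unfolding tiled_def using Z
    by (intro exI[of _ "{Q}"] exI[of _ Z]) auto
qed

text \<open>Near the apex of the image of a quadrant a single small parallelogram at the apex suffices.\<close>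

lemma tiled_quadrant_image_near:
  fixes T :: "real \<times> real \<Rightarrow> complex"
  assumes T: "linear T" "bij T" and \<epsilon>: "0 < \<epsilon>" and N: "(+) x ` T ` quadrant \<inter> ball x \<epsilon> \<subseteq> N"
  obtains \<delta> where "0 < \<delta>" "tiled N ((+) x ` T ` quadrant \<inter> ball x \<delta>)"
proof -
  obtain L where L: "0 < L" "\<And>u. norm (T u) \<le> L * norm u" using linear_bounded_pos[OF T(1)] by blast
  obtain l where l: "0 < l" "\<And>u. l * norm u \<le> norm (T u)"
    using linear_inj_bounded_below_pos[OF T(1) bij_is_inj[OF T(2)]] by blast
  define \<eta> where "\<eta> = \<epsilon> / (2 * L)"
  have \<eta>: "0 < \<eta>" using \<epsilon> L by (simp add: \<eta>_def)
  define T' where "T' u = T (\<eta> *\<^sub>R u)" for u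
  have T': "linear T'" "bij T'"
  proof -
    show "linear T'" unfolding T'_def
      by (rule linearI) (simp_all add: scaleR_add_right linear_add[OF T(1)] linear_scale[OF T(1)] mult.commute)
    have "bij (\<lambda>u::real \<times> real. \<eta> *\<^sub>R u)"
      using \<eta> by (intro o_bij[of "\<lambda>u. (1 / \<eta>) *\<^sub>R u"]) (auto simp: fun_eq_iff)
    then have "bij (T \<circ> (\<lambda>u. \<eta> *\<^sub>R u))" using T(2) by (rule bij_comp)
    moreover have "T' = T \<circ> (\<lambda>u. \<eta> *\<^sub>R u)" by (simp add: T'_def fun_eq_iff)
    ultimately show "bij T'" by simp
  qed
  let ?J = "{0<..<1::real} \<times> {0<..<1::real}"
  define Q where "Q i = (if i = 0 then (\<lambda>z. x + T' z) ` ?J else {})" for i :: nat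
  have "tiling N Q" unfolding tiling_def
  proof (intro conjI exI[of _ T'] allI)
    show "disjoint_family Q" by (auto simp: disjoint_family_on_def Q_def)
    fix i
    show "Q i \<subseteq> N"
    proof (cases "i = 0")
      case True
      have "(\<lambda>z. x + T' z) ` ?J \<subseteq> (+) x ` T ` quadrant \<inter> ball x \<epsilon>"
      proof
        fix w assume "w \<in> (\<lambda>z. x + T' z) ` ?J"
        then obtain u where u: "u \<in> ?J" "w = x + T' u" by blast
        have "norm u < 2"
        proof -
          have "norm u \<le> norm (fst u) + norm (snd u)" using norm_Pair_le[of "fst u" "snd u"] unfolding prod.collapse .
          then show ?thesis using u(1) by auto
        qed
        then have "norm (T' u) < \<epsilon>"
        proof -
          have "norm (T' u) \<le> L * (\<eta> * norm u)" using L(2)[of "\<eta> *\<^sub>R u"] \<eta> by (simp add: T'_def)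
          also have "\<dots> < L * (\<eta> * 2)" using L(1) \<eta> \<open>norm u < 2\<close> by simp
          also have "\<dots> = \<epsilon>" using L(1) by (simp add: \<eta>_def)
          finally show ?thesis .
        qed
        moreover have "\<eta> *\<^sub>R u \<in> quadrant" using u(1) \<eta> by (auto simp: scaleR_prod_def)
        ultimately show "w \<in> (+) x ` T ` quadrant \<inter> ball x \<epsilon>"
          using u(2) by (auto simp: T'_def dist_norm)
      qed
      then have "(\<lambda>z. x + T' z) ` ?J \<subseteq> N" using N by (rule order_trans)
      moreover have "Q i = (\<lambda>z. x + T' z) ` ?J" using True by (simp add: Q_def)
      ultimately show ?thesis by simp
    qed (simp add: Q_def)
    show "Q i = {} \<or> (\<exists>a. Q i = (\<lambda>z. a + T' z) ` ?J)"
    proof (cases "i = 0")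
      case True
      then have "Q i = (\<lambda>z. x + T' z) ` ?J" by (simp add: Q_def)
      then show ?thesis by blast
    qed (simp add: Q_def)
  qed (use T' in auto)
  moreover define Z where "Z = (+) x ` T ` ({0} \<times> UNIV \<union> UNIV \<times> {0})"
  have ax: "{0} \<times> UNIV \<union> UNIV \<times> {0} \<in> sets (borel :: (real \<times> real) measure)"
    "emeasure lborel ({0} \<times> UNIV \<union> UNIV \<times> {0} :: (real \<times> real) set) = 0"
    using axes_null[of "{0::real}"] by simp_all
  have Z: "Z \<in> sets borel" "emeasure lborel Z = 0"
    unfolding Z_def by (rule null_translation[OF null_linear_image[OF T ax]])+
  moreover have "(+) x ` T ` quadrant \<inter> ball x (l * \<eta>) \<subseteq> (\<Union>i. Q i) \<union> Z"
  proof
    fix w assume w: "w \<in> (+) x ` T ` quadrant \<inter> ball x (l * \<eta>)"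
    then obtain a b where ab: "0 \<le> a" "0 \<le> b" "w = x + T (a, b)" by auto
    have "norm (T (a, b)) < l * \<eta>" using w ab(3) by (simp add: dist_norm)
    then have "l * norm (a, b) < l * \<eta>" using l(2)[of "(a, b)"] by linarith
    then have n: "norm (a, b) < \<eta>" using l(1) by simp
    have lt: "a < \<eta>" "b < \<eta>" using norm_fst_le[of a b] norm_snd_le[of b a] n by auto
    show "w \<in> (\<Union>i. Q i) \<union> Z"
    proof (cases "a = 0 \<or> b = 0")
      case True
      then show ?thesis using ab(3) by (auto simp: Z_def)
    next
      case False
      have "w = x + T' (a / \<eta>, b / \<eta>)" using ab(3) \<eta> by (simp add: T'_def)
      moreover have "(a / \<eta>, b / \<eta>) \<in> ?J" using False ab lt \<eta> by (simp add: divide_less_eq)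
      ultimately have "w \<in> Q 0" unfolding Q_def by auto
      then show ?thesis by blast
    qed
  qed
  ultimately have "tiled N ((+) x ` T ` quadrant \<inter> ball x (l * \<eta>))"
    unfolding tiled_def by (intro exI[of _ "{Q}"] exI[of _ Z]) auto
  moreover have "0 < l * \<eta>" using l \<eta> by simp
  ultimately show thesis using that by blast
qed

text \<open>Images of quadrants are convex, whereas sectors of angle more than \<open>\<pi>\<close> are not; four
  images, each of angle less than \<open>\<pi>\<close>, make up every sector of angle at most \<open>2 * pi\<close>, including the half plane and
  the plane.\<close>

definition conical :: "complex set \<Rightarrow> bool" where
  "conical N \<longleftrightarrow> (\<exists>T :: nat \<Rightarrow> real \<times> real \<Rightarrow> complex.
     (\<forall>k<4. linear (T k) \<and> bij (T k)) \<and> N = (\<Union>k<4. T k ` quadrant))"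

lemma conical_closed:
  assumes "conical N" shows "closed N"
proof -
  obtain T :: "nat \<Rightarrow> real \<times> real \<Rightarrow> complex" where T: "\<forall>k<4. linear (T k) \<and> bij (T k)" "N = (\<Union>k<4. T k ` quadrant)"
    using assms unfolding conical_def by blast
  have "closed (T k ` quadrant)" if "k < 4" for k
    using T(1) that by (intro closed_injective_linear_image closed_Times) (auto simp: bij_is_inj)
  then show ?thesis unfolding T(2) by (intro closed_UN) auto
qed

lemma conical_scale:
  assumes "conical N" "0 < c" shows "(*) (complex_of_real c) ` N = N"
proof -
  obtain T :: "nat \<Rightarrow> real \<times> real \<Rightarrow> complex" where T: "\<forall>k<4. linear (T k) \<and> bij (T k)" "N = (\<Union>k<4. T k ` quadrant)"
    using assms(1) unfolding conical_def by blast
  have sub: "(*) (complex_of_real c) ` N \<subseteq> N" if c: "0 < c" for c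
  proof
    fix z assume "z \<in> (*) (complex_of_real c) ` N"
    then obtain k u where k: "k < 4" "u \<in> quadrant" "z = complex_of_real c * T k u" unfolding T(2) by blast
    have "z = T k (c *\<^sub>R u)" using k T(1) by (simp add: linear_scale scaleR_conv_of_real)
    moreover have "c *\<^sub>R u \<in> quadrant" using k(2) c by (auto simp: scaleR_prod_def)
    ultimately have "z \<in> T k ` quadrant" by (rule image_eqI)
    then show "z \<in> N" unfolding T(2) using k(1) by blast
  qed
  have "N \<subseteq> (*) (complex_of_real c) ` N"
  proof
    fix z assume z: "z \<in> N"
    have "complex_of_real (1 / c) * z \<in> N" using sub[of "1 / c"] z assms(2) by auto
    then have "complex_of_real c * (complex_of_real (1 / c) * z) \<in> (*) (complex_of_real c) ` N" by (rule imageI)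
    then show "z \<in> (*) (complex_of_real c) ` N" using assms(2) by simp
  qed
  then show ?thesis using sub[OF assms(2)] by blast
qed

lemma conical_tiled:
  assumes "conical N" shows "tiled N N"
proof -
  obtain T :: "nat \<Rightarrow> real \<times> real \<Rightarrow> complex" where T: "\<forall>k<4. linear (T k) \<and> bij (T k)" "N = (\<Union>k<4. T k ` quadrant)"
    using assms(1) unfolding conical_def by blast
  have "tiled N (\<Union>k\<in>{..<4}. T k ` quadrant)"
    using T by (intro tiled_UN tiled_quadrant_image) auto
  then show ?thesis using T(2) by simp
qed

lemma conical_interior_near_origin:
  assumes "conical N" "0 < \<rho>" shows "interior N \<inter> ball 0 \<rho> \<noteq> {}"
proof -
  obtain T :: "nat \<Rightarrow> real \<times> real \<Rightarrow> complex" where T: "\<forall>k<4. linear (T k) \<and> bij (T k)" "N = (\<Union>k<4. T k ` quadrant)"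
    using assms(1) unfolding conical_def by blast
  have T0: "linear (T 0)" "bij (T 0)" using T(1) by auto
  have "open (T 0 ` ({0<..} \<times> {0<..}))"
    using T0 by (intro open_surjective_linear_image) (auto simp: open_Times bij_is_surj)
  moreover have "T 0 ` ({0<..} \<times> {0<..}) \<subseteq> N" unfolding T(2) by force
  ultimately have sub: "T 0 ` ({0<..} \<times> {0<..}) \<subseteq> interior N" by (intro interior_maximal)
  obtain L where L: "0 < L" "\<And>u. norm (T 0 u) \<le> L * norm u" using linear_bounded_pos[OF T0(1)] by blast
  define e where "e = \<rho> / (4 * L)"
  have e: "0 < e" using assms(2) L by (simp add: e_def)
  have "norm (e, e) \<le> 2 * e" using norm_Pair_le[of e e] e by simp
  then have "norm (T 0 (e, e)) \<le> L * (2 * e)" using L(2)[of "(e, e)"] mult_left_mono[of "norm (e, e)" "2 * e" L] L(1) by linarith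
  also have "\<dots> < \<rho>" using L(1) assms(2) by (simp add: e_def)
  finally have "T 0 (e, e) \<in> ball 0 \<rho>" by simp
  moreover have "T 0 (e, e) \<in> interior N" using sub e by auto
  ultimately show ?thesis by blast
qed

text \<open>Compactness reduces the tiling of \<open>B\<close> to neighbourhoods of its points.\<close>

lemma locally_conical_tiled:
  assumes B: "compact B"
    and loc: "\<And>x. x \<in> B \<Longrightarrow> \<exists>\<epsilon>>0. \<exists>N. conical N \<and> B \<inter> ball x \<epsilon> = (+) x ` N \<inter> ball x \<epsilon>"
  shows "tiled B B"
proof -
  have "\<exists>\<delta>>0. tiled B (B \<inter> ball x \<delta>)" if x: "x \<in> B" for x
  proof -
    obtain \<epsilon> N where \<epsilon>: "0 < \<epsilon>" "conical N" "B \<inter> ball x \<epsilon> = (+) x ` N \<inter> ball x \<epsilon>" using loc[OF x] by blast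
    obtain T :: "nat \<Rightarrow> real \<times> real \<Rightarrow> complex" where T: "\<forall>k<4. linear (T k) \<and> bij (T k)" "N = (\<Union>k<4. T k ` quadrant)"
      using \<epsilon>(2) unfolding conical_def by blast
    have "\<exists>\<delta>>0. tiled B ((+) x ` T k ` quadrant \<inter> ball x \<delta>)" if k: "k < 4" for k
    proof -
      have "(+) x ` T k ` quadrant \<inter> ball x \<epsilon> \<subseteq> (+) x ` N \<inter> ball x \<epsilon>" using T(2) k by blast
      then have "(+) x ` T k ` quadrant \<inter> ball x \<epsilon> \<subseteq> B" using \<epsilon>(3) by blast
      then show ?thesis using tiled_quadrant_image_near[of "T k" \<epsilon> x B] T(1) k \<epsilon>(1) by metis
    qed
    then obtain \<delta> where \<delta>: "\<And>k. k < 4 \<Longrightarrow> 0 < \<delta> k" "\<And>k. k < 4 \<Longrightarrow> tiled B ((+) x ` T k ` quadrant \<inter> ball x (\<delta> k))"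
      by metis
    define d where "d = Min (insert \<epsilon> (\<delta> ` {..<4::nat}))"
    have d: "0 < d" unfolding d_def using \<delta>(1) \<epsilon>(1) by (subst Min_gr_iff) auto
    have d_le: "d \<le> \<epsilon>" "k < 4 \<Longrightarrow> d \<le> \<delta> k" for k unfolding d_def by (auto intro!: Min_le)
    have "tiled B (\<Union>k\<in>{..<4}. (+) x ` T k ` quadrant \<inter> ball x (\<delta> k))"
      using \<delta>(2) by (intro tiled_UN) auto
    moreover have "B \<inter> ball x d \<subseteq> (\<Union>k\<in>{..<4}. (+) x ` T k ` quadrant \<inter> ball x (\<delta> k))"
    proof
      fix z assume z: "z \<in> B \<inter> ball x d"
      then have "z \<in> (+) x ` N" using \<epsilon>(3) d_le(1) by fastforce
      then obtain k where k: "k < 4" "z \<in> (+) x ` T k ` quadrant" using T(2) by blast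
      moreover have "z \<in> ball x (\<delta> k)" using z d_le(2)[OF k(1)] by auto
      ultimately show "z \<in> (\<Union>k\<in>{..<4}. (+) x ` T k ` quadrant \<inter> ball x (\<delta> k))" by blast
    qed
    ultimately show ?thesis using d tiled_mono by blast
  qed
  then obtain \<delta> where \<delta>: "\<And>x. x \<in> B \<Longrightarrow> 0 < \<delta> x" "\<And>x. x \<in> B \<Longrightarrow> tiled B (B \<inter> ball x (\<delta> x))" by metis
  have cover: "B \<subseteq> (\<Union>x\<in>B. ball x (\<delta> x))"
  proof
    fix x assume "x \<in> B"
    then have "x \<in> ball x (\<delta> x)" using \<delta>(1) by simp
    then show "x \<in> (\<Union>x\<in>B. ball x (\<delta> x))" using \<open>x \<in> B\<close> by blast
  qed
  obtain X where X: "X \<subseteq> B" "finite X" "B \<subseteq> (\<Union>x\<in>X. ball x (\<delta> x))"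
    by (rule compactE_image[OF B _ cover]) (simp, rule that)
  have "tiled B (\<Union>x\<in>X. B \<inter> ball x (\<delta> x))" using X \<delta>(2) by (intro tiled_UN) auto
  then show ?thesis by (rule tiled_mono) (use X(3) in blast)
qed

text \<open>A sector of angle less than \<open>\<pi>\<close> consists of the nonnegative combinations of its two bounding directions.\<close>

lemma sector_piece:
  fixes \<alpha> \<beta> :: real
  assumes ab: "\<alpha> < \<beta>" "\<beta> < \<alpha> + pi"
  defines "T \<equiv> \<lambda>z::real \<times> real. of_real (fst z) * cis \<alpha> + of_real (snd z) * cis \<beta>"
  shows "linear T" "bij T" "T ` quadrant = {of_real r * cis \<psi> | r \<psi>. 0 \<le> r \<and> \<alpha> \<le> \<psi> \<and> \<psi> \<le> \<beta>}"
proof -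
  have s: "0 < sin (\<beta> - \<alpha>)" using ab by (intro sin_gt_zero) auto
  show lin: "linear T" unfolding T_def
    by (rule linearI) (simp_all add: algebra_simps scaleR_conv_of_real)
  have T0: "u = 0" if "T u = 0" for u
  proof -
    obtain x y where u: "u = (x, y)" by (cases u)
    have "T u * cis (- \<alpha>) = of_real x + of_real y * cis (\<beta> - \<alpha>)"
      by (simp add: T_def u distrib_right mult.assoc cis_mult)
    then have "Im (of_real x + of_real y * cis (\<beta> - \<alpha>)) = 0" "Re (of_real x + of_real y * cis (\<beta> - \<alpha>)) = 0"
      using that by (metis mult_zero_left zero_complex.sel)+
    then show "u = 0" using s by (simp add: u zero_prod_def)
  qed
  have inj: "inj T" using linear_injective_0[OF lin] T0 by blast
  have surj: "surj T"
    unfolding surj_def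
  proof
    fix w
    define v where "v = w * cis (- \<alpha>)"
    define y where "y = Im v / sin (\<beta> - \<alpha>)"
    define x where "x = Re v - y * cos (\<beta> - \<alpha>)"
    have "of_real x + of_real y * cis (\<beta> - \<alpha>) = v"
      using s by (simp add: complex_eq_iff x_def y_def)
    then have "(of_real x + of_real y * cis (\<beta> - \<alpha>)) * cis \<alpha> = w"
      by (simp add: v_def mult.assoc cis_mult)
    then have "w = T (x, y)" by (simp add: T_def distrib_right mult.assoc cis_mult)
    then show "\<exists>u. w = T u" by blast
  qed
  show "bij T" using inj surj by (simp add: bij_def)
  show "T ` quadrant = {of_real r * cis \<psi> | r \<psi>. 0 \<le> r \<and> \<alpha> \<le> \<psi> \<and> \<psi> \<le> \<beta>}"
  proof (intro equalityI subsetI)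
    fix z assume "z \<in> T ` quadrant"
    then obtain x y where xy: "0 \<le> x" "0 \<le> y" "z = T (x, y)" by auto
    define v where "v = of_real x + of_real y * cis (\<beta> - \<alpha>)"
    have zv: "z = v * cis \<alpha>" by (simp add: xy T_def v_def distrib_right mult.assoc cis_mult)
    show "z \<in> {of_real r * cis \<psi> | r \<psi>. 0 \<le> r \<and> \<alpha> \<le> \<psi> \<and> \<psi> \<le> \<beta>}"
    proof (cases "v = 0")
      case True
      then have "z = of_real 0 * cis \<alpha>" by (simp add: zv)
      then show ?thesis using ab by force
    next
      case False
      define \<phi> where "\<phi> = Arg v"
      have v: "v = of_real (norm v) * cis \<phi>" unfolding \<phi>_def using False
        by (simp add: cis_Arg sgn_eq)
      have im: "0 \<le> Im v" using xy s by (simp add: v_def)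
      then have \<phi>: "0 \<le> \<phi>" "\<phi> \<le> pi" using Arg_less_0[of v] Arg_bounded[of v] by (auto simp: \<phi>_def not_less)
      have "\<phi> \<le> \<beta> - \<alpha>"
      proof (rule ccontr)
        assume "\<not> ?thesis"
        then have "0 < sin (\<phi> - (\<beta> - \<alpha>))" using \<phi> ab by (intro sin_gt_zero) auto
        then have "0 < norm v * sin (\<phi> - (\<beta> - \<alpha>))" using False by simp
        also have "norm v * sin (\<phi> - (\<beta> - \<alpha>)) = Im (v * cis (- (\<beta> - \<alpha>)))"
        proof -
          have "v * cis (- (\<beta> - \<alpha>)) = of_real (norm v) * cis \<phi> * cis (- (\<beta> - \<alpha>))"
            by (rule arg_cong[OF v, of "\<lambda>w. w * cis (- (\<beta> - \<alpha>))"])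
          also have "\<dots> = of_real (norm v) * cis (\<phi> - (\<beta> - \<alpha>))"
            by (simp only: mult.assoc cis_mult diff_conv_add_uminus[of \<phi> "\<beta> - \<alpha>"])
          finally show ?thesis by simp
        qed
        also have "v * cis (- (\<beta> - \<alpha>)) = of_real x * cis (- (\<beta> - \<alpha>)) + of_real y"
          by (simp add: v_def distrib_right mult.assoc cis_mult)
        also have "Im \<dots> = - x * sin (\<beta> - \<alpha>)" using sin_minus[of "\<beta> - \<alpha>"] by simp
        finally have "0 < - (x * sin (\<beta> - \<alpha>))" by simp
        moreover have "0 \<le> x * sin (\<beta> - \<alpha>)" using xy(1) s by simp
        ultimately show False by linarith
      qed
      moreover have "z = of_real (norm v) * cis (\<phi> + \<alpha>)"
        unfolding zv by (subst v) (simp add: mult.assoc cis_mult)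
      ultimately show ?thesis using \<phi>(1) by (intro CollectI exI[of _ "norm v"] exI[of _ "\<phi> + \<alpha>"]) auto
    qed
  next
    fix z assume "z \<in> {of_real r * cis \<psi> | r \<psi>. 0 \<le> r \<and> \<alpha> \<le> \<psi> \<and> \<psi> \<le> \<beta>}"
    then obtain r \<psi> where r: "z = of_real r * cis \<psi>" "0 \<le> r" "\<alpha> \<le> \<psi>" "\<psi> \<le> \<beta>" by blast
    \<comment> \<open>The coordinates of \<open>z\<close> in the basis of the two directions, by Cramer's rule.\<close>
    define x y where "x = r * sin (\<beta> - \<psi>) / sin (\<beta> - \<alpha>)" and "y = r * sin (\<psi> - \<alpha>) / sin (\<beta> - \<alpha>)"
    have "0 \<le> sin (\<beta> - \<psi>)" "0 \<le> sin (\<psi> - \<alpha>)" using r ab by (auto intro!: sin_ge_zero)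
    then have xy: "0 \<le> x" "0 \<le> y" using r(2) s by (auto simp: x_def y_def)
    have id: "sin (\<beta> - \<psi>) * cos \<alpha> + sin (\<psi> - \<alpha>) * cos \<beta> = sin (\<beta> - \<alpha>) * cos \<psi>"
      "sin (\<beta> - \<psi>) * sin \<alpha> + sin (\<psi> - \<alpha>) * sin \<beta> = sin (\<beta> - \<alpha>) * sin \<psi>"
    proof -
      have "sin (\<beta> - \<psi>) * cos \<alpha> + sin (\<psi> - \<alpha>) * cos \<beta> = (sin \<beta> * cos \<alpha> - cos \<beta> * sin \<alpha>) * cos \<psi>"
        by (simp add: sin_diff algebra_simps)
      then show "sin (\<beta> - \<psi>) * cos \<alpha> + sin (\<psi> - \<alpha>) * cos \<beta> = sin (\<beta> - \<alpha>) * cos \<psi>" by (simp add: sin_diff)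
      have "sin (\<beta> - \<psi>) * sin \<alpha> + sin (\<psi> - \<alpha>) * sin \<beta> = (sin \<beta> * cos \<alpha> - cos \<beta> * sin \<alpha>) * sin \<psi>"
        by (simp add: sin_diff algebra_simps)
      then show "sin (\<beta> - \<psi>) * sin \<alpha> + sin (\<psi> - \<alpha>) * sin \<beta> = sin (\<beta> - \<alpha>) * sin \<psi>" by (simp add: sin_diff)
    qed
    have "x * cos \<alpha> + y * cos \<beta> = r / sin (\<beta> - \<alpha>) * (sin (\<beta> - \<psi>) * cos \<alpha> + sin (\<psi> - \<alpha>) * cos \<beta>)"
      by (simp add: x_def y_def algebra_simps)
    also have "\<dots> = r * cos \<psi>" unfolding id using s by simp
    finally have 1: "x * cos \<alpha> + y * cos \<beta> = r * cos \<psi>" .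
    have "x * sin \<alpha> + y * sin \<beta> = r / sin (\<beta> - \<alpha>) * (sin (\<beta> - \<psi>) * sin \<alpha> + sin (\<psi> - \<alpha>) * sin \<beta>)"
      by (simp add: x_def y_def algebra_simps)
    also have "\<dots> = r * sin \<psi>" unfolding id using s by simp
    finally have 2: "x * sin \<alpha> + y * sin \<beta> = r * sin \<psi>" .
    have "z = T (x, y)" using 1 2 by (simp add: complex_eq_iff T_def r(1))
    then show "z \<in> T ` quadrant" using xy by auto
  qed
qed

lemma conical_rotated_sector:
  assumes \<theta>: "0 < \<theta>" "\<theta> \<le> 2 * pi"
  shows "conical ((*) (cis \<phi>) ` sector \<theta>)"
proof -
  define \<alpha> where "\<alpha> k = \<phi> + real k * (\<theta> / 4)" for k :: nat
  have step: "\<alpha> k < \<alpha> (Suc k)" "\<alpha> (Suc k) < \<alpha> k + pi" for k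
    using \<theta> pi_gt_zero by (auto simp: \<alpha>_def algebra_simps)
  define T where "T k = (\<lambda>z::real \<times> real. of_real (fst z) * cis (\<alpha> k) + of_real (snd z) * cis (\<alpha> (Suc k)))" for k
  note piece = sector_piece[OF step]
  have Tq: "T k ` quadrant = {of_real r * cis \<psi> | r \<psi>. 0 \<le> r \<and> \<alpha> k \<le> \<psi> \<and> \<psi> \<le> \<alpha> (Suc k)}" for k
    unfolding T_def by (rule piece(3))
  have sec: "(*) (cis \<phi>) ` sector \<theta> = {of_real r * cis \<psi> | r \<psi>. 0 \<le> r \<and> \<phi> \<le> \<psi> \<and> \<psi> \<le> \<phi> + \<theta>}"
  proof (intro equalityI subsetI)
    fix z assume "z \<in> (*) (cis \<phi>) ` sector \<theta>"
    then obtain r \<psi> where r: "z = cis \<phi> * (of_real r * cis \<psi>)" "0 \<le> r" "0 \<le> \<psi>" "\<psi> \<le> \<theta>"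
      unfolding sector_def by blast
    then have "z = of_real r * cis (\<phi> + \<psi>)" by (simp add: cis_mult[symmetric] mult_ac)
    then show "z \<in> {of_real r * cis \<psi> | r \<psi>. 0 \<le> r \<and> \<phi> \<le> \<psi> \<and> \<psi> \<le> \<phi> + \<theta>}"
      using r by (intro CollectI exI[of _ r] exI[of _ "\<phi> + \<psi>"]) auto
  next
    fix z assume "z \<in> {of_real r * cis \<psi> | r \<psi>. 0 \<le> r \<and> \<phi> \<le> \<psi> \<and> \<psi> \<le> \<phi> + \<theta>}"
    then obtain r \<psi> where r: "z = of_real r * cis \<psi>" "0 \<le> r" "\<phi> \<le> \<psi>" "\<psi> \<le> \<phi> + \<theta>" by blast
    have "z = cis \<phi> * (of_real r * cis (\<psi> - \<phi>))" using r(1) by (simp add: cis_mult mult.left_commute)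
    moreover have "of_real r * cis (\<psi> - \<phi>) \<in> sector \<theta>"
      unfolding sector_def using r by (intro CollectI exI[of _ r] exI[of _ "\<psi> - \<phi>"]) auto
    ultimately show "z \<in> (*) (cis \<phi>) ` sector \<theta>" by blast
  qed
  have "(*) (cis \<phi>) ` sector \<theta> = (\<Union>k<4. T k ` quadrant)"
  proof (intro equalityI subsetI)
    fix z assume "z \<in> (*) (cis \<phi>) ` sector \<theta>"
    then obtain r \<psi> where r: "z = of_real r * cis \<psi>" "0 \<le> r" "\<phi> \<le> \<psi>" "\<psi> \<le> \<phi> + \<theta>" unfolding sec by blast
    have "\<exists>k<4. \<alpha> k \<le> \<psi> \<and> \<psi> \<le> \<alpha> (Suc k)"
    proof -
      have ends: "\<alpha> 0 \<le> \<psi>" "\<psi> \<le> \<alpha> (Suc 3)" using r(3,4) by (auto simp: \<alpha>_def)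
      consider "\<psi> \<le> \<alpha> (Suc 0)" | "\<alpha> 1 \<le> \<psi>" "\<psi> \<le> \<alpha> (Suc 1)"
        | "\<alpha> 2 \<le> \<psi>" "\<psi> \<le> \<alpha> (Suc 2)" | "\<alpha> 3 \<le> \<psi>" by (force simp: numeral_2_eq_2 numeral_3_eq_3)
      then show ?thesis
      proof cases
        case 1
        then show ?thesis using ends by (intro exI[of _ 0]) simp
      next
        case 2
        then show ?thesis by (intro exI[of _ 1]) simp
      next
        case 3
        then show ?thesis by (intro exI[of _ 2]) simp
      next
        case 4
        then show ?thesis using ends by (intro exI[of _ 3]) simp
      qed
    qed
    then obtain k where k: "k < 4" "\<alpha> k \<le> \<psi>" "\<psi> \<le> \<alpha> (Suc k)" by blast
    then have "z \<in> T k ` quadrant" unfolding Tq using r by blast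
    then show "z \<in> (\<Union>k<4. T k ` quadrant)" using k(1) by blast
  next
    fix z assume "z \<in> (\<Union>k<4. T k ` quadrant)"
    then obtain k where k: "k < 4" "z \<in> T k ` quadrant" by blast
    then obtain r \<psi> where r: "z = of_real r * cis \<psi>" "0 \<le> r" "\<alpha> k \<le> \<psi>" "\<psi> \<le> \<alpha> (Suc k)" unfolding Tq by blast
    have "\<phi> \<le> \<alpha> k" using \<theta> by (simp add: \<alpha>_def)
    moreover have "\<alpha> (Suc k) \<le> \<phi> + \<theta>"
    proof -
      have "real (Suc k) * (\<theta> / 4) \<le> 4 * (\<theta> / 4)" using k(1) \<theta> by (intro mult_right_mono) auto
      then show ?thesis by (simp add: \<alpha>_def)
    qed
    ultimately have "\<phi> \<le> \<psi>" "\<psi> \<le> \<phi> + \<theta>" using r by linarith+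
    then show "z \<in> (*) (cis \<phi>) ` sector \<theta>" unfolding sec using r by blast
  qed
  then show ?thesis unfolding conical_def using piece(1,2) T_def by (intro exI[of _ T]) (simp add: T_def)
qed

section \<open>Sectors in polar coordinates\<close>

lemma Arg2pi_polar:
  assumes "0 < r" "0 \<le> a" "a < 2 * pi" shows "Arg2pi (of_real r * cis a) = a"
  by (rule Arg2pi_unique[of r a]) (use assms in \<open>simp_all add: cis_conv_exp\<close>)

lemma polar_Arg2pi: "z = of_real (norm z) * cis (Arg2pi z)"
  using Arg2pi_eq[of z] by (simp add: cis_conv_exp)

lemma angle_polar:
  fixes u :: complex
  assumes "u \<noteq> 0" "0 < r" "0 \<le> a" "a < 2 * pi"
  shows "Arg2pi (of_real r * sgn u * cis a / u) = a"
proof -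
  have "of_real r * sgn u * cis a / u = of_real (r / norm u) * cis a"
    using assms(1) by (simp add: sgn_eq field_simps)
  then show ?thesis using Arg2pi_polar[of "r / norm u" a] assms by simp
qed

text \<open>Polar coordinates in which angles are measured counterclockwise from the direction of \<open>u\<close>.\<close>

lemma polar_angle:
  fixes u :: complex
  assumes "u \<noteq> 0"
  shows "z = of_real (norm z) * sgn u * cis (Arg2pi (z / u))"
proof -
  have "z / u = of_real (norm z / norm u) * cis (Arg2pi (z / u))"
    using polar_Arg2pi[of "z / u"] by (simp add: norm_divide)
  then have "z = of_real (norm z / norm u) * cis (Arg2pi (z / u)) * u"
    using assms by (metis nonzero_eq_divide_eq)
  then show ?thesis using assms by (simp add: sgn_eq field_simps)
qed

lemma sgn_eq_cis: "u \<noteq> 0 \<Longrightarrow> \<exists>\<phi>. sgn u = cis \<phi>"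
  by (metis cis_Arg)

lemma rotated_sector_angle:
  fixes u :: complex
  assumes u: "u \<noteq> 0" and t: "0 < t" "t < 2 * pi"
  shows "z \<in> (*) (sgn u) ` sector t \<longleftrightarrow> Arg2pi (z / u) \<le> t"
proof
  assume "z \<in> (*) (sgn u) ` sector t"
  then obtain r \<theta> where r: "z = sgn u * (of_real r * cis \<theta>)" "0 \<le> r" "0 \<le> \<theta>" "\<theta> \<le> t"
    unfolding sector_def by blast
  have z: "z = of_real r * sgn u * cis \<theta>" using r(1) by simp
  show "Arg2pi (z / u) \<le> t"
  proof (cases "r = 0")
    case True
    then show ?thesis using z t by simp
  next
    case False
    then have "Arg2pi (z / u) = \<theta>" unfolding z using u r t by (intro angle_polar) auto
    then show ?thesis using r by simp
  qed
next
  assume "Arg2pi (z / u) \<le> t"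
  then have "of_real (norm z) * cis (Arg2pi (z / u)) \<in> sector t"
    unfolding sector_def using Arg2pi_ge_0 by (intro CollectI exI[of _ "norm z"] exI[of _ "Arg2pi (z / u)"]) simp
  then have "sgn u * (of_real (norm z) * cis (Arg2pi (z / u))) \<in> (*) (sgn u) ` sector t" by (rule imageI)
  moreover have "sgn u * (of_real (norm z) * cis (Arg2pi (z / u))) = z"
    using polar_angle[OF u, of z] by (simp add: mult_ac)
  ultimately show "z \<in> (*) (sgn u) ` sector t" by simp
qed

text \<open>The sector from \<open>w\<close> counterclockwise to \<open>u\<close>.  It contains the direction \<open>u\<close> as its last ray, where the
  angle jumps from \<open>2 * pi\<close> to \<open>0\<close>; this is why angle \<open>0\<close> appears.\<close>

lemma complementary_sector_angle:
  fixes u w :: complex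
  assumes u: "u \<noteq> 0" "w \<noteq> 0" and t: "t = Arg2pi (w / u)" "0 < t"
  shows "z \<in> (*) (sgn w) ` sector (2 * pi - t) \<longleftrightarrow> Arg2pi (z / u) = 0 \<or> t \<le> Arg2pi (z / u)"
proof -
  have t2: "t < 2 * pi" using t Arg2pi_lt_2pi by simp
  have sw: "sgn w = sgn u * cis t"
  proof -
    have "w = of_real (norm w) * sgn u * cis t" using polar_angle[OF u(1), of w] t by simp
    then have "sgn w = of_real (norm w) * sgn u * cis t / of_real (norm w)" by (metis sgn_eq)
    then show ?thesis using u by simp
  qed
  show ?thesis
  proof
    assume "z \<in> (*) (sgn w) ` sector (2 * pi - t)"
    then obtain r \<theta> where r: "z = sgn w * (of_real r * cis \<theta>)" "0 \<le> r" "0 \<le> \<theta>" "\<theta> \<le> 2 * pi - t"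
      unfolding sector_def by blast
    have z: "z = of_real r * sgn u * cis (t + \<theta>)" using r(1) by (simp add: sw cis_mult[symmetric] mult_ac)
    show "Arg2pi (z / u) = 0 \<or> t \<le> Arg2pi (z / u)"
    proof (cases "r = 0 \<or> t + \<theta> = 2 * pi")
      case True
      then consider "z = 0" | "r > 0" "z = of_real r * sgn u * cis 0" using z r(2) by (cases "r = 0") auto
      then show ?thesis
      proof cases
        case 2
        then show ?thesis using angle_polar[OF u(1), of r 0] by simp
      qed simp
    next
      case False
      then have "Arg2pi (z / u) = t + \<theta>" unfolding z using u r t by (intro angle_polar) auto
      then show ?thesis using r by simp
    qed
  next
    assume a: "Arg2pi (z / u) = 0 \<or> t \<le> Arg2pi (z / u)"
    define a where "a = (if Arg2pi (z / u) = 0 then 2 * pi else Arg2pi (z / u))"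
    have a1: "t \<le> a" "a \<le> 2 * pi" using a Arg2pi_lt_2pi[of "z / u"] t2 by (auto simp: a_def)
    have "cis (Arg2pi (z / u)) = cis a" by (simp add: a_def cis_2pi)
    then have z: "z = of_real (norm z) * sgn u * cis a" using polar_angle[OF u(1), of z] by simp
    have "cis t * cis (a - t) = cis a" by (simp add: cis_mult)
    moreover have "sgn w * (of_real (norm z) * cis (a - t)) = of_real (norm z) * sgn u * (cis t * cis (a - t))"
      by (simp only: sw mult_ac)
    ultimately have "z = sgn w * (of_real (norm z) * cis (a - t))" using z by metis
    moreover have "of_real (norm z) * cis (a - t) \<in> sector (2 * pi - t)"
      unfolding sector_def using a1 by (intro CollectI exI[of _ "norm z"] exI[of _ "a - t"]) simp
    ultimately show "z \<in> (*) (sgn w) ` sector (2 * pi - t)" by blast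
  qed
qed

lemma sector_2pi: "sector (2 * pi) = UNIV"
proof -
  have "z \<in> sector (2 * pi)" for z
    unfolding sector_def using polar_Arg2pi[of z] Arg2pi_ge_0[of z] Arg2pi_lt_2pi[of z]
    by (intro CollectI exI[of _ "norm z"] exI[of _ "Arg2pi z"]) simp
  then show ?thesis by blast
qed

lemma sector_pi: "sector pi = half_plane"
proof -
  have "z \<in> sector pi \<longleftrightarrow> Arg2pi z \<le> pi" for z
    using rotated_sector_angle[of 1 pi z] by (simp add: image_ident)
  then show ?thesis unfolding half_plane_def using Arg2pi_le_pi by blast
qed

lemma connected_open_sector:
  fixes u :: complex
  assumes u: "u \<noteq> 0" and ab: "0 \<le> a" "b \<le> 2 * pi"
  shows "connected {z. a < Arg2pi (z / u) \<and> Arg2pi (z / u) < b \<and> norm z < \<epsilon>}"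
proof -
  let ?f = "\<lambda>(r, \<psi>). of_real r * sgn u * cis \<psi>"
  have polar: "{z. a < Arg2pi (z / u) \<and> Arg2pi (z / u) < b \<and> norm z < \<epsilon>} = ?f ` ({0<..<\<epsilon>} \<times> {a<..<b})"
  proof (intro equalityI subsetI)
    fix z assume "z \<in> {z. a < Arg2pi (z / u) \<and> Arg2pi (z / u) < b \<and> norm z < \<epsilon>}"
    then have z: "a < Arg2pi (z / u)" "Arg2pi (z / u) < b" "norm z < \<epsilon>" by auto
    have "z \<noteq> 0" using z(1) ab by auto
    then have "(norm z, Arg2pi (z / u)) \<in> {0<..<\<epsilon>} \<times> {a<..<b}" using z by simp
    moreover have "z = ?f (norm z, Arg2pi (z / u))" using polar_angle[OF u, of z] by simp
    ultimately show "z \<in> ?f ` ({0<..<\<epsilon>} \<times> {a<..<b})" by blast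
  next
    fix z assume "z \<in> ?f ` ({0<..<\<epsilon>} \<times> {a<..<b})"
    then obtain r \<psi> where r: "0 < r" "r < \<epsilon>" "a < \<psi>" "\<psi> < b" "z = of_real r * sgn u * cis \<psi>" by auto
    have "Arg2pi (z / u) = \<psi>" unfolding r(5) using u r ab by (intro angle_polar) auto
    moreover have "norm z = r" using r u by (simp add: norm_mult norm_sgn)
    ultimately show "z \<in> {z. a < Arg2pi (z / u) \<and> Arg2pi (z / u) < b \<and> norm z < \<epsilon>}" using r by simp
  qed
  have "connected ({0<..<\<epsilon>} \<times> {a<..<b})" by (intro connected_Times connected_Ioo)
  moreover have "continuous_on ({0<..<\<epsilon>} \<times> {a<..<b}) ?f"
    unfolding split_def by (intro continuous_intros)
  ultimately show ?thesis unfolding polar by (intro connected_continuous_image)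
qed

lemma mem_translation_iff: "(z::complex) \<in> (+) x ` S \<longleftrightarrow> z - x \<in> S"
proof
  assume "z - x \<in> S"
  then have "x + (z - x) \<in> (+) x ` S" by (rule imageI)
  then show "z \<in> (+) x ` S" by simp
qed auto

section \<open>A Jordan curve near a corner\<close>

definition ray :: "complex \<Rightarrow> complex set" where
  "ray u = {of_real s * u | s. 0 \<le> s}"

lemma mem_ray_iff:
  fixes u w :: complex
  assumes "u \<noteq> 0" "w \<noteq> 0"
  shows "z \<in> ray w \<longleftrightarrow> z = 0 \<or> Arg2pi (z / u) = Arg2pi (w / u)"
proof (cases "z = 0")
  case True
  then show ?thesis unfolding ray_def by (auto intro: exI[of _ 0])
next
  case False
  have "Arg2pi (z / u) = Arg2pi (w / u) \<longleftrightarrow> (\<exists>x. 0 < x \<and> z / u = of_real x * (w / u))"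
    using assms False by (intro Arg2pi_eq_iff) auto
  also have "\<dots> \<longleftrightarrow> (\<exists>x. 0 < x \<and> z = of_real x * w)" using assms by (simp add: field_simps)
  also have "\<dots> \<longleftrightarrow> z \<in> ray w" unfolding ray_def using False
    by (auto simp: less_le)
  finally show ?thesis using False by blast
qed

text \<open>In the ball, the complement of the two rays consists of two connected open sectors.  Each of them lies on
  one side of the curve, and since \<open>x\<close> is in the frontier of both sides, they lie on different sides.  The
  second conjunct of each alternative records where the first sector lies; it decides about the interior
  angle of a polygon.\<close>

lemma jordan_two_rays:
  fixes P I V B :: "complex set"
  assumes op: "open I" "open V" and disj: "I \<inter> V = {}" and cover: "I \<union> V = - P"
    and fr: "frontier I = P" "frontier V = P" and x: "x \<in> P" and B: "B = P \<union> I"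
    and \<epsilon>: "0 < \<epsilon>" and u: "u \<noteq> 0" "w \<noteq> 0" and t: "t = Arg2pi (w / u)" "t \<noteq> 0"
    and rays: "P \<inter> ball x \<epsilon> = (+) x ` (ray u \<union> ray w) \<inter> ball x \<epsilon>"
  shows "B \<inter> ball x \<epsilon> = (+) x ` (*) (sgn u) ` sector t \<inter> ball x \<epsilon> \<and>
      (\<forall>z. 0 < Arg2pi (z / u) \<and> Arg2pi (z / u) < t \<and> norm z < \<epsilon> \<longrightarrow> x + z \<in> B) \<or>
    B \<inter> ball x \<epsilon> = (+) x ` (*) (sgn w) ` sector (2 * pi - t) \<inter> ball x \<epsilon> \<and>
      (\<forall>z. 0 < Arg2pi (z / u) \<and> Arg2pi (z / u) < t \<and> norm z < \<epsilon> \<longrightarrow> x + z \<notin> B)"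
proof -
  have t': "0 < t" "t < 2 * pi" using t Arg2pi_ge_0[of "w / u"] Arg2pi_lt_2pi[of "w / u"] by auto
  define A where "A z = Arg2pi (z / u)" for z
  have A: "0 \<le> A z" "A z < 2 * pi" for z using Arg2pi_ge_0 Arg2pi_lt_2pi by (auto simp: A_def)
  have mem: "x + z \<in> P \<longleftrightarrow> z = 0 \<or> A z = 0 \<or> A z = t" if "norm z < \<epsilon>" for z
  proof -
    have "x + z \<in> P \<longleftrightarrow> x + z \<in> P \<inter> ball x \<epsilon>" using that by (simp add: dist_norm)
    also have "\<dots> \<longleftrightarrow> z \<in> ray u \<union> ray w" unfolding rays using that by (auto simp: dist_norm)
    also have "\<dots> \<longleftrightarrow> z = 0 \<or> A z = 0 \<or> A z = t"
      using mem_ray_iff[OF u(1,1), of z] mem_ray_iff[OF u, of z] u t by (auto simp: A_def Arg2pi_of_real[of 1, simplified])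
    finally show ?thesis .
  qed
  define D1 where "D1 = (+) x ` {z. 0 < A z \<and> A z < t \<and> norm z < \<epsilon>}"
  define D2 where "D2 = (+) x ` {z. t < A z \<and> A z < 2 * pi \<and> norm z < \<epsilon>}"
  have con: "connected D1" "connected D2" unfolding D1_def D2_def A_def
    using connected_open_sector[OF u(1), of 0 t \<epsilon>] connected_open_sector[OF u(1), of t "2 * pi" \<epsilon>] t'
    by (auto intro!: connected_continuous_image continuous_intros)
  have off: "D1 \<subseteq> - P" "D2 \<subseteq> - P"
  proof -
    have "x + z \<notin> P" if "0 < A z" "A z \<noteq> t" "norm z < \<epsilon>" for z
    proof -
      have "z \<noteq> 0" using that(1) by (auto simp: A_def)
      then show ?thesis using mem[OF that(3)] that(1,2) by auto
    qed
    then show "D1 \<subseteq> - P" "D2 \<subseteq> - P" unfolding D1_def D2_def using t' by auto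
  qed
  have side: "D \<subseteq> I \<or> D \<subseteq> V" if "connected D" "D \<subseteq> - P" for D
  proof -
    have D: "D \<subseteq> I \<union> V" using that(2) cover by simp
    have "I \<inter> V \<inter> D = {}" using disj by simp
    from connectedD[OF that(1) op this D] show ?thesis using D by blast
  qed
  note side = side[OF con(1) off(1)] side[OF con(2) off(2)]
  have split: "z \<in> P \<or> z \<in> D1 \<or> z \<in> D2" if z: "z \<in> ball x \<epsilon>" for z
  proof -
    have n: "norm (z - x) < \<epsilon>" using z by (simp add: dist_norm norm_minus_commute)
    consider "A (z - x) = 0 \<or> A (z - x) = t" | "0 < A (z - x)" "A (z - x) < t" | "t < A (z - x)"
      using A(1)[of "z - x"] by linarith
    then show ?thesis
    proof cases
      case 1
      then show ?thesis using mem[OF n] by simp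
    next
      case 2
      then have "x + (z - x) \<in> D1" unfolding D1_def using n by blast
      then show ?thesis by simp
    next
      case 3
      then have "x + (z - x) \<in> D2" unfolding D2_def using n A(2) by blast
      then show ?thesis by simp
    qed
  qed
  have meet: "I \<inter> ball x \<epsilon> \<noteq> {}" "V \<inter> ball x \<epsilon> \<noteq> {}"
    using x fr \<epsilon> unfolding frontier_def closure_approachable
    by (metis (no_types, lifting) DiffD1 Int_iff closure_approachable dist_commute empty_iff mem_ball)+
  have notP: "I \<inter> P = {}" "V \<inter> P = {}" using cover by blast+
  have D12: "D1 \<subseteq> I \<and> D2 \<subseteq> V \<or> D1 \<subseteq> V \<and> D2 \<subseteq> I"
  proof -
    obtain i v where i: "i \<in> I" "i \<in> ball x \<epsilon>" and v: "v \<in> V" "v \<in> ball x \<epsilon>" using meet by blast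
    have "i \<in> D1 \<union> D2" using split[OF i(2)] i(1) notP(1) by blast
    moreover have "v \<in> D1 \<union> D2" using split[OF v(2)] v(1) notP(2) by blast
    ultimately show ?thesis using side i(1) v(1) disj by blast
  qed
  show ?thesis
  proof (cases "D1 \<subseteq> I \<and> D2 \<subseteq> V")
    case True
    have "z \<in> B \<longleftrightarrow> z \<in> (+) x ` (*) (sgn u) ` sector t" if z: "z \<in> ball x \<epsilon>" for z
    proof -
      have n: "norm (z - x) < \<epsilon>" using z by (simp add: dist_norm norm_minus_commute)
      have "z \<in> (+) x ` (*) (sgn u) ` sector t \<longleftrightarrow> z - x \<in> (*) (sgn u) ` sector t"
        by (rule mem_translation_iff)
      also have "\<dots> \<longleftrightarrow> A (z - x) \<le> t" unfolding A_def by (rule rotated_sector_angle[OF u(1) t'])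
      also have "\<dots> \<longleftrightarrow> z \<notin> D2"
        unfolding D2_def mem_translation_iff using n A(2)[of "z - x"] by auto
      also have "\<dots> \<longleftrightarrow> z \<in> B"
      proof -
        have "z \<notin> D2" if "z \<in> B"
          using that True disj notP unfolding B by blast
        moreover have "z \<in> B" if "z \<notin> D2" using that True split[OF z] unfolding B by blast
        ultimately show ?thesis by blast
      qed
      finally show ?thesis by simp
    qed
    moreover have "x + z \<in> B" if "0 < A z" "A z < t" "norm z < \<epsilon>" for z
      using that True unfolding B D1_def by blast
    ultimately show ?thesis unfolding A_def by blast
  next
    case False
    then have D: "D1 \<subseteq> V" "D2 \<subseteq> I" using D12 by blast+
    have "z \<in> B \<longleftrightarrow> z \<in> (+) x ` (*) (sgn w) ` sector (2 * pi - t)" if z: "z \<in> ball x \<epsilon>" for z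
    proof -
      have n: "norm (z - x) < \<epsilon>" using z by (simp add: dist_norm norm_minus_commute)
      have "z \<in> (+) x ` (*) (sgn w) ` sector (2 * pi - t) \<longleftrightarrow> z - x \<in> (*) (sgn w) ` sector (2 * pi - t)"
        by (rule mem_translation_iff)
      also have "\<dots> \<longleftrightarrow> A (z - x) = 0 \<or> t \<le> A (z - x)"
        unfolding A_def by (rule complementary_sector_angle[OF u t(1) t'(1)])
      also have "\<dots> \<longleftrightarrow> z \<notin> D1"
        unfolding D1_def mem_translation_iff using n A(1)[of "z - x"] by auto
      also have "\<dots> \<longleftrightarrow> z \<in> B"
      proof -
        have "z \<notin> D1" if "z \<in> B" using that D disj notP unfolding B by blast
        moreover have "z \<in> B" if "z \<notin> D1" using that D split[OF z] unfolding B by blast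
        ultimately show ?thesis by blast
      qed
      finally show ?thesis by simp
    qed
    moreover have "x + z \<notin> B" if "0 < A z" "A z < t" "norm z < \<epsilon>" for z
    proof -
      have "x + z \<in> D1" unfolding D1_def using that by blast
      then show ?thesis using D(1) disj notP unfolding B by blast
    qed
    ultimately show ?thesis unfolding A_def by blast
  qed
qed

lemma segment_ray:
  assumes "y \<noteq> x" "\<epsilon> \<le> dist x y"
  shows "closed_segment x y \<inter> ball x \<epsilon> = (+) x ` ray (y - x) \<inter> ball x \<epsilon>"
proof (intro equalityI subsetI)
  fix z assume z: "z \<in> closed_segment x y \<inter> ball x \<epsilon>"
  then obtain s where s: "0 \<le> s" "z = (1 - s) *\<^sub>R x + s *\<^sub>R y" by (auto simp: in_segment)
  have "z = x + of_real s * (y - x)" using s(2) by (simp add: scaleR_conv_of_real algebra_simps)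
  then show "z \<in> (+) x ` ray (y - x) \<inter> ball x \<epsilon>" using s(1) z unfolding ray_def by blast
next
  fix z assume z: "z \<in> (+) x ` ray (y - x) \<inter> ball x \<epsilon>"
  then obtain s where s: "0 \<le> s" "z = x + of_real s * (y - x)" unfolding ray_def by blast
  have "dist x z = s * dist x y" using s by (simp add: dist_norm norm_mult norm_minus_commute)
  moreover have "dist x z < \<epsilon>" using z by simp
  ultimately have "s * dist x y < 1 * dist x y" using assms(2) by linarith
  then have "s < 1" using assms(1) by (subst (asm) mult_less_cancel_right_pos) auto
  moreover have "z = (1 - s) *\<^sub>R x + s *\<^sub>R y" using s(2) by (simp add: scaleR_conv_of_real algebra_simps)
  ultimately show "z \<in> closed_segment x y \<inter> ball x \<epsilon>" using s(1) z by (auto simp: in_segment)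
qed

lemma two_segments_near:
  fixes x y z :: complex
  assumes P: "P = closed_segment x y \<union> closed_segment x z \<union> R" and yz: "y \<noteq> x" "z \<noteq> x"
    and R: "closed R" "x \<notin> R"
  obtains \<epsilon> where "0 < \<epsilon>" "P \<inter> ball x \<epsilon> = (+) x ` (ray (y - x) \<union> ray (z - x)) \<inter> ball x \<epsilon>"
proof -
  obtain d where d: "0 < d" "ball x d \<subseteq> - R"
    using R open_contains_ball[of "- R"] by auto
  define \<epsilon> where "\<epsilon> = Min {d, dist x y, dist x z}"
  have \<epsilon>: "0 < \<epsilon>" "\<epsilon> \<le> d" "\<epsilon> \<le> dist x y" "\<epsilon> \<le> dist x z" using d yz by (auto simp: \<epsilon>_def)
  have "R \<inter> ball x \<epsilon> = {}" using d(2) subset_ball[OF \<epsilon>(2), of x] by blast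
  then have "P \<inter> ball x \<epsilon> = (closed_segment x y \<inter> ball x \<epsilon>) \<union> (closed_segment x z \<inter> ball x \<epsilon>)"
    unfolding P by blast
  also have "\<dots> = (+) x ` (ray (y - x) \<union> ray (z - x)) \<inter> ball x \<epsilon>"
    unfolding segment_ray[OF yz(1) \<epsilon>(3)] segment_ray[OF yz(2) \<epsilon>(4)] by blast
  finally show thesis using that \<epsilon>(1) by blast
qed

section \<open>Simple polygons\<close>

text \<open>The first two equations are default values; polylines have at least two vertices.\<close>

fun polyline :: "complex list \<Rightarrow> real \<Rightarrow> complex" where
  "polyline [] = linepath 0 0"
| "polyline [a] = linepath a a"
| "polyline [a, b] = linepath a b"
| "polyline (a # b # c # ws) = linepath a b +++ polyline (b # c # ws)"

text \<open>The half-open edges of a simple polygon partition its boundary.\<close>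

definition half_open_segment :: "complex \<Rightarrow> complex \<Rightarrow> complex set" where
  "half_open_segment a b = closed_segment a b - {b}"

lemma polyline_ends: "ws \<noteq> [] \<Longrightarrow> pathstart (polyline ws) = hd ws \<and> pathfinish (polyline ws) = last ws"
  by (induction ws rule: polyline.induct) auto

lemma polyline_image:
  "2 \<le> length ws \<Longrightarrow> path_image (polyline ws) = (\<Union>i\<in>{i. Suc i < length ws}. closed_segment (ws ! i) (ws ! Suc i))"
proof (induction ws rule: polyline.induct)
  case (3 a b)
  have "{i. Suc i < length [a, b]} = {0}" by auto
  then show ?case by simp
next
  case (4 a b c ws)
  have idx: "{i. Suc i < length (a # b # c # ws)} = insert 0 (Suc ` {i. Suc i < length (b # c # ws)})"
    by (auto simp: image_iff) (metis Suc_less_eq not0_implies_Suc)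
  have "path_image (polyline (a # b # c # ws)) = closed_segment a b \<union> path_image (polyline (b # c # ws))"
    using polyline_ends[of "b # c # ws"] by (simp add: path_image_join)
  also have "path_image (polyline (b # c # ws)) =
      (\<Union>i\<in>{i. Suc i < length (b # c # ws)}. closed_segment ((b # c # ws) ! i) ((b # c # ws) ! Suc i))"
    by (rule 4(1)) simp
  finally show ?case unfolding idx by simp
qed simp_all

lemma polyline_image_half_open:
  assumes "2 \<le> length ws"
  shows "path_image (polyline ws) \<subseteq> (\<Union>i\<in>{i. Suc i < length ws}. half_open_segment (ws ! i) (ws ! Suc i)) \<union> {last ws}"
  using assms
proof (induction ws rule: polyline.induct)
  case (3 a b)
  have "{i. Suc i < length [a, b]} = {0}" by auto
  then show ?case by (auto simp: half_open_segment_def)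
next
  case (4 a b c ws)
  let ?H = "\<lambda>ws i. half_open_segment (ws ! i) (ws ! Suc i)"
  have IH: "path_image (polyline (b # c # ws)) \<subseteq>
      (\<Union>i\<in>{i. Suc i < length (b # c # ws)}. ?H (b # c # ws) i) \<union> {last (b # c # ws)}"
    by (rule 4(1)) simp
  have idx: "{i. Suc i < length (a # b # c # ws)} = insert 0 (Suc ` {i. Suc i < length (b # c # ws)})"
    by (auto simp: image_iff) (metis Suc_less_eq not0_implies_Suc)
  have "b \<in> path_image (polyline (b # c # ws))"
    using pathstart_in_path_image[of "polyline (b # c # ws)"] polyline_ends[of "b # c # ws"] by simp
  moreover have "path_image (polyline (a # b # c # ws)) = closed_segment a b \<union> path_image (polyline (b # c # ws))"
    using polyline_ends[of "b # c # ws"] by (simp add: path_image_join)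
  ultimately have "path_image (polyline (a # b # c # ws)) \<subseteq> half_open_segment a b \<union> path_image (polyline (b # c # ws))"
    by (auto simp: half_open_segment_def)
  also have "\<dots> \<subseteq> half_open_segment a b \<union> ((\<Union>i\<in>{i. Suc i < length (b # c # ws)}. ?H (b # c # ws) i) \<union> {last (b # c # ws)})"
    using IH by blast
  also have "\<dots> = (\<Union>i\<in>{i. Suc i < length (a # b # c # ws)}. ?H (a # b # c # ws) i) \<union> {last (a # b # c # ws)}"
    unfolding idx by simp
  finally show ?case .
qed simp_all

lemma arc_polyline:
  assumes "2 \<le> length ws" "\<And>i. Suc i < length ws \<Longrightarrow> ws ! i \<noteq> ws ! Suc i"
    and "\<And>i j. i < j \<Longrightarrow> Suc j < length ws \<Longrightarrow>
      half_open_segment (ws ! i) (ws ! Suc i) \<inter> half_open_segment (ws ! j) (ws ! Suc j) = {}"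
    and "\<And>i. Suc i < length ws \<Longrightarrow> last ws \<notin> half_open_segment (ws ! i) (ws ! Suc i)"
  shows "arc (polyline ws)"
  using assms
proof (induction ws rule: polyline.induct)
  case (3 a b)
  then show ?case using "3.prems"(2)[of 0] by (simp add: arc_linepath)
next
  case (4 a b c ws)
  let ?vs = "b # c # ws"
  have rest: "arc (polyline ?vs)"
  proof (rule "4.IH")
    fix i assume i: "Suc i < length ?vs"
    show "?vs ! i \<noteq> ?vs ! Suc i" using "4.prems"(2)[of "Suc i"] i by simp
    show "last ?vs \<notin> half_open_segment (?vs ! i) (?vs ! Suc i)" using "4.prems"(4)[of "Suc i"] i by simp
  next
    fix i j assume ij: "i < j" "Suc j < length ?vs"
    show "half_open_segment (?vs ! i) (?vs ! Suc i) \<inter> half_open_segment (?vs ! j) (?vs ! Suc j) = {}"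
      using "4.prems"(3)[of "Suc i" "Suc j"] ij by simp
  qed simp
  have "closed_segment a b \<inter> path_image (polyline ?vs) \<subseteq> {b}"
  proof
    fix z assume z: "z \<in> closed_segment a b \<inter> path_image (polyline ?vs)"
    show "z \<in> {b}"
    proof (rule ccontr)
      assume "z \<notin> {b}"
      then have zh: "z \<in> half_open_segment a b" using z by (simp add: half_open_segment_def)
      have "z \<in> (\<Union>i\<in>{i. Suc i < length ?vs}. half_open_segment (?vs ! i) (?vs ! Suc i)) \<union> {last ?vs}"
        using polyline_image_half_open[of ?vs] z by auto
      then consider i where "Suc i < length ?vs" "z \<in> half_open_segment (?vs ! i) (?vs ! Suc i)" | "z = last ?vs"
        by blast
      then show False
      proof cases
        case 1
        then show False using "4.prems"(3)[of 0 "Suc i"] zh by auto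
      next
        case 2
        then show False using "4.prems"(4)[of 0] zh by simp
      qed
    qed
  qed
  moreover have "a \<noteq> b" using "4.prems"(2)[of 0] by simp
  ultimately show ?case
    using rest polyline_ends[of ?vs] by (simp add: arc_join_eq arc_linepath)
qed simp_all

lemma polygon_closed_list:
  assumes "vs \<noteq> []" "i < length vs"
  shows "(vs @ [hd vs]) ! i = vs ! i" "(vs @ [hd vs]) ! Suc i = next_vertex vs i"
proof -
  show "(vs @ [hd vs]) ! i = vs ! i" using assms by (simp add: nth_append)
  show "(vs @ [hd vs]) ! Suc i = next_vertex vs i"
  proof (cases "Suc i < length vs")
    case True
    then show ?thesis by (simp add: next_vertex_def nth_append)
  next
    case False
    then have "Suc i = length vs" using assms by simp
    then show ?thesis using assms by (simp add: next_vertex_def nth_append hd_conv_nth)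
  qed
qed

text \<open>The boundary is the first edge followed by an arc through the other vertices back to the first one.\<close>

lemma simple_polygon_curve:
  assumes "simple_polygon vs"
  obtains c where "simple_path c" "pathfinish c = pathstart c" "path_image c = polygon_boundary vs"
proof -
  have n: "3 \<le> length vs" and ne: "\<And>i. i < length vs \<Longrightarrow> vs ! i \<noteq> next_vertex vs i"
    and disj: "\<And>i j. i < length vs \<Longrightarrow> j < length vs \<Longrightarrow> i \<noteq> j \<Longrightarrow>
      half_open_segment (vs ! i) (next_vertex vs i) \<inter> half_open_segment (vs ! j) (next_vertex vs j) = {}"
    using assms unfolding simple_polygon_def half_open_segment_def by auto
  have vs0: "vs \<noteq> []" using n by auto
  define us where "us = vs @ [hd vs]"
  have us: "us ! i = vs ! i" "us ! Suc i = next_vertex vs i" if "i < length vs" for i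
    using polygon_closed_list[OF vs0 that] by (simp_all add: us_def)
  have len: "length us = Suc (length vs)" by (simp add: us_def)
  obtain a b c ws where uvs: "us = a # b # c # ws"
    using n unfolding us_def by (metis Suc_le_length_iff append_Cons numeral_3_eq_3)
  have zero: "0 < length vs" using n by auto
  have a: "a = vs ! 0" and b: "b = next_vertex vs 0"
    using us[OF zero] uvs by simp_all
  let ?rs = "b # c # ws"
  have last: "last ?rs = a"
  proof -
    have "last ?rs = last us" by (simp add: uvs)
    also have "\<dots> = hd vs" by (simp add: us_def)
    finally show ?thesis using hd_conv_nth[OF vs0] a by simp
  qed
  have rs: "?rs ! i = vs ! Suc i" "?rs ! Suc i = next_vertex vs (Suc i)" if "Suc i < length ?rs" for i
  proof -
    have "Suc i < length vs" using that len uvs by simp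
    then show "?rs ! i = vs ! Suc i" "?rs ! Suc i = next_vertex vs (Suc i)"
      using us[of "Suc i"] uvs by simp_all
  qed
  have lrs: "length ?rs = length vs" using len uvs by simp
  have a_half: "a \<in> half_open_segment (vs ! 0) (next_vertex vs 0)"
    using ne[OF zero] by (simp add: half_open_segment_def a)
  have arc2: "arc (polyline ?rs)"
  proof (rule arc_polyline)
    fix i assume i: "Suc i < length ?rs"
    then have Si: "Suc i < length vs" unfolding lrs .
    show "?rs ! i \<noteq> ?rs ! Suc i" unfolding rs[OF i] by (rule ne[OF Si])
    show "last ?rs \<notin> half_open_segment (?rs ! i) (?rs ! Suc i)"
      unfolding last rs[OF i] using disj[OF Si zero nat.distinct(2)] a_half by blast
  next
    fix i j assume ij: "i < j" "Suc j < length ?rs"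
    then have i: "Suc i < length ?rs" by simp
    show "half_open_segment (?rs ! i) (?rs ! Suc i) \<inter> half_open_segment (?rs ! j) (?rs ! Suc j) = {}"
      unfolding rs[OF i] rs[OF ij(2)] using ij(1) i ij(2) unfolding lrs by (intro disj) simp_all
  qed simp
  define g where "g = linepath a b +++ polyline ?rs"
  have g: "g = polyline us" unfolding g_def uvs by simp
  have ends: "pathstart (polyline ?rs) = b" "pathfinish (polyline ?rs) = a"
    using polyline_ends[of ?rs] last by auto
  have "closed_segment a b \<inter> path_image (polyline ?rs) \<subseteq> {a, b}"
  proof
    fix z assume z: "z \<in> closed_segment a b \<inter> path_image (polyline ?rs)"
    show "z \<in> {a, b}"
    proof (rule ccontr)
      assume nz: "z \<notin> {a, b}"
      then have zh: "z \<in> half_open_segment (vs ! 0) (next_vertex vs 0)"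
        using z a b by (simp add: half_open_segment_def)
      have "z \<in> (\<Union>i\<in>{i. Suc i < length ?rs}. half_open_segment (?rs ! i) (?rs ! Suc i)) \<union> {last ?rs}"
        using polyline_image_half_open[of ?rs] z by auto
      then obtain i where i: "Suc i < length ?rs" "z \<in> half_open_segment (?rs ! i) (?rs ! Suc i)"
        using nz last by auto
      have Si: "Suc i < length vs" using i(1) unfolding lrs .
      show False using i(2) zh disj[OF Si zero nat.distinct(2)] unfolding rs[OF i(1)] by blast
    qed
  qed
  moreover have "a \<noteq> b" using ne[OF zero] a b by simp
  ultimately have "simple_path g"
    unfolding g_def using arc2 ends by (subst simple_path_join_loop_eq) (auto simp: arc_linepath)
  moreover have "pathfinish g = pathstart g" using ends by (simp add: g_def)
  moreover have "path_image g = polygon_boundary vs"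
  proof -
    have "path_image g = (\<Union>i\<in>{i. Suc i < length us}. closed_segment (us ! i) (us ! Suc i))"
      unfolding g by (rule polyline_image) (use n len in simp)
    also have "\<dots> = (\<Union>i<length vs. closed_segment (vs ! i) (next_vertex vs i))"
      using us len by (intro SUP_cong) auto
    finally show ?thesis by (simp add: polygon_boundary_def)
  qed
  ultimately show thesis using that by blast
qed

lemma polygon_jordan:
  assumes "simple_polygon vs"
  defines "P \<equiv> polygon_boundary vs"
  shows "open (inside P)" "open (outside P)" "inside P \<inter> outside P = {}" "inside P \<union> outside P = - P"
    "frontier (inside P) = P" "frontier (outside P) = P" "bounded (inside P)" "compact P"
proof -
  obtain c where c: "simple_path c" "pathfinish c = pathstart c" "path_image c = P"
    using simple_polygon_curve[OF assms(1)] unfolding P_def by metis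
  note J = Jordan_inside_outside[OF c(1,2), unfolded c(3)]
  show "open (inside P)" "open (outside P)" "inside P \<inter> outside P = {}" "inside P \<union> outside P = - P"
    "frontier (inside P) = P" "frontier (outside P) = P" "bounded (inside P)" using J by auto
  show "compact P" using c(3) compact_simple_path_image[OF c(1)] by simp
qed

lemma polygon_region_compact:
  assumes "simple_polygon vs" shows "compact (polygon_region vs)"
proof -
  note J = polygon_jordan[OF assms]
  have "polygon_region vs = - outside (polygon_boundary vs)"
    unfolding polygon_region_def using J(3,4) by blast
  then have "closed (polygon_region vs)" using J(2) by (simp add: closed_def)
  moreover have "bounded (polygon_region vs)"
    unfolding polygon_region_def using J(7,8) by (simp add: compact_imp_bounded)
  ultimately show ?thesis by (simp add: compact_eq_bounded_closed)
qed

lemma polygon_region_interior: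
  assumes "simple_polygon vs"
  shows "interior (polygon_region vs) = inside (polygon_boundary vs)"
    and "frontier (polygon_region vs) = polygon_boundary vs"
proof -
  note J = polygon_jordan[OF assms]
  let ?P = "polygon_boundary vs"
  have eq: "polygon_region vs = - outside ?P"
    unfolding polygon_region_def using J(3,4) by blast
  have fr: "frontier (polygon_region vs) = ?P"
    unfolding eq frontier_complement by (rule J(6))
  then show "frontier (polygon_region vs) = ?P" .
  have disj: "inside ?P \<inter> ?P = {}" using J(4) by blast
  have "interior (polygon_region vs) = polygon_region vs - frontier (polygon_region vs)"
    using interior_subset[of "polygon_region vs"] closure_subset[of "polygon_region vs"]
    by (auto simp: frontier_def)
  also have "\<dots> = (?P \<union> inside ?P) - ?P" unfolding fr unfolding polygon_region_def ..
  also have "\<dots> = inside ?P" using disj by blast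
  finally show "interior (polygon_region vs) = inside ?P" .
qed

lemma polygon_edges:
  assumes "simple_polygon vs"
  shows "3 \<le> length vs" "\<And>i. i < length vs \<Longrightarrow> vs ! i \<noteq> next_vertex vs i"
    "\<And>i j z. i < length vs \<Longrightarrow> j < length vs \<Longrightarrow> z \<in> closed_segment (vs ! i) (next_vertex vs i) \<Longrightarrow> z \<noteq> next_vertex vs i \<Longrightarrow>
      z \<in> closed_segment (vs ! j) (next_vertex vs j) \<Longrightarrow> z \<noteq> next_vertex vs j \<Longrightarrow> i = j"
proof -
  show "3 \<le> length vs" "\<And>i. i < length vs \<Longrightarrow> vs ! i \<noteq> next_vertex vs i"
    using assms unfolding simple_polygon_def by simp_all
  fix i j z
  assume i: "i < length vs" "z \<in> closed_segment (vs ! i) (next_vertex vs i)" "z \<noteq> next_vertex vs i"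
    and j: "j < length vs" "z \<in> closed_segment (vs ! j) (next_vertex vs j)" "z \<noteq> next_vertex vs j"
  show "i = j"
  proof (rule ccontr)
    assume "i \<noteq> j"
    then have "(closed_segment (vs ! i) (next_vertex vs i) - {next_vertex vs i}) \<inter>
        (closed_segment (vs ! j) (next_vertex vs j) - {next_vertex vs j}) = {}"
      using assms i(1) j(1) unfolding simple_polygon_def by simp
    then show False using i(2,3) j(2,3) by blast
  qed
qed

lemma closed_other_edges: "closed (\<Union>j\<in>{j. j < length vs \<and> Q j}. closed_segment (vs ! j) (next_vertex vs j))"
  by (intro closed_UN) auto

lemma prev_index:
  assumes "3 \<le> length vs" "i < length vs"
  defines "k \<equiv> (i + length vs - 1) mod length vs"
  shows "k < length vs" "k \<noteq> i" "next_vertex vs k = vs ! i" "prev_vertex vs i = vs ! k"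
    "\<And>j. j < length vs \<Longrightarrow> (j + 1) mod length vs = i \<Longrightarrow> j = k"
proof -
  have cases: "k = (if i = 0 then length vs - 1 else i - 1)"
  proof (cases "i = 0")
    case True
    then show ?thesis using assms(1) unfolding k_def by simp
  next
    case False
    then have e: "i + length vs - 1 = (i - 1) + length vs" by simp
    have "k = (i - 1) mod length vs" unfolding k_def e by (rule mod_add_self2)
    then show ?thesis using False assms(2) by simp
  qed
  show "k < length vs" "k \<noteq> i" using cases assms(1,2) by auto
  have "(k + 1) mod length vs = i" using cases assms(1,2) by auto
  then show "next_vertex vs k = vs ! i" by (simp add: next_vertex_def)
  show "prev_vertex vs i = vs ! k" by (simp add: prev_vertex_def k_def)
  show "j = k" if "j < length vs" "(j + 1) mod length vs = i" for j
    using that cases assms(1,2) by (cases "j + 1 = length vs") auto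
qed

text \<open>At an inner point of an edge the two rays are opposite, so both alternatives of \<open>jordan_two_rays\<close> give a
  half plane.\<close>

lemma polygon_local_edge:
  assumes S: "simple_polygon vs" and x: "x \<in> polygon_boundary vs" "x \<notin> set vs"
  shows "\<exists>\<epsilon>>0. \<exists>\<phi>. polygon_region vs \<inter> ball x \<epsilon> = (+) x ` (*) (cis \<phi>) ` sector pi \<inter> ball x \<epsilon>"
proof -
  let ?P = "polygon_boundary vs"
  note J = polygon_jordan[OF S] and E = polygon_edges[OF S]
  obtain i where i: "i < length vs" "x \<in> closed_segment (vs ! i) (next_vertex vs i)"
    using x(1) unfolding polygon_boundary_def by blast
  have nv: "next_vertex vs j \<in> set vs" if "j < length vs" for j
  proof -
    have "(j + 1) mod length vs < length vs" using that by (intro mod_less_divisor) auto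
    then show ?thesis unfolding next_vertex_def by simp
  qed
  let ?a = "vs ! i" and ?b = "next_vertex vs i"
  have ab: "?a \<noteq> x" "?b \<noteq> x" using x(2) i nv by auto
  define R where "R = (\<Union>j\<in>{j. j < length vs \<and> j \<noteq> i}. closed_segment (vs ! j) (next_vertex vs j))"
  have R: "closed R" unfolding R_def by (rule closed_other_edges)
  have xR: "x \<notin> R"
  proof
    assume "x \<in> R"
    then obtain j where j: "j < length vs" "j \<noteq> i" "x \<in> closed_segment (vs ! j) (next_vertex vs j)"
      unfolding R_def by blast
    have "x \<noteq> next_vertex vs j" using nv[OF j(1)] x(2) by blast
    then show False using E(3)[OF i(1) j(1) i(2) ab(2)[symmetric] j(3)] j(2) by blast
  qed
  have "?P = closed_segment ?a ?b \<union> R" unfolding polygon_boundary_def R_def using i(1) by blast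
  also have "closed_segment ?a ?b = closed_segment x ?b \<union> closed_segment x ?a"
    using Un_closed_segment[OF i(2)] by (simp add: closed_segment_commute Un_commute)
  finally have P: "?P = closed_segment x ?b \<union> closed_segment x ?a \<union> R" .
  obtain \<epsilon> where \<epsilon>: "0 < \<epsilon>" "?P \<inter> ball x \<epsilon> = (+) x ` (ray (?b - x) \<union> ray (?a - x)) \<inter> ball x \<epsilon>"
    by (rule two_segments_near[OF P ab(2,1) R xR])
  define u w where "u = ?b - x" and "w = ?a - x"
  have uw: "u \<noteq> 0" "w \<noteq> 0" using ab by (auto simp: u_def w_def)
  obtain s where s: "0 \<le> s" "s \<le> 1" "x = (1 - s) *\<^sub>R ?a + s *\<^sub>R ?b" using i(2) by (auto simp: in_segment)
  have "s \<noteq> 0" "s \<noteq> 1" using s(3) ab by auto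
  then have s': "0 < s" "s < 1" using s by auto
  have 1: "u = of_real (1 - s) * (?b - ?a)" "w = of_real (- s) * (?b - ?a)"
    unfolding u_def w_def using s(3) by (simp_all add: scaleR_conv_of_real algebra_simps)
  have "w / u = of_real (- (s / (1 - s)))"
    using uw(1) s' unfolding 1 by (simp add: field_simps)
  moreover have "- (s / (1 - s)) < 0" using s' by simp
  ultimately have t: "Arg2pi (w / u) = pi" by (simp only: Arg2pi_of_real if_True)
  have alt: "polygon_region vs \<inter> ball x \<epsilon> = (+) x ` (*) (sgn u) ` sector pi \<inter> ball x \<epsilon> \<or>
    polygon_region vs \<inter> ball x \<epsilon> = (+) x ` (*) (sgn w) ` sector (2 * pi - pi) \<inter> ball x \<epsilon>"
    using jordan_two_rays[OF J(1,2,3,4,5,6) x(1) polygon_region_def \<epsilon>(1) uw t[symmetric] pi_neq_zero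
      \<epsilon>(2)[folded u_def w_def]] by blast
  obtain \<phi> \<phi>' where \<phi>: "sgn u = cis \<phi>" "sgn w = cis \<phi>'"
    using sgn_eq_cis[OF uw(1)] sgn_eq_cis[OF uw(2)] by blast
  have "2 * pi - pi = pi" by simp
  then show ?thesis using alt \<epsilon>(1) unfolding \<phi> by metis
qed

text \<open>The two edges at a vertex leave it in different directions, since they have no other point in common.  The
  bisecting ray in the definition of the interior angle lies in the first sector of \<open>jordan_two_rays\<close>, so
  the definition picks the angle of the sector that lies inside.\<close>

lemma polygon_local_vertex:
  assumes S: "simple_polygon vs" and i: "i < length vs"
  shows "\<exists>\<epsilon>>0. \<exists>\<phi>. polygon_region vs \<inter> ball (vs ! i) \<epsilon>
      = (+) (vs ! i) ` (*) (cis \<phi>) ` sector (interior_angle vs i) \<inter> ball (vs ! i) \<epsilon>"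
    and "0 < interior_angle vs i" "interior_angle vs i < 2 * pi"
proof -
  let ?P = "polygon_boundary vs"
  note J = polygon_jordan[OF S] and E = polygon_edges[OF S]
  define x where "x = vs ! i"
  define k where "k = (i + length vs - 1) mod length vs"
  note K = prev_index[OF E(1) i, folded k_def]
  define b a where "b = next_vertex vs i" and "a = prev_vertex vs i"
  have bx: "b \<noteq> x" using E(2)[OF i] by (simp add: b_def x_def)
  have ax: "a \<noteq> x" using E(2)[OF K(1)] K(3,4) by (simp add: a_def x_def)
  have xi: "x \<in> closed_segment (vs ! i) (next_vertex vs i)" "x \<noteq> next_vertex vs i"
    using bx by (auto simp: x_def b_def)
  define R where "R = (\<Union>j\<in>{j. j < length vs \<and> j \<noteq> i \<and> j \<noteq> k}. closed_segment (vs ! j) (next_vertex vs j))"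
  have R: "closed R" unfolding R_def by (rule closed_other_edges)
  have xR: "x \<notin> R"
  proof
    assume "x \<in> R"
    then obtain j where j: "j < length vs" "j \<noteq> i" "j \<noteq> k" "x \<in> closed_segment (vs ! j) (next_vertex vs j)"
      unfolding R_def by blast
    have xj: "x = next_vertex vs j"
      using E(3)[OF i j(1) xi j(4)] j(2) by blast
    define l where "l = (j + 1) mod length vs"
    have l: "l < length vs" unfolding l_def using i by (intro mod_less_divisor) auto
    have "x = vs ! l" using xj by (simp add: next_vertex_def l_def)
    then have "x \<in> closed_segment (vs ! l) (next_vertex vs l)" "x \<noteq> next_vertex vs l" using E(2)[OF l] by auto
    then have "i = l" by (rule E(3)[OF i l xi])
    then show False using K(5)[OF j(1)] j(3) by (simp add: l_def)
  qed
  have "?P = closed_segment (vs ! i) (next_vertex vs i) \<union> closed_segment (vs ! k) (next_vertex vs k) \<union> R"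
    unfolding polygon_boundary_def R_def using i K(1) by blast
  then have P: "?P = closed_segment x b \<union> closed_segment x a \<union> R"
    using K(3,4) by (simp add: x_def a_def b_def closed_segment_commute)
  obtain \<epsilon> where \<epsilon>: "0 < \<epsilon>" "?P \<inter> ball x \<epsilon> = (+) x ` (ray (b - x) \<union> ray (a - x)) \<inter> ball x \<epsilon>"
    by (rule two_segments_near[OF P bx ax R xR])
  define u w where "u = b - x" and "w = a - x"
  have uw: "u \<noteq> 0" "w \<noteq> 0" using bx ax by (auto simp: u_def w_def)
  define t where "t = Arg2pi (w / u)"
  have t0: "t \<noteq> 0"
  proof
    assume "t = 0"
    then have "Arg2pi (w / u) = Arg2pi (u / u)" using uw by (simp add: t_def Arg2pi_of_real[of 1, simplified])
    then have "w \<in> ray u" using mem_ray_iff[OF uw(1,1)] by blast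
    then obtain c where c: "0 \<le> c" "w = of_real c * u" unfolding ray_def by blast
    have c0: "0 < c" using c uw(2) by (cases "c = 0") auto
    \<comment> \<open>Chosen such that \<open>y\<close> below is different from \<open>x\<close> and lies on both edges.\<close>
    define s where "s = min c 1 / 2"
    have s: "0 < s" "s < 1" "0 < s / c" "s / c \<le> 1" using c0 by (auto simp: s_def min_def field_simps)
    define y where "y = x + of_real s * u"
    have y1: "y = (1 - s) *\<^sub>R x + s *\<^sub>R b" by (simp add: y_def u_def scaleR_conv_of_real algebra_simps)
    define r where "r = s / c"
    have "y = x + of_real r * w" using c0 by (simp add: y_def c(2) r_def)
    then have y2: "y = (1 - r) *\<^sub>R x + r *\<^sub>R a" by (simp add: w_def scaleR_conv_of_real algebra_simps)
    have "y \<in> closed_segment x b" unfolding in_segment using y1 s by (intro exI[of _ s]) simp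
    moreover have "y \<noteq> b"
    proof
      assume "y = b"
      then have "of_real (1 - s) * u = 0" by (simp add: y_def u_def algebra_simps)
      then show False using s uw(1) by simp
    qed
    moreover have "y \<in> closed_segment x a" unfolding in_segment using y2 s by (intro exI[of _ r]) (simp add: r_def)
    moreover have "y \<noteq> x" using s uw(1) by (simp add: y_def)
    ultimately have "i = k"
      using E(3)[OF i K(1), of y] K(3,4) by (simp add: x_def a_def b_def closed_segment_commute)
    then show False using K(2) by simp
  qed
  have t2: "0 < t" "t < 2 * pi" using t0 Arg2pi_ge_0[of "w / u"] Arg2pi_lt_2pi[of "w / u"] by (auto simp: t_def)
  have angle: "interior_angle vs i =
    (if \<forall>\<^sub>F \<epsilon> in at_right 0. x + of_real \<epsilon> * u * cis (t / 2) \<in> polygon_region vs then t else 2 * pi - t)"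
    unfolding interior_angle_def Let_def t_def u_def w_def x_def a_def b_def ..
  have xP: "x \<in> ?P" unfolding P by simp
  have small: "\<forall>\<^sub>F e in at_right 0. 0 < Arg2pi (of_real e * u * cis (t / 2) / u) \<and>
      Arg2pi (of_real e * u * cis (t / 2) / u) < t \<and> norm (of_real e * u * cis (t / 2)) < \<epsilon>"
    unfolding eventually_at_right_field
  proof (intro exI[of _ "\<epsilon> / norm u"] conjI allI impI)
    show "0 < \<epsilon> / norm u" using \<epsilon>(1) uw by simp
    fix e :: real assume e: "0 < e" "e < \<epsilon> / norm u"
    have "of_real e * u * cis (t / 2) / u = of_real e * cis (t / 2)" using uw by simp
    then have "Arg2pi (of_real e * u * cis (t / 2) / u) = t / 2"
      using Arg2pi_polar[of e "t / 2"] e t2 by simp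
    then show "0 < Arg2pi (of_real e * u * cis (t / 2) / u)" "Arg2pi (of_real e * u * cis (t / 2) / u) < t"
      using t2 by auto
    show "norm (of_real e * u * cis (t / 2)) < \<epsilon>" using e uw by (simp add: norm_mult field_simps)
  qed
  show "0 < interior_angle vs i" "interior_angle vs i < 2 * pi" unfolding angle using t2 by auto
  consider (convex) "polygon_region vs \<inter> ball x \<epsilon> = (+) x ` (*) (sgn u) ` sector t \<inter> ball x \<epsilon>"
      "\<forall>z. 0 < Arg2pi (z / u) \<and> Arg2pi (z / u) < t \<and> norm z < \<epsilon> \<longrightarrow> x + z \<in> polygon_region vs"
    | (reflex) "polygon_region vs \<inter> ball x \<epsilon> = (+) x ` (*) (sgn w) ` sector (2 * pi - t) \<inter> ball x \<epsilon>"
      "\<forall>z. 0 < Arg2pi (z / u) \<and> Arg2pi (z / u) < t \<and> norm z < \<epsilon> \<longrightarrow> x + z \<notin> polygon_region vs"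
    using jordan_two_rays[OF J(1,2,3,4,5,6) xP polygon_region_def \<epsilon>(1) uw t_def t0
      \<epsilon>(2)[folded u_def w_def]] by blast
  then have "\<exists>\<phi>. polygon_region vs \<inter> ball x \<epsilon> = (+) x ` (*) (cis \<phi>) ` sector (interior_angle vs i) \<inter> ball x \<epsilon>"
  proof cases
    case convex
    have "\<forall>\<^sub>F e in at_right 0. x + of_real e * u * cis (t / 2) \<in> polygon_region vs"
      using small by (rule eventually_mono) (use convex(2) in blast)
    then have "interior_angle vs i = t" by (simp add: angle)
    then show ?thesis using convex(1) sgn_eq_cis[OF uw(1)] by metis
  next
    case reflex
    have "\<forall>\<^sub>F e in at_right 0. x + of_real e * u * cis (t / 2) \<notin> polygon_region vs"
      using small by (rule eventually_mono) (use reflex(2) in blast)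
    note outside = this
    have "\<not> (\<forall>\<^sub>F e in at_right 0. x + of_real e * u * cis (t / 2) \<in> polygon_region vs)"
    proof
      assume "\<forall>\<^sub>F e in at_right 0. x + of_real e * u * cis (t / 2) \<in> polygon_region vs"
      with outside have "\<forall>\<^sub>F e in at_right (0::real). False" by eventually_elim simp
      then show False by simp
    qed
    then have "interior_angle vs i = 2 * pi - t" by (simp add: angle)
    then show ?thesis using reflex(1) sgn_eq_cis[OF uw(2)] by metis
  qed
  then show "\<exists>\<epsilon>>0. \<exists>\<phi>. polygon_region vs \<inter> ball (vs ! i) \<epsilon>
      = (+) (vs ! i) ` (*) (cis \<phi>) ` sector (interior_angle vs i) \<inter> ball (vs ! i) \<epsilon>"
    using \<epsilon>(1) unfolding x_def by blast
qed

lemma polygon_locally_conical: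
  assumes S: "simple_polygon vs" and x: "x \<in> polygon_region vs"
  shows "\<exists>\<epsilon>>0. \<exists>N. conical N \<and> polygon_region vs \<inter> ball x \<epsilon> = (+) x ` N \<inter> ball x \<epsilon>"
proof -
  consider "x \<in> inside (polygon_boundary vs)" | "x \<in> polygon_boundary vs" "x \<notin> set vs" | "x \<in> set vs"
    using x unfolding polygon_region_def by blast
  then show ?thesis
  proof cases
    case 1
    obtain \<epsilon> where \<epsilon>: "0 < \<epsilon>" "ball x \<epsilon> \<subseteq> inside (polygon_boundary vs)"
      using polygon_jordan(1)[OF S] 1 open_contains_ball by blast
    have "conical UNIV" using conical_rotated_sector[of "2 * pi" 0] by (simp add: sector_2pi)
    moreover have "polygon_region vs \<inter> ball x \<epsilon> = (+) x ` UNIV \<inter> ball x \<epsilon>"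
      using \<epsilon>(2) unfolding polygon_region_def by (auto simp: mem_translation_iff)
    ultimately show ?thesis using \<epsilon>(1) by blast
  next
    case 2
    then show ?thesis using polygon_local_edge[OF S 2] conical_rotated_sector[of pi] by fastforce
  next
    case 3
    then obtain i where i: "i < length vs" "x = vs ! i" by (auto simp: in_set_conv_nth)
    have "conical ((*) (cis \<phi>) ` sector (interior_angle vs i))" for \<phi>
      using polygon_local_vertex(2,3)[OF S i(1)] by (intro conical_rotated_sector) auto
    then show ?thesis unfolding i(2) using polygon_local_vertex(1)[OF S i(1)] by blast
  qed
qed

section \<open>Comparison of the polygon with the cone\<close>

text \<open>Isoperimetric among the regions inside a ball.  This notion depends only on the cone \<open>C\<close>, and it links
  \<open>B\<close> and \<open>M\<close>.\<close>

definition isoperimetric_within :: "real \<Rightarrow> complex set \<Rightarrow> real \<Rightarrow> real \<Rightarrow> complex set \<Rightarrow> bool" where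
  "isoperimetric_within p C \<rho> A E \<longleftrightarrow> region C E \<and> E \<subseteq> ball 0 \<rho> \<and> weighted_area p E = ennreal A \<and>
     (\<forall>F. region C F \<longrightarrow> F \<subseteq> ball 0 \<rho> \<longrightarrow> weighted_area p F = ennreal A \<longrightarrow>
        weighted_perimeter p C E \<le> weighted_perimeter p C F)"

text \<open>If a minimizer among the regions inside the ball were beaten by some region \<open>F\<close>, then \<open>F\<close> would satisfy the
  hypothesis of \<open>localization\<close> and lie in the ball itself.\<close>

lemma isoperimetric_iff_within:
  assumes p: "0 < p" and \<rho>: "0 < \<rho>" and C: "conical C" and eq: "N \<inter> ball 0 \<rho> = C \<inter> ball 0 \<rho>"
    and N: "closed N" "tiled N N"
  obtains Astar where "0 < Astar"
    "\<And>A E. 0 < A \<Longrightarrow> A < Astar \<Longrightarrow> isoperimetric p N A E \<longleftrightarrow> isoperimetric_within p C \<rho> A E"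
proof -
  have cone: "\<forall>c>0. (*) (complex_of_real c) ` C = C" using conical_scale[OF C] by blast
  have "interior N \<inter> ball 0 \<rho> = interior C \<inter> ball 0 \<rho>"
    using interior_Int[of N "ball 0 \<rho>"] interior_Int[of C "ball 0 \<rho>"] eq by (simp add: interior_open)
  then have int: "interior N \<inter> ball 0 \<rho> \<noteq> {}" using conical_interior_near_origin[OF C \<rho>] by simp
  have ext: "exterior_isoperimetric p N (\<rho> / 8)"
    using \<rho> by (intro tiled_exterior_isoperimetric N p) simp
  obtain Astar where Astar: "0 < Astar" and local:
    "\<And>A F. 0 < A \<Longrightarrow> A < Astar \<Longrightarrow> region N F \<Longrightarrow> weighted_area p F = ennreal A \<Longrightarrow>
       (\<And>G. region N G \<Longrightarrow> G \<subseteq> ball 0 \<rho> \<Longrightarrow> weighted_area p G = ennreal A \<Longrightarrow>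
          weighted_perimeter p N F \<le> weighted_perimeter p N G) \<Longrightarrow> F \<subseteq> ball 0 \<rho>"
    using localization[OF p \<rho> eq cone N(1) tiled_frontier_null[OF N(2,1)] int ext] by metis
  have per: "weighted_perimeter p N X = weighted_perimeter p C X" if "region N X" "X \<subseteq> ball 0 \<rho>" for X
    by (rule weighted_perimeter_local[OF eq region_closed[OF that(1)] that(2)])
  show thesis
  proof (rule that[OF Astar])
    fix A E assume A: "0 < A" "A < Astar"
    show "isoperimetric p N A E \<longleftrightarrow> isoperimetric_within p C \<rho> A E"
    proof
      assume iso: "isoperimetric p N A E"
      then have E: "region N E" "weighted_area p E = ennreal A"
        and least: "\<And>F. region N F \<Longrightarrow> weighted_area p F = ennreal A \<Longrightarrow> weighted_perimeter p N E \<le> weighted_perimeter p N F"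
        unfolding isoperimetric_def by blast+
      have Eb: "E \<subseteq> ball 0 \<rho>" using local[OF A E] least by blast
      show "isoperimetric_within p C \<rho> A E" unfolding isoperimetric_within_def
      proof (intro conjI allI impI)
        show "region C E" using E(1) region_local[OF eq Eb] by simp
        fix F assume F: "region C F" "F \<subseteq> ball 0 \<rho>" "weighted_area p F = ennreal A"
        have "region N F" using F(1) region_local[OF eq F(2)] by simp
        then show "weighted_perimeter p C E \<le> weighted_perimeter p C F"
          using least[of F] F per[of E] per[of F] E(1) Eb by simp
      qed fact+
    next
      assume "isoperimetric_within p C \<rho> A E"
      then have E: "region C E" "E \<subseteq> ball 0 \<rho>" "weighted_area p E = ennreal A"
        and least: "\<And>F. region C F \<Longrightarrow> F \<subseteq> ball 0 \<rho> \<Longrightarrow> weighted_area p F = ennreal A \<Longrightarrow>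
          weighted_perimeter p C E \<le> weighted_perimeter p C F"
        unfolding isoperimetric_within_def by blast+
      have EN: "region N E" using E(1) region_local[OF eq E(2)] by simp
      have leastN: "weighted_perimeter p N E \<le> weighted_perimeter p N G"
        if G: "region N G" "G \<subseteq> ball 0 \<rho>" "weighted_area p G = ennreal A" for G
        using least[of G] region_local[OF eq G(2)] G per[of G] per[of E] EN E(2) by simp
      show "isoperimetric p N A E" unfolding isoperimetric_def
      proof (intro conjI allI impI)
        fix F assume F: "region N F \<and> weighted_area p F = ennreal A"
        show "weighted_perimeter p N E \<le> weighted_perimeter p N F"
        proof (rule ccontr)
          assume "\<not> ?thesis"
          then have less: "weighted_perimeter p N F < weighted_perimeter p N E" by simp
          have "F \<subseteq> ball 0 \<rho>"
          proof (rule local[OF A])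
            show "region N F" "weighted_area p F = ennreal A" using F by auto
            fix G assume "region N G" "G \<subseteq> ball 0 \<rho>" "weighted_area p G = ennreal A"
            then have "weighted_perimeter p N E \<le> weighted_perimeter p N G" by (rule leastN)
            then show "weighted_perimeter p N F \<le> weighted_perimeter p N G" using less by simp
          qed
          then show False using leastN[of F] F less by simp
        qed
      qed (use EN E in auto)
    qed
  qed
qed

text \<open>The three cases for \<open>M\<close> are sectors of angle \<open>2 * pi\<close>, \<open>pi\<close> and the interior angle.\<close>

lemma polygon_near_origin:
  assumes polygon: "simple_polygon vs" and B: "B = polygon_region vs" and origin: "0 \<in> B"
    and plane: "0 \<in> interior B \<Longrightarrow> M = UNIV"
    and half_plane: "0 \<in> frontier B \<Longrightarrow> 0 \<notin> set vs \<Longrightarrow> M = half_plane"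
    and sector: "\<And>i. i < length vs \<Longrightarrow> vs ! i = 0 \<Longrightarrow> M = sector (interior_angle vs i)"
  obtains \<phi> \<theta> \<rho> where "0 < \<rho>" "0 < \<theta>" "\<theta> \<le> 2 * pi" "M = sector \<theta>"
    "B \<inter> ball 0 \<rho> = (*) (cis \<phi>) ` M \<inter> ball 0 \<rho>"
proof -
  have zero: "(+) (0::complex) ` X = X" for X by simp
  consider "0 \<in> inside (polygon_boundary vs)" | "0 \<in> polygon_boundary vs" "0 \<notin> set vs" | "0 \<in> set vs"
    using origin unfolding B polygon_region_def by blast
  then show thesis
  proof cases
    case 1
    obtain \<rho> where \<rho>: "0 < \<rho>" "ball 0 \<rho> \<subseteq> inside (polygon_boundary vs)"
      using polygon_jordan(1)[OF polygon] 1 open_contains_ball by blast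
    have M: "M = sector (2 * pi)"
      using plane 1 polygon_region_interior(1)[OF polygon] by (simp add: B sector_2pi)
    have "B \<inter> ball 0 \<rho> = (*) (cis 0) ` M \<inter> ball 0 \<rho>"
      using \<rho>(2) unfolding B M sector_2pi polygon_region_def by auto
    then show thesis using that[of \<rho> "2 * pi" 0] \<rho>(1) M by simp
  next
    case 2
    have M: "M = sector pi"
      using half_plane 2 polygon_region_interior(2)[OF polygon] by (simp add: B sector_pi)
    obtain \<rho> \<phi> where "0 < \<rho>" "B \<inter> ball 0 \<rho> = (*) (cis \<phi>) ` M \<inter> ball 0 \<rho>"
      using polygon_local_edge[OF polygon 2] unfolding B M zero by blast
    then show thesis using that[of \<rho> pi \<phi>] M by simp
  next
    case 3
    then obtain i where i: "i < length vs" "vs ! i = 0" by (auto simp: in_set_conv_nth)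
    have M: "M = sector (interior_angle vs i)" by (rule sector[OF i])
    obtain \<rho> \<phi> where "0 < \<rho>" "B \<inter> ball 0 \<rho> = (*) (cis \<phi>) ` M \<inter> ball 0 \<rho>"
      using polygon_local_vertex(1)[OF polygon i(1)] unfolding B M i(2) zero by blast
    then show thesis using that[of \<rho> "interior_angle vs i" \<phi>] M polygon_local_vertex(2,3)[OF polygon i(1)] by simp
  qed
qed

lemma rotate_ball:
  fixes c :: complex
  assumes "norm c = 1" shows "(*) c ` (S \<inter> ball 0 \<rho>) = (*) c ` S \<inter> ball 0 \<rho>"
  using assms by (auto simp: norm_mult)

theorem theorem4p20:
  fixes vs :: "complex list" and B M :: "complex set" and p :: real
  assumes polygon: "simple_polygon vs" and B: "B = polygon_region vs"
    and origin: "0 \<in> B" and p: "0 < p"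
    and plane: "0 \<in> interior B \<Longrightarrow> M = UNIV"
    and half_plane: "0 \<in> frontier B \<Longrightarrow> 0 \<notin> set vs \<Longrightarrow> M = half_plane"
    and sector: "\<And>i. i < length vs \<Longrightarrow> vs ! i = 0 \<Longrightarrow> M = sector (interior_angle vs i)"
  shows "\<exists>\<phi> \<rho>. 0 < \<rho> \<and> (\<lambda>z. cis \<phi> * z) ` (M \<inter> ball 0 \<rho>) = B \<inter> ball 0 \<rho> \<and>
    (\<exists>Astar>0. \<forall>A. 0 < A \<and> A < Astar \<longrightarrow>
       (\<forall>E. isoperimetric p M A E \<longrightarrow> E \<subseteq> ball 0 \<rho>) \<and>
       (\<forall>E. isoperimetric p B A E \<longrightarrow> E \<subseteq> ball 0 \<rho>) \<and>
       {E. isoperimetric p B A E} = (\<lambda>E. (\<lambda>z. cis \<phi> * z) ` E) ` {E. isoperimetric p M A E})"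
proof -
  obtain \<phi> \<theta> \<rho> where \<rho>: "0 < \<rho>" and \<theta>: "0 < \<theta>" "\<theta> \<le> 2 * pi" and M: "M = sector \<theta>"
    and near: "B \<inter> ball 0 \<rho> = (*) (cis \<phi>) ` M \<inter> ball 0 \<rho>"
    by (rule polygon_near_origin[OF polygon B origin plane half_plane sector])
  define C where "C = (*) (cis \<phi>) ` M"
  have C: "conical C" unfolding C_def M by (rule conical_rotated_sector[OF \<theta>])
  have tiledB: "tiled B B"
    unfolding B using polygon_region_compact[OF polygon] polygon_locally_conical[OF polygon]
    by (rule locally_conical_tiled)
  have closedB: "closed B" unfolding B by (rule compact_imp_closed[OF polygon_region_compact[OF polygon]])
  obtain AB where AB: "0 < AB"
    "\<And>A E. 0 < A \<Longrightarrow> A < AB \<Longrightarrow> isoperimetric p B A E \<longleftrightarrow> isoperimetric_within p C \<rho> A E"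
    using isoperimetric_iff_within[OF p \<rho> C near[folded C_def] closedB tiledB] by metis
  obtain AC where AC: "0 < AC"
    "\<And>A E. 0 < A \<Longrightarrow> A < AC \<Longrightarrow> isoperimetric p C A E \<longleftrightarrow> isoperimetric_within p C \<rho> A E"
    using isoperimetric_iff_within[OF p \<rho> C refl conical_closed[OF C] conical_tiled[OF C]] by metis
  have rot: "isoperimetric p C A ((*) (cis \<phi>) ` E) \<longleftrightarrow> isoperimetric p M A E" for A E
    unfolding C_def by (rule isoperimetric_mult) simp
  have unrot: "(*) (cis \<phi>) ` (*) (cis (- \<phi>)) ` E = E" for E
    by (simp add: image_image mult.assoc[symmetric] cis_mult)
  show ?thesis
  proof (rule exI[of _ \<phi>], rule exI[of _ \<rho>], intro conjI exI[of _ "min AB AC"] allI impI)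
    show "(\<lambda>z. cis \<phi> * z) ` (M \<inter> ball 0 \<rho>) = B \<inter> ball 0 \<rho>"
      unfolding near by (rule rotate_ball) simp
    fix A assume A: "0 < A \<and> A < min AB AC"
    have iff: "isoperimetric p B A E \<longleftrightarrow> isoperimetric p C A E" for E using AB(2) AC(2) A by simp
    have inB: "E \<subseteq> ball 0 \<rho>" if "isoperimetric p B A E" for E
      using that AB(2)[of A E] A by (simp add: isoperimetric_within_def)
    then show "E \<subseteq> ball 0 \<rho>" if "isoperimetric p B A E" for E using that .
    show "E \<subseteq> ball 0 \<rho>" if "isoperimetric p M A E" for E
    proof -
      have "(*) (cis \<phi>) ` E \<subseteq> ball 0 \<rho>" using that inB rot iff by blast
      then show ?thesis by (auto simp: norm_mult)
    qed
    show "{E. isoperimetric p B A E} = (\<lambda>E. (\<lambda>z. cis \<phi> * z) ` E) ` {E. isoperimetric p M A E}"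
    proof (intro equalityI subsetI)
      fix E assume "E \<in> {E. isoperimetric p B A E}"
      then have "isoperimetric p C A ((*) (cis \<phi>) ` (*) (cis (- \<phi>)) ` E)" by (simp add: iff unrot)
      then have "(*) (cis (- \<phi>)) ` E \<in> {E. isoperimetric p M A E}" by (simp add: rot)
      then show "E \<in> (\<lambda>E. (\<lambda>z. cis \<phi> * z) ` E) ` {E. isoperimetric p M A E}"
        by (intro image_eqI[of _ _ "(*) (cis (- \<phi>)) ` E"]) (simp_all only: unrot)
    qed (auto simp: iff rot)
  qed (use \<rho> AB(1) AC(1) in auto)
qed

end
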